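(* Let $(E,\langle\cdot,\cdot\rangle,\Theta)$ be a Courant algebroid over a manifold $M$ and let $\mathcal N:E\to E$ be a skew-symmetric vector bundle endomorphism that is proportional to a generalized almost cps structure, and write $\mathcal N^2=\lambda\,\mathrm{Id}_E$ with $\lambda\in\mathbb R$. Then: (i) The torsion $T_\Theta\mathcal N:\Gamma E\times\Gamma E\to\Gamma E$ is $C^\infty(M)$-linear in both arguments and skew-symmetric, and it defines (through $\widetilde{T_\Theta\mathcal N}(u,v,w)=\langle (T_\Theta\mathcal N)(u,v),w\rangle$, which is a skew-symmetric covariant $3$-tensor on $E$) an element $\widetilde{T_\Theta\mathcal N}\in\mathcal A^3$. (ii) For all sections $u,v$ of $E$, $(T_\Theta\mathcal N)(u,v)=\{\{u,\widetilde{T_\Theta\mathcal N}\},v\}$. (iii) $\widetilde{T_\Theta\mathcal N}=-\tfrac12\left(\{\{\widetilde{\mathcal N},\Theta\},\widetilde{\mathcal N}\}+\lambda\,\Theta\right)$.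
   Context: Vector bundles are smooth, real, of finite rank over a manifold $M$; $\Gamma E$ denotes sections. Let $(E,\langle\cdot,\cdot\rangle)$ be a vector bundle with a fiberwise non-degenerate symmetric bilinear form. Its minimal symplectic realization is the graded manifold $\widetilde E=j^!(T^*[2]E[1])$, where $j:E[1]\to E[1]\oplus E^*[1]$, $u\mapsto(u,\frac12\langle u,\cdot\rangle)$, and $j^!$ denotes pull-back by $j$. $\mathcal A=\bigoplus_k\mathcal A^k$ is the graded algebra of functions on $\widetilde E$, with its canonical Poisson bracket $\{\cdot,\cdot\}$ of degree $-2$: $\{a,b\}=-(-1)^{|a||b|}\{b,a\}$, $\{a,bc\}=\{a,b\}c+(-1)^{|a||b|}b\{a,c\}$, $\{a,\{b,c\}\}=\{\{a,b\},c\}+(-1)^{|a||b|}\{b,\{a,c\}\}$. For a local basis $(e_a)$ of $\Gamma E$ with $g_{ab}=\langle e_a,e_b\rangle$ constant, local coordinates on $\widetilde E$ are $(q^i,\tau^a,p_i)$ of degrees $0,1,2$, whose non-vanishing brackets are $\{q^i,p_j\}=\delta^i_j$, $\{\tau^a,\tau^b\}=g^{ab}$. One has $\mathcal A^0=C^\infty(M)$, $\mathcal A^1=\Gamma E$ (with $u=u^ae_a$ identified with $g_{ab}u^a\tau^b$), and $\{u,v\}=\langle u,v\rangle$ for sections $u,v$. A Courant algebroid structure on $(E,\langle\cdot,\cdot\rangle)$ is an element $\Theta\in\mathcal A^3$ with $\{\Theta,\Theta\}=0$; its anchor is $\rho(u)f=\{\{u,\Theta\},f\}$ and its (Dorfman)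 bracket is $[u,v]=\{\{u,\Theta\},v\}$, for $u,v\in\Gamma E$, $f\in C^\infty(M)$. An endomorphism $\mathcal N$ of $E$ is skew-symmetric if $\langle\mathcal Nu,v\rangle+\langle u,\mathcal Nv\rangle=0$ for all $u,v$; then $\widetilde{\mathcal N}\in\mathcal A^2$ denotes the unique element with $\mathcal N(u)=\{u,\widetilde{\mathcal N}\}$ for all $u\in\Gamma E$. Set $[u,v]_{\mathcal N}=[\mathcal Nu,v]+[u,\mathcal Nv]-\mathcal N[u,v]$. The torsion of $\mathcal N$ is $(T_\Theta\mathcal N)(u,v)=[\mathcal Nu,\mathcal Nv]-\mathcal N[u,v]_{\mathcal N}$. A generalized almost cps structure on $E$ is a skew-symmetric endomorphism with square $-\mathrm{Id}_E$, $\mathrm{Id}_E$ or $0$; "proportional to" means equal to a real constant multiple of. A skew-symmetric covariant $3$-tensor $t$ on $E$ is identified with the element $\widetilde t\in\mathcal A^3$ (locally a cubic expression in the $\tau^a$ with coefficients in $C^\infty(M)$) such that $\{\{\{u,\widetilde t\},v\},w\}=t(u,v,w)$ for all $u,v,w\in\Gamma E$. *)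

theory Defs
  imports "HOL-Analysis.Analysis" "HOL-Library.FSet" "HOL-Library.Multiset"
begin

section \<open>Polynomials in odd variables \<open>\<tau>\<^sub>a\<close> and even variables \<open>p\<^sub>i\<close>\<close>

text \<open>
  The algebra $\Lambda[\tau_0,\tau_1,\dots]\otimes\mathbb R[p_0,p_1,\dots]$.  A key \<open>(I, \<mu>)\<close> stands
  for the monomial $\tau_{a_1}\cdots\tau_{a_k}\,p^\mu$, where $a_1<\dots<a_k$ are the elements of
  \<open>I\<close>.
\<close>

type_synonym key = "nat fset \<times> nat multiset"

typedef superpoly = "{f :: key \<Rightarrow> real. finite {k. f k \<noteq> 0}}"
  morphisms coeff Superpoly
  by (rule exI[of _ "\<lambda>_. 0"]) simp

setup_lifting type_definition_superpoly

lemma superpoly_eqI: "(\<And>k. coeff a k = coeff b k) \<Longrightarrow> a = b"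
  by (metis coeff_inject ext)

lemma finite_coeff [simp]: "finite {k. coeff a k \<noteq> 0}"
  using coeff[of a] by simp

instantiation superpoly :: real_vector
begin

lift_definition zero_superpoly :: superpoly is "\<lambda>_. 0" by simp

lift_definition plus_superpoly :: "superpoly \<Rightarrow> superpoly \<Rightarrow> superpoly"
  is "\<lambda>f g k. f k + g k"
proof -
  fix f g :: "key \<Rightarrow> real"
  assume fin: "finite {k. f k \<noteq> 0}" "finite {k. g k \<noteq> 0}"
  show "finite {k. f k + g k \<noteq> 0}"
    by (rule finite_subset[of _ "{k. f k \<noteq> 0} \<union> {k. g k \<noteq> 0}"]) (use fin in auto)
qed

lift_definition minus_superpoly :: "superpoly \<Rightarrow> superpoly \<Rightarrow> superpoly"
  is "\<lambda>f g k. f k - g k"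
proof -
  fix f g :: "key \<Rightarrow> real"
  assume fin: "finite {k. f k \<noteq> 0}" "finite {k. g k \<noteq> 0}"
  show "finite {k. f k - g k \<noteq> 0}"
    by (rule finite_subset[of _ "{k. f k \<noteq> 0} \<union> {k. g k \<noteq> 0}"]) (use fin in auto)
qed

lift_definition uminus_superpoly :: "superpoly \<Rightarrow> superpoly"
  is "\<lambda>f k. - f k" by simp

lift_definition scaleR_superpoly :: "real \<Rightarrow> superpoly \<Rightarrow> superpoly"
  is "\<lambda>r f k. r * f k"
  by (erule finite_subset[rotated]) auto

instance
proof
  fix a b c :: superpoly and r s :: real
  show "a + b + c = a + (b + c)" by transfer (simp add: add.assoc)
  show "a + b = b + a" by transfer (simp add: add.commute)
  show "0 + a = a" by transfer simp
  show "- a + a = 0" by transfer simp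
  show "a - b = a + - b" by transfer simp
  show "r *\<^sub>R (a + b) = r *\<^sub>R a + r *\<^sub>R b" by transfer (simp add: distrib_left)
  show "(r + s) *\<^sub>R a = r *\<^sub>R a + s *\<^sub>R a" by transfer (simp add: distrib_right)
  show "r *\<^sub>R s *\<^sub>R a = (r * s) *\<^sub>R a" by transfer (simp add: mult.assoc)
  show "1 *\<^sub>R a = a" by transfer simp
qed

end

lemma coeff_add [simp]: "coeff (a + b) k = coeff a k + coeff b k"
  by (simp add: plus_superpoly.rep_eq)

lemma coeff_zero [simp]: "coeff 0 k = 0"
  by (simp add: zero_superpoly.rep_eq)

lemma coeff_scaleR [simp]: "coeff (r *\<^sub>R a) k = r * coeff a k"
  by (simp add: scaleR_superpoly.rep_eq)

lemma coeff_sum: "coeff (\<Sum>i\<in>S. f i) k = (\<Sum>i\<in>S. coeff (f i) k)"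
  by (induction S rule: infinite_finite_induct) auto

lift_definition mon :: "key \<Rightarrow> superpoly" is "\<lambda>k k'. if k' = k then 1 else 0"
  by simp

lemma coeff_mon: "coeff (mon k) k' = (if k' = k then 1 else 0)"
  by (simp add: mon.rep_eq)

definition lin_ext :: "(key \<Rightarrow> superpoly) \<Rightarrow> superpoly \<Rightarrow> superpoly" where
  "lin_ext F a = (\<Sum>k | coeff a k \<noteq> 0. coeff a k *\<^sub>R F k)"

lemma lin_ext_superset:
  assumes "finite S" "{k. coeff a k \<noteq> 0} \<subseteq> S"
  shows "lin_ext F a = (\<Sum>k\<in>S. coeff a k *\<^sub>R F k)"
  unfolding lin_ext_def by (rule sum.mono_neutral_left) (use assms in auto)

lemma lin_ext_add: "lin_ext F (a + b) = lin_ext F a + lin_ext F b"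
proof -
  let ?S = "{k. coeff a k \<noteq> 0} \<union> {k. coeff b k \<noteq> 0}"
  have "lin_ext F c = (\<Sum>k\<in>?S. coeff c k *\<^sub>R F k)" if "c \<in> {a, b, a + b}" for c
    by (rule lin_ext_superset) (use that in auto)
  then show ?thesis
    by (simp add: sum.distrib scaleR_add_left)
qed

lemma lin_ext_scaleR: "lin_ext F (r *\<^sub>R a) = r *\<^sub>R lin_ext F a"
proof -
  have "lin_ext F c = (\<Sum>k | coeff a k \<noteq> 0. coeff c k *\<^sub>R F k)" if "c \<in> {a, r *\<^sub>R a}" for c
    by (rule lin_ext_superset) (use that in auto)
  then show ?thesis
    by (simp add: scaleR_sum_right)
qed

lemma linear_lin_ext: "linear (lin_ext F)"
  by (rule linearI) (simp_all add: lin_ext_add lin_ext_scaleR)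

lemma lin_ext_mon [simp]: "lin_ext F (mon k) = F k"
  by (subst lin_ext_superset[of "{k}"]) (auto simp: coeff_mon)

lemma lin_ext_mon_self: "lin_ext mon a = a"
proof (rule superpoly_eqI)
  fix k
  have "coeff (lin_ext mon a) k = (\<Sum>j | coeff a j \<noteq> 0. if j = k then coeff a j else 0)"
    unfolding lin_ext_def coeff_sum by (rule sum.cong) (auto simp: coeff_mon)
  then show "coeff (lin_ext mon a) k = coeff a k"
    by (simp add: sum.delta)
qed

lemma linear_eq_on_mon:
  fixes f g :: "superpoly \<Rightarrow> superpoly"
  assumes "linear f" "linear g" "\<And>k. f (mon k) = g (mon k)"
  shows "f a = g a"
proof -
  have "f (lin_ext mon a) = g (lin_ext mon a)"
    unfolding lin_ext_def
    by (simp add: assms(3) linear_sum[OF assms(1)] linear_sum[OF assms(2)]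
        linear_scale[OF assms(1)] linear_scale[OF assms(2)])
  then show ?thesis
    by (simp add: lin_ext_mon_self)
qed

lemma linear_lin_ext_arg:
  assumes "\<And>k. linear (\<lambda>b. F b k)"
  shows "linear (\<lambda>b. lin_ext (F b) a)"
  unfolding lin_ext_def
  by (rule linear_compose_sum, rule ballI, rule linear_compose_scale_right, rule assms)

definition shuffle_sign :: "nat set \<Rightarrow> nat set \<Rightarrow> real" where
  "shuffle_sign I J = (- 1) ^ card {(i, j). i \<in> I \<and> j \<in> J \<and> j < i}"

fun mon_mult :: "key \<Rightarrow> key \<Rightarrow> superpoly" where
  "mon_mult (I, \<mu>) (J, \<nu>) =
     (if I |\<inter>| J = {||} then shuffle_sign (fset I) (fset J) *\<^sub>R mon (I |\<union>| J, \<mu> + \<nu>) else 0)"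

lemma shuffle_sign_Un_left:
  assumes "finite I" "finite J" "finite K" "I \<inter> J = {}"
  shows "shuffle_sign (I \<union> J) K = shuffle_sign I K * shuffle_sign J K"
proof -
  have "{(i, j). i \<in> I \<union> J \<and> j \<in> K \<and> j < i} =
        {(i, j). i \<in> I \<and> j \<in> K \<and> j < i} \<union> {(i, j). i \<in> J \<and> j \<in> K \<and> j < i}"
    by auto
  moreover have "finite {(i, j). i \<in> I \<and> j \<in> K \<and> j < i}"
    by (rule finite_subset[of _ "I \<times> K"]) (use assms in auto)
  moreover have "finite {(i, j). i \<in> J \<and> j \<in> K \<and> j < i}"
    by (rule finite_subset[of _ "J \<times> K"]) (use assms in auto)
  moreover have "{(i, j). i \<in> I \<and> j \<in> K \<and> j < i} \<inter> {(i, j). i \<in> J \<and> j \<in> K \<and> j < i} = {}"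
    using assms by auto
  ultimately show ?thesis
    by (simp add: shuffle_sign_def card_Un_disjoint power_add)
qed

lemma shuffle_sign_Un_right:
  assumes "finite I" "finite J" "finite K" "J \<inter> K = {}"
  shows "shuffle_sign I (J \<union> K) = shuffle_sign I J * shuffle_sign I K"
proof -
  have "{(i, j). i \<in> I \<and> j \<in> J \<union> K \<and> j < i} =
        {(i, j). i \<in> I \<and> j \<in> J \<and> j < i} \<union> {(i, j). i \<in> I \<and> j \<in> K \<and> j < i}"
    by auto
  moreover have "finite {(i, j). i \<in> I \<and> j \<in> J \<and> j < i}"
    by (rule finite_subset[of _ "I \<times> J"]) (use assms in auto)
  moreover have "finite {(i, j). i \<in> I \<and> j \<in> K \<and> j < i}"
    by (rule finite_subset[of _ "I \<times> K"]) (use assms in auto)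
  moreover have "{(i, j). i \<in> I \<and> j \<in> J \<and> j < i} \<inter> {(i, j). i \<in> I \<and> j \<in> K \<and> j < i} = {}"
    using assms by auto
  ultimately show ?thesis
    by (simp add: shuffle_sign_def card_Un_disjoint power_add)
qed

instantiation superpoly :: real_algebra_1
begin

definition one_superpoly :: superpoly where
  "1 = mon ({||}, {#})"

definition times_superpoly :: "superpoly \<Rightarrow> superpoly \<Rightarrow> superpoly" where
  "a * b = lin_ext (\<lambda>k. lin_ext (mon_mult k) b) a"

lemma linear_times_left: "linear (\<lambda>a. a * b :: superpoly)"
  unfolding times_superpoly_def by (rule linear_lin_ext)

lemma linear_times_right: "linear (\<lambda>b. a * b :: superpoly)"
  unfolding times_superpoly_def by (rule linear_lin_ext_arg) (rule linear_lin_ext)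

lemma mon_times_mon: "mon k * mon l = mon_mult k l"
  by (simp add: times_superpoly_def)

lemma mon_assoc: "mon k * mon l * mon m = mon k * (mon l * mon m)"
proof -
  obtain I \<mu> J \<nu> K \<rho> where [simp]: "k = (I, \<mu>)" "l = (J, \<nu>)" "m = (K, \<rho>)"
    by (metis surj_pair)
  have scl: "r *\<^sub>R a * b = r *\<^sub>R (a * b)" "a * r *\<^sub>R b = r *\<^sub>R (a * b)"
    "0 * b = 0" "a * 0 = 0" for r and a b :: superpoly
    using linear_scale[OF linear_times_left[of b]] linear_scale[OF linear_times_right[of a]]
      linear_0[OF linear_times_left[of b]] linear_0[OF linear_times_right[of a]] by auto
  have dist: "(I |\<union>| J) |\<inter>| K = {||} \<longleftrightarrow> I |\<inter>| K = {||} \<and> J |\<inter>| K = {||}"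
    "I |\<inter>| (J |\<union>| K) = {||} \<longleftrightarrow> I |\<inter>| J = {||} \<and> I |\<inter>| K = {||}"
    by (simp_all add: inf_sup_distrib1 inf_sup_distrib2)
  show ?thesis
  proof (cases "I |\<inter>| J = {||} \<and> I |\<inter>| K = {||} \<and> J |\<inter>| K = {||}")
    case True
    then have "fset I \<inter> fset J = {}" "fset J \<inter> fset K = {}"
      by (metis bot_fset.rep_eq inf_fset.rep_eq)+
    with True show ?thesis
      by (simp add: mon_times_mon scl dist shuffle_sign_Un_left shuffle_sign_Un_right
          sup_assoc add.assoc)
  next
    case False
    then show ?thesis
      by (cases "I |\<inter>| J = {||}"; cases "J |\<inter>| K = {||}") (simp_all add: mon_times_mon scl dist)
  qed
qed

instance
proof
  fix a b c :: superpoly and r :: real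
  show "(a + b) * c = a * c + b * c"
    using linear_add[OF linear_times_left] .
  show "a * (b + c) = a * b + a * c"
    using linear_add[OF linear_times_right] .
  show "r *\<^sub>R a * b = r *\<^sub>R (a * b)"
    using linear_scale[OF linear_times_left] .
  show "a * r *\<^sub>R b = r *\<^sub>R (a * b)"
    using linear_scale[OF linear_times_right] .
  have one_mon: "1 * mon k = mon k" "mon k * 1 = mon k" for k
    by (cases k; simp add: one_superpoly_def mon_times_mon shuffle_sign_def)+
  show "1 * a = a"
    by (rule linear_eq_on_mon[OF linear_times_right linear_ident]) (rule one_mon)
  show "a * 1 = a"
    by (rule linear_eq_on_mon[OF linear_times_left linear_ident]) (rule one_mon)
  have "coeff 1 ({||}, {#}) \<noteq> coeff 0 ({||}, {#})"
    by (simp add: one_superpoly_def coeff_mon)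
  then show "(0::superpoly) \<noteq> 1"
    by metis
  have lin_l: "linear (\<lambda>x. f x * c)" if "linear f" for f :: "superpoly \<Rightarrow> superpoly" and c
    using linear_compose[OF that linear_times_left] by (simp add: o_def)
  have lin_r: "linear (\<lambda>x. c * f x)" if "linear f" for f :: "superpoly \<Rightarrow> superpoly" and c
    using linear_compose[OF that linear_times_right] by (simp add: o_def)
  have 1: "mon k * mon l * x = mon k * (mon l * x)" for k l x
    by (rule linear_eq_on_mon[of "\<lambda>x. mon k * mon l * x" "\<lambda>x. mon k * (mon l * x)"])
      (rule lin_l lin_r linear_ident mon_assoc)+
  have 2: "mon k * x * y = mon k * (x * y)" for k x y
    by (rule linear_eq_on_mon[of "\<lambda>x. mon k * x * y" "\<lambda>x. mon k * (x * y)"])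
      (rule lin_l[OF lin_r] lin_r[OF lin_l] linear_ident 1)+
  show "a * b * c = a * (b * c)"
    by (rule linear_eq_on_mon[of "\<lambda>x. x * b * c" "\<lambda>x. x * (b * c)"])
      (rule lin_l[OF lin_l] lin_l linear_ident 2)+
qed

end

definition tau :: "nat \<Rightarrow> superpoly" where
  "tau a = mon ({|a|}, {#})"

definition mom :: "nat \<Rightarrow> superpoly" where
  "mom i = mon ({||}, {#i#})"

definition d_mom :: "nat \<Rightarrow> superpoly \<Rightarrow> superpoly" where
  "d_mom i = lin_ext (\<lambda>(I, \<mu>). real (count \<mu> i) *\<^sub>R mon (I, \<mu> - {#i#}))"

definition d_tau_left :: "nat \<Rightarrow> superpoly \<Rightarrow> superpoly" where
  "d_tau_left a = lin_ext (\<lambda>(I, \<mu>). if a |\<in>| I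
     then (- 1) ^ card {j. j |\<in>| I \<and> j < a} *\<^sub>R mon (I |-| {|a|}, \<mu>) else 0)"

definition d_tau_right :: "nat \<Rightarrow> superpoly \<Rightarrow> superpoly" where
  "d_tau_right a = lin_ext (\<lambda>(I, \<mu>). if a |\<in>| I
     then (- 1) ^ card {j. j |\<in>| I \<and> a < j} *\<^sub>R mon (I |-| {|a|}, \<mu>) else 0)"

text \<open>The algebra homomorphism with \<open>\<tau>\<^sub>a \<mapsto> t a\<close> and \<open>p\<^sub>i \<mapsto> P i\<close>; it is only used
  for odd \<open>t a\<close> and even \<open>P i\<close>.\<close>

definition substitute :: "(nat \<Rightarrow> superpoly) \<Rightarrow> (nat \<Rightarrow> superpoly) \<Rightarrow> superpoly \<Rightarrow> superpoly" where
  "substitute t P = lin_ext (\<lambda>(I, \<mu>). prod_list (map t (sorted_list_of_set (fset I))) *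
                                prod_list (map P (sorted_list_of_multiset \<mu>)))"


section \<open>Smooth manifolds\<close>

text \<open>
  $\mathbb R^n$ is the carrier of the library's \<open>Euclidean_space n\<close>, i.e. functions
  \<open>nat \<Rightarrow> real\<close> vanishing from \<open>n\<close> on, which includes \<open>n = 0\<close>.  A function is smooth if its
  iterated partial derivatives of all orders exist and are continuous.
\<close>

definition partial :: "nat \<Rightarrow> ((nat \<Rightarrow> real) \<Rightarrow> real) \<Rightarrow> (nat \<Rightarrow> real) \<Rightarrow> real" where
  "partial i f y = deriv (\<lambda>t. f (y(i := t))) (y i)"

fun Ck_on :: "nat \<Rightarrow> nat \<Rightarrow> (nat \<Rightarrow> real) set \<Rightarrow> ((nat \<Rightarrow> real) \<Rightarrow> real) \<Rightarrow> bool" where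
  "Ck_on n 0 V f \<longleftrightarrow> continuous_on V f"
| "Ck_on n (Suc k) V f \<longleftrightarrow> continuous_on V f \<and>
     (\<forall>i<n. (\<forall>y\<in>V. (\<lambda>t. f (y(i := t))) differentiable at (y i)) \<and> Ck_on n k V (partial i f))"

definition Cinf_on :: "nat \<Rightarrow> (nat \<Rightarrow> real) set \<Rightarrow> ((nat \<Rightarrow> real) \<Rightarrow> real) \<Rightarrow> bool" where
  "Cinf_on n V f \<longleftrightarrow> (\<forall>k. Ck_on n k V f)"

text \<open>The manifold is the whole type \<open>'m\<close>; values of a chart outside its domain are irrelevant.\<close>

type_synonym 'm chart = "'m set \<times> ('m \<Rightarrow> nat \<Rightarrow> real)"

definition is_chart :: "nat \<Rightarrow> 'm::topological_space chart \<Rightarrow> bool" where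
  "is_chart n = (\<lambda>(U, \<phi>). open U \<and> openin (Euclidean_space n) (\<phi> ` U) \<and>
     homeomorphic_map (top_of_set U) (subtopology (Euclidean_space n) (\<phi> ` U)) \<phi>)"

definition smooth_transition :: "nat \<Rightarrow> 'm chart \<Rightarrow> 'm chart \<Rightarrow> bool" where
  "smooth_transition n = (\<lambda>(U, \<phi>) (V, \<psi>).
     \<forall>i<n. Cinf_on n (\<phi> ` (U \<inter> V)) (\<lambda>y. \<psi> (inv_into U \<phi> y) i))"

record 'm manifold =
  dimension :: nat
  charts :: "'m chart set"

text \<open>\<open>charts M\<close> is a maximal atlas.\<close>

definition is_manifold ::
  "('m::{t2_space,second_countable_topology}, 'z) manifold_scheme \<Rightarrow> bool" where
  "is_manifold M \<longleftrightarrow>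
     (\<forall>c\<in>charts M. is_chart (dimension M) c) \<and>
     (\<Union>c\<in>charts M. fst c) = UNIV \<and>
     (\<forall>c\<in>charts M. \<forall>d\<in>charts M. smooth_transition (dimension M) c d) \<and>
     (\<forall>c. is_chart (dimension M) c \<and>
          (\<forall>d\<in>charts M. smooth_transition (dimension M) c d \<and>
                         smooth_transition (dimension M) d c) \<longrightarrow> c \<in> charts M)"

definition smooth_on :: "('m, 'z) manifold_scheme \<Rightarrow> 'm set \<Rightarrow> ('m \<Rightarrow> real) \<Rightarrow> bool" where
  "smooth_on M U f \<longleftrightarrow>
     (\<forall>(V, \<phi>)\<in>charts M. Cinf_on (dimension M) (\<phi> ` (U \<inter> V)) (\<lambda>y. f (inv_into V \<phi> y)))"

definition smooth_functions :: "('m, 'z) manifold_scheme \<Rightarrow> ('m \<Rightarrow> real) set" where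
  "smooth_functions M = {f. smooth_on M UNIV f}"

definition chart_deriv :: "'m chart \<Rightarrow> nat \<Rightarrow> ('m \<Rightarrow> real) \<Rightarrow> 'm \<Rightarrow> real" where
  "chart_deriv = (\<lambda>(U, \<phi>) i f x. partial i (\<lambda>y. f (inv_into U \<phi> y)) (\<phi> x))"


section \<open>Vector bundles with a non-degenerate symmetric bilinear form\<close>

text \<open>
  The fibres are subspaces of one real vector space, which merely serves as a common type for
  them (one may take the direct sum of all fibres); the smooth structure is given
  by \<open>frames\<close>, the set of all smooth local frames $(U, (e_a)_{a<r})$.
\<close>

type_synonym ('m, 'v) frame = "'m set \<times> (nat \<Rightarrow> 'm \<Rightarrow> 'v)"

record ('m, 'v) metric_bundle = "'m manifold" +
  rank :: nat
  fibre :: "'m \<Rightarrow> 'v set"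
  frames :: "('m, 'v) frame set"
  metric :: "'m \<Rightarrow> 'v \<Rightarrow> 'v \<Rightarrow> real"

definition is_frame ::
  "('m::topological_space, 'v::real_vector, 'z) metric_bundle_scheme \<Rightarrow> ('m, 'v) frame \<Rightarrow> bool"
  where
  "is_frame E = (\<lambda>(U, e). open U \<and>
     (\<forall>x\<in>U. inj_on (\<lambda>a. e a x) {..<rank E} \<and> independent ((\<lambda>a. e a x) ` {..<rank E}) \<and>
            span ((\<lambda>a. e a x) ` {..<rank E}) = fibre E x))"

definition frame_coord ::
  "('m, 'v::real_vector, 'z) metric_bundle_scheme \<Rightarrow> (nat \<Rightarrow> 'm \<Rightarrow> 'v) \<Rightarrow> 'm \<Rightarrow> 'v \<Rightarrow> nat \<Rightarrow> real"
  where
  "frame_coord E e x v a = representation ((\<lambda>a. e a x) ` {..<rank E}) v (e a x)"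

definition frames_compatible ::
  "('m, 'v::real_vector, 'z) metric_bundle_scheme \<Rightarrow> ('m, 'v) frame \<Rightarrow> ('m, 'v) frame \<Rightarrow> bool"
  where
  "frames_compatible E = (\<lambda>(U, e) (U', e'). \<forall>a<rank E. \<forall>b<rank E.
     smooth_on E (U \<inter> U') (\<lambda>x. frame_coord E e' x (e b x) a))"

definition is_vector_bundle ::
  "('m::{t2_space,second_countable_topology}, 'v::real_vector, 'z) metric_bundle_scheme \<Rightarrow> bool"
  where
  "is_vector_bundle E \<longleftrightarrow> is_manifold E \<and>
     (\<forall>x. subspace (fibre E x)) \<and>
     (\<forall>c\<in>frames E. is_frame E c) \<and>
     (\<Union>c\<in>frames E. fst c) = UNIV \<and>
     (\<forall>c\<in>frames E. \<forall>d\<in>frames E. frames_compatible E c d) \<and>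
     (\<forall>c. is_frame E c \<and>
          (\<forall>d\<in>frames E. frames_compatible E c d \<and> frames_compatible E d c) \<longrightarrow> c \<in> frames E)"

definition is_metric ::
  "('m, 'v::real_vector, 'z) metric_bundle_scheme \<Rightarrow> bool" where
  "is_metric E \<longleftrightarrow>
     (\<forall>x. \<forall>u\<in>fibre E x. \<forall>v\<in>fibre E x. \<forall>w\<in>fibre E x. \<forall>r s.
        metric E x (r *\<^sub>R u + s *\<^sub>R v) w = r * metric E x u w + s * metric E x v w) \<and>
     (\<forall>x. \<forall>u\<in>fibre E x. \<forall>v\<in>fibre E x. metric E x u v = metric E x v u) \<and>
     (\<forall>x. \<forall>u\<in>fibre E x. (\<forall>v\<in>fibre E x. metric E x u v = 0) \<longrightarrow> u = 0) \<and>
     (\<forall>(U, e)\<in>frames E. \<forall>a<rank E. \<forall>b<rank E. smooth_on E U (\<lambda>x. metric E x (e a x) (e b x)))"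

definition is_metric_bundle ::
  "('m::{t2_space,second_countable_topology}, 'v::real_vector, 'z) metric_bundle_scheme \<Rightarrow> bool"
  where
  "is_metric_bundle E \<longleftrightarrow> is_vector_bundle E \<and> is_metric E"

definition sections ::
  "('m, 'v::real_vector, 'z) metric_bundle_scheme \<Rightarrow> ('m \<Rightarrow> 'v) set" where
  "sections E = {u. (\<forall>x. u x \<in> fibre E x) \<and>
     (\<forall>(U, e)\<in>frames E. \<forall>a<rank E. smooth_on E U (\<lambda>x. frame_coord E e x (u x) a))}"

definition is_endomorphism ::
  "('m, 'v::real_vector, 'z) metric_bundle_scheme \<Rightarrow> ('m \<Rightarrow> 'v \<Rightarrow> 'v) \<Rightarrow> bool" where
  "is_endomorphism E N \<longleftrightarrow>
     (\<forall>x. N x ` fibre E x \<subseteq> fibre E x) \<and>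
     (\<forall>x. \<forall>u\<in>fibre E x. \<forall>v\<in>fibre E x. \<forall>r s.
        N x (r *\<^sub>R u + s *\<^sub>R v) = r *\<^sub>R N x u + s *\<^sub>R N x v) \<and>
     (\<forall>(U, e)\<in>frames E. \<forall>a<rank E. \<forall>b<rank E.
        smooth_on E U (\<lambda>x. frame_coord E e x (N x (e b x)) a))"

definition is_skew ::
  "('m, 'v::real_vector, 'z) metric_bundle_scheme \<Rightarrow> ('m \<Rightarrow> 'v \<Rightarrow> 'v) \<Rightarrow> bool" where
  "is_skew E N \<longleftrightarrow>
     (\<forall>x. \<forall>u\<in>fibre E x. \<forall>v\<in>fibre E x. metric E x (N x u) v + metric E x u (N x v) = 0)"

definition almost_cps ::
  "('m, 'v::real_vector, 'z) metric_bundle_scheme \<Rightarrow> ('m \<Rightarrow> 'v \<Rightarrow> 'v) \<Rightarrow> bool" where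
  "almost_cps E J \<longleftrightarrow> is_endomorphism E J \<and> is_skew E J \<and>
     ((\<forall>x. \<forall>v\<in>fibre E x. J x (J x v) = - v) \<or>
      (\<forall>x. \<forall>v\<in>fibre E x. J x (J x v) = v) \<or>
      (\<forall>x. \<forall>v\<in>fibre E x. J x (J x v) = 0))"

definition proportional_to_almost_cps ::
  "('m, 'v::real_vector, 'z) metric_bundle_scheme \<Rightarrow> ('m \<Rightarrow> 'v \<Rightarrow> 'v) \<Rightarrow> bool" where
  "proportional_to_almost_cps E N \<longleftrightarrow>
     (\<exists>J. almost_cps E J \<and> (\<exists>c. \<forall>x. \<forall>v\<in>fibre E x. N x v = c *\<^sub>R J x v))"


section \<open>Functions on the minimal symplectic realization\<close>

text \<open>
  The graded manifold $\widetilde E=j^!(T^*[2]E[1])$ is glued from its coordinate domains.  A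
  local coordinate system is a chart together with a frame on the same domain in which
  the Gram matrix is constant.  Such systems exist around every point (orthonormal frames).
\<close>

type_synonym ('m, 'v) coords = "'m set \<times> ('m \<Rightarrow> nat \<Rightarrow> real) \<times> (nat \<Rightarrow> 'm \<Rightarrow> 'v)"

definition coord_systems ::
  "('m, 'v::real_vector, 'z) metric_bundle_scheme \<Rightarrow> ('m, 'v) coords set" where
  "coord_systems E = {(U, \<phi>, e). (U, \<phi>) \<in> charts E \<and> (U, e) \<in> frames E \<and>
     (\<forall>a<rank E. \<forall>b<rank E. \<forall>x\<in>U. \<forall>y\<in>U.
        metric E x (e a x) (e b x) = metric E y (e a y) (e b y))}"

definition gram ::
  "('m, 'v, 'z) metric_bundle_scheme \<Rightarrow> (nat \<Rightarrow> 'm \<Rightarrow> 'v) \<Rightarrow> 'm \<Rightarrow> nat \<Rightarrow> nat \<Rightarrow> real" where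
  "gram E e x a b = metric E x (e a x) (e b x)"

definition gram_inv ::
  "('m, 'v, 'z) metric_bundle_scheme \<Rightarrow> (nat \<Rightarrow> 'm \<Rightarrow> 'v) \<Rightarrow> 'm \<Rightarrow> nat \<Rightarrow> nat \<Rightarrow> real" where
  "gram_inv E e x = (SOME h. \<forall>a<rank E. \<forall>c<rank E.
     (\<Sum>b<rank E. gram E e x a b * h b c) = (if a = c then 1 else 0))"

text \<open>
  Coordinate changes.  Let $(q,\tau,p)$ and $(q',\tau',p')$ belong to the charts and frames
  $(\varphi,e)$ and $(\varphi',e')$, with $e_b=\sum_a T^a_b e'_a$, so $\tau'^a=\sum_b T^a_b\tau^b$.
  On $T^*[2]E[1]$, with coordinates $(q,\tau,p,\theta)$ and $\{q^i,p_j\}=\delta^i_j$,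
  $\{\tau^a,\theta_b\}=\delta^a_b$, the cotangent lift of a change of coordinates of $E[1]$ is
  $\theta_b=\sum_a T^a_b\theta'_a$ and
  $p'_j=\sum_i\frac{\partial q^i}{\partial q'^j}\bigl(p_i+\sum_{a,b}\frac{\partial T^a_b}{\partial q^i}
  \tau^b\theta'_a\bigr)$.  Pulling back by $j$ amounts to setting
  $\theta'_a=\frac12\sum_b g'_{ab}\tau'^b$.  The three definitions below are
  $\tau'^a$, $\theta'_a$ and $p'_j$, at a point \<open>x\<close>, as polynomials in $\tau^b$, $p_i$.
\<close>

fun new_tau :: "('m, 'v::real_vector, 'z) metric_bundle_scheme \<Rightarrow>
    ('m, 'v) coords \<Rightarrow> ('m, 'v) coords \<Rightarrow> 'm \<Rightarrow> nat \<Rightarrow> superpoly" where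
  "new_tau E (U, \<phi>, e) (U', \<phi>', e') x a =
     (\<Sum>b<rank E. frame_coord E e' x (e b x) a *\<^sub>R tau b)"

fun new_theta :: "('m, 'v::real_vector, 'z) metric_bundle_scheme \<Rightarrow>
    ('m, 'v) coords \<Rightarrow> ('m, 'v) coords \<Rightarrow> 'm \<Rightarrow> nat \<Rightarrow> superpoly" where
  "new_theta E (U, \<phi>, e) (U', \<phi>', e') x a =
     (1 / 2) *\<^sub>R (\<Sum>b<rank E. gram E e' x a b *\<^sub>R new_tau E (U, \<phi>, e) (U', \<phi>', e') x b)"

fun new_mom :: "('m, 'v::real_vector, 'z) metric_bundle_scheme \<Rightarrow>
    ('m, 'v) coords \<Rightarrow> ('m, 'v) coords \<Rightarrow> 'm \<Rightarrow> nat \<Rightarrow> superpoly" where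
  "new_mom E (U, \<phi>, e) (U', \<phi>', e') x j =
     (\<Sum>i<dimension E. chart_deriv (U', \<phi>') j (\<lambda>y. \<phi> y i) x *\<^sub>R
        (mom i + (\<Sum>a<rank E. \<Sum>b<rank E.
           chart_deriv (U, \<phi>) i (\<lambda>y. frame_coord E e' y (e b y) a) x *\<^sub>R
             (tau b * new_theta E (U, \<phi>, e) (U', \<phi>', e') x a))))"

text \<open>
  A function on $\widetilde E$ is a family of local expressions
  $\sum_{I,\mu}f_{I,\mu}(q)\,\tau^Ip^\mu$, one for each coordinate system (and \<open>0\<close> by convention
  outside its domain), related by the coordinate changes.  The degrees of $q,\tau,p$ are $0,1,2$.
\<close>

type_synonym ('m, 'v) graded_function = "('m, 'v) coords \<Rightarrow> 'm \<Rightarrow> superpoly"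

definition graded_functions :: "('m, 'v::real_vector, 'z) metric_bundle_scheme \<Rightarrow> nat \<Rightarrow>
    ('m, 'v) graded_function set" where
  "graded_functions E k = {a.
     (\<forall>c x. c \<notin> coord_systems E \<or> x \<notin> fst c \<longrightarrow> a c x = 0) \<and>
     (\<forall>c\<in>coord_systems E.
        (\<forall>I \<mu>. smooth_on E (fst c) (\<lambda>x. coeff (a c x) (I, \<mu>))) \<and>
        (\<forall>x\<in>fst c. \<forall>I \<mu>. coeff (a c x) (I, \<mu>) \<noteq> 0 \<longrightarrow>
           fset I \<subseteq> {..<rank E} \<and> set_mset \<mu> \<subseteq> {..<dimension E} \<and> fcard I + 2 * size \<mu> = k)) \<and>
     (\<forall>c\<in>coord_systems E. \<forall>c'\<in>coord_systems E. \<forall>x\<in>fst c \<inter> fst c'.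
        a c x = substitute (new_tau E c c' x) (new_mom E c c' x) (a c' x))}"

text \<open>Coefficientwise $\partial/\partial q^i$.\<close>

definition d_base :: "'m chart \<Rightarrow> nat \<Rightarrow> ('m \<Rightarrow> superpoly) \<Rightarrow> 'm \<Rightarrow> superpoly" where
  "d_base c i a x = Superpoly (\<lambda>k. chart_deriv c i (\<lambda>y. coeff (a y) k) x)"

text \<open>
  The Poisson bracket of degree \<open>-2\<close> with $\{q^i,p_j\}=\delta^i_j$, $\{\tau^a,\tau^b\}=g^{ab}$:
  the stated graded antisymmetry and Leibniz rule force
  $\{a,b\}=\sum_i\bigl(\partial_{q^i}a\,\partial_{p_i}b-\partial_{p_i}a\,\partial_{q^i}b\bigr)
  +\sum_{a,b}g^{ab}\,(a\overleftarrow\partial_{\tau^a})(\overrightarrow\partial_{\tau^b}b)$.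
\<close>

definition bracket :: "('m, 'v::real_vector, 'z) metric_bundle_scheme \<Rightarrow>
    ('m, 'v) graded_function \<Rightarrow> ('m, 'v) graded_function \<Rightarrow> ('m, 'v) graded_function" where
  "bracket E f h = (\<lambda>(U, \<phi>, e) x.
     if (U, \<phi>, e) \<in> coord_systems E \<and> x \<in> U then
       let f' = f (U, \<phi>, e); h' = h (U, \<phi>, e) in
       (\<Sum>i<dimension E. d_base (U, \<phi>) i f' x * d_mom i (h' x)
                        - d_mom i (f' x) * d_base (U, \<phi>) i h' x) +
       (\<Sum>a<rank E. \<Sum>b<rank E.
          gram_inv E e x a b *\<^sub>R (d_tau_right a (f' x) * d_tau_left b (h' x)))
     else 0)"

text \<open>The identifications $C^\infty(M)=\mathcal A^0$ and $\Gamma E=\mathcal A^1$,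
  $u\mapsto g_{ab}u^a\tau^b$.\<close>

definition of_fun :: "('m, 'v::real_vector, 'z) metric_bundle_scheme \<Rightarrow> ('m \<Rightarrow> real) \<Rightarrow>
    ('m, 'v) graded_function" where
  "of_fun E f = (\<lambda>c x. if c \<in> coord_systems E \<and> x \<in> fst c then f x *\<^sub>R 1 else 0)"

definition of_section :: "('m, 'v::real_vector, 'z) metric_bundle_scheme \<Rightarrow> ('m \<Rightarrow> 'v) \<Rightarrow>
    ('m, 'v) graded_function" where
  "of_section E u = (\<lambda>(U, \<phi>, e) x.
     if (U, \<phi>, e) \<in> coord_systems E \<and> x \<in> U then
       (\<Sum>a<rank E. \<Sum>b<rank E. (gram E e x a b * frame_coord E e x (u x) a) *\<^sub>R tau b)
     else 0)"

definition section_of :: "('m, 'v::real_vector, 'z) metric_bundle_scheme \<Rightarrow>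
    ('m, 'v) graded_function \<Rightarrow> 'm \<Rightarrow> 'v" where
  "section_of E a = (THE u. u \<in> sections E \<and> of_section E u = a)"


section \<open>Courant algebroids and torsion\<close>

definition is_courant :: "('m, 'v::real_vector, 'z) metric_bundle_scheme \<Rightarrow>
    ('m, 'v) graded_function \<Rightarrow> bool" where
  "is_courant E \<Theta> \<longleftrightarrow> \<Theta> \<in> graded_functions E 3 \<and> bracket E \<Theta> \<Theta> = (\<lambda>c x. 0)"

definition dorfman :: "('m, 'v::real_vector, 'z) metric_bundle_scheme \<Rightarrow>
    ('m, 'v) graded_function \<Rightarrow> ('m \<Rightarrow> 'v) \<Rightarrow> ('m \<Rightarrow> 'v) \<Rightarrow> 'm \<Rightarrow> 'v" where
  "dorfman E \<Theta> u v = section_of E (bracket E (bracket E (of_section E u) \<Theta>) (of_section E v))"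

definition app :: "('m \<Rightarrow> 'v \<Rightarrow> 'v) \<Rightarrow> ('m \<Rightarrow> 'v) \<Rightarrow> 'm \<Rightarrow> 'v" where
  "app N u = (\<lambda>x. N x (u x))"

definition dorfman_twisted :: "('m, 'v::real_vector, 'z) metric_bundle_scheme \<Rightarrow>
    ('m, 'v) graded_function \<Rightarrow> ('m \<Rightarrow> 'v \<Rightarrow> 'v) \<Rightarrow> ('m \<Rightarrow> 'v) \<Rightarrow> ('m \<Rightarrow> 'v) \<Rightarrow> 'm \<Rightarrow> 'v" where
  "dorfman_twisted E \<Theta> N u v = (\<lambda>x. dorfman E \<Theta> (app N u) v x + dorfman E \<Theta> u (app N v) x
                                     - app N (dorfman E \<Theta> u v) x)"

definition torsion :: "('m, 'v::real_vector, 'z) metric_bundle_scheme \<Rightarrow>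
    ('m, 'v) graded_function \<Rightarrow> ('m \<Rightarrow> 'v \<Rightarrow> 'v) \<Rightarrow> ('m \<Rightarrow> 'v) \<Rightarrow> ('m \<Rightarrow> 'v) \<Rightarrow> 'm \<Rightarrow> 'v" where
  "torsion E \<Theta> N u v = (\<lambda>x. dorfman E \<Theta> (app N u) (app N v) x
                              - app N (dorfman_twisted E \<Theta> N u v) x)"

text \<open>For \<open>rank E = 0\<close> the element below is not unique, but then $\mathcal A^3=0$.\<close>

definition endo_element :: "('m, 'v::real_vector, 'z) metric_bundle_scheme \<Rightarrow>
    ('m \<Rightarrow> 'v \<Rightarrow> 'v) \<Rightarrow> ('m, 'v) graded_function" where
  "endo_element E N = (THE a. a \<in> graded_functions E 2 \<and>
     (\<forall>u\<in>sections E. of_section E (app N u) = bracket E (of_section E u) a))"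

text \<open>Covariant 3-tensors as $C^\infty(M)$-trilinear maps on sections.\<close>

definition is_skew_3_tensor :: "('m, 'v::real_vector, 'z) metric_bundle_scheme \<Rightarrow>
    (('m \<Rightarrow> 'v) \<Rightarrow> ('m \<Rightarrow> 'v) \<Rightarrow> ('m \<Rightarrow> 'v) \<Rightarrow> 'm \<Rightarrow> real) \<Rightarrow> bool" where
  "is_skew_3_tensor E t \<longleftrightarrow>
     (\<forall>u\<in>sections E. \<forall>v\<in>sections E. \<forall>w\<in>sections E. t u v w \<in> smooth_functions E) \<and>
     (\<forall>u\<in>sections E. \<forall>u'\<in>sections E. \<forall>v\<in>sections E. \<forall>w\<in>sections E.
        \<forall>f\<in>smooth_functions E. \<forall>h\<in>smooth_functions E. \<forall>x.
        t (\<lambda>y. f y *\<^sub>R u y + h y *\<^sub>R u' y) v w x = f x * t u v w x + h x * t u' v w x) \<and>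
     (\<forall>u\<in>sections E. \<forall>v\<in>sections E. \<forall>w\<in>sections E. \<forall>x.
        t v u w x = - t u v w x \<and> t u w v x = - t u v w x)"

definition represents_3_tensor :: "('m, 'v::real_vector, 'z) metric_bundle_scheme \<Rightarrow>
    (('m \<Rightarrow> 'v) \<Rightarrow> ('m \<Rightarrow> 'v) \<Rightarrow> ('m \<Rightarrow> 'v) \<Rightarrow> 'm \<Rightarrow> real) \<Rightarrow> ('m, 'v) graded_function \<Rightarrow> bool" where
  "represents_3_tensor E t a \<longleftrightarrow> a \<in> graded_functions E 3 \<and>
     (\<forall>c x I \<mu>. coeff (a c x) (I, \<mu>) \<noteq> 0 \<longrightarrow> \<mu> = {#}) \<and>
     (\<forall>u\<in>sections E. \<forall>v\<in>sections E. \<forall>w\<in>sections E.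
        bracket E (bracket E (bracket E (of_section E u) a) (of_section E v)) (of_section E w)
          = of_fun E (t u v w))"

definition tensor_element :: "('m, 'v::real_vector, 'z) metric_bundle_scheme \<Rightarrow>
    (('m \<Rightarrow> 'v) \<Rightarrow> ('m \<Rightarrow> 'v) \<Rightarrow> ('m \<Rightarrow> 'v) \<Rightarrow> 'm \<Rightarrow> real) \<Rightarrow> ('m, 'v) graded_function" where
  "tensor_element E t = (THE a. represents_3_tensor E t a)"

definition torsion_tensor :: "('m, 'v::real_vector, 'z) metric_bundle_scheme \<Rightarrow>
    ('m, 'v) graded_function \<Rightarrow> ('m \<Rightarrow> 'v \<Rightarrow> 'v) \<Rightarrow>
    ('m \<Rightarrow> 'v) \<Rightarrow> ('m \<Rightarrow> 'v) \<Rightarrow> ('m \<Rightarrow> 'v) \<Rightarrow> 'm \<Rightarrow> real" where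
  "torsion_tensor E \<Theta> N u v w = (\<lambda>x. metric E x (torsion E \<Theta> N u v x) (w x))"

definition torsion_element :: "('m, 'v::real_vector, 'z) metric_bundle_scheme \<Rightarrow>
    ('m, 'v) graded_function \<Rightarrow> ('m \<Rightarrow> 'v \<Rightarrow> 'v) \<Rightarrow> ('m, 'v) graded_function" where
  "torsion_element E \<Theta> N = tensor_element E (torsion_tensor E \<Theta> N)"

end

theory Submission
  imports Defs
begin

text \<open>
  For a section \<open>u\<close> the operator \<open>\<iota>\<^sub>u = {u, \<cdot>}\<close> involves only the 1-jet of \<open>u\<close>, and \<open>D\<close>, the
  bracket with the quadratic element of \<open>N\<close>, only the 1-jet of that element, since neither contains
  momenta.  At a point of a coordinate domain both therefore act on superpolynomials, as derivations
  determined by their values on \<open>\<tau>\<^sub>a\<close> and \<open>p\<^sub>i\<close>, and comparing these values gives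
  \<open>[D, \<iota>\<^sub>u] = - \<iota>\<^bsub>N u\<^esub>\<close>.  The Dorfman bracket is \<open>- \<iota>\<^sub>v \<iota>\<^sub>u \<Theta>\<close> and the double bracket of the
  theorem is \<open>- D\<^sup>2 \<Theta>\<close>, so commuting \<open>D\<close> past \<open>\<iota>\<^sub>v \<iota>\<^sub>u\<close> shows that \<open>(D\<^sup>2 \<Theta> - \<lambda> \<Theta>) / 2\<close> generates
  the torsion.  Since \<open>D\<close> commutes with \<open>\<partial>/\<partial>p\<^sub>i\<close> and \<open>D\<^sup>2 = \<lambda>\<close> in degree 1, this element is free of
  momenta, i.e. a cubic expression in the \<open>\<tau>\<^sub>a\<close>, which makes the torsion tensorial and skew.

  The operators \<open>\<iota>\<^sub>u\<close> are compatible with coordinate changes because the Gram matrices are constant,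
  and an expression in the \<open>\<tau>\<^sub>a\<close> is determined by its contractions with sections; together these
  give the transformation law of every momentum-free element.  Constant Gram matrices exist
  around each point by Gram--Schmidt, and sections with given 1-jet by smooth bump functions.
\<close>

section \<open>The superpolynomial algebra\<close>

text \<open>The factor in the formula comes from a count. Moving two copies of \<open>D\<close> past
  two contractions produces each mixed term twice, whence the 1/2; \<open>D\<close> squared in
  degree 1 and \<open>N\<close> squared together leave three times \<lambda> \<iota>(v) \<iota>(u)
  \<Theta>, and subtracting \<lambda> \<Theta> reduces this to twice the contribution of N N [u, v].
  The commutator rule is the Jacobi identity for the quadratic element; at a point it compares
  derivations of one superpolynomial algebra, so generators decide. Three objects are definite
  descriptions (\<open>section_of\<close>, \<open>endo_element\<close>,
  \<open>tensor_element\<close>), and each calls for existence as well as uniqueness among globally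
  glued families. This shapes the proof: explicit candidates \<open>endo_form\<close> and
  \<open>torsion_form\<close> are written down in coordinates, and a candidate is compared in two
  coordinate systems by contracting it with sections until the covector of a known vector, or a
  scalar, remains. For \<open>torsion_form\<close> this scalar is \<open>torsion_tensor\<close>,
  whose definition selects no coordinate system.\<close>

lemma tau_times_mon:
  "tau a * mon (J, \<nu>) =
     (if a |\<in>| J then 0 else (- 1) ^ card {j. j |\<in>| J \<and> j < a} *\<^sub>R mon (finsert a J, \<nu>))"
proof -
  have "{(i, j). i \<in> {a} \<and> j \<in> fset J \<and> j < i} = Pair a ` {j. j |\<in>| J \<and> j < a}"
    by auto
  then have "shuffle_sign {a} (fset J) = (- 1) ^ card {j. j |\<in>| J \<and> j < a}"
    by (simp add: shuffle_sign_def card_image inj_on_def)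
  then show ?thesis
    by (auto simp: tau_def mon_times_mon)
qed

lemma mom_times_mon: "mom i * mon (J, \<nu>) = mon (J, add_mset i \<nu>)"
  by (simp add: mom_def mon_times_mon shuffle_sign_def)

text \<open>The sets \<open>R\<close> and \<open>M\<close> restrict the generators, because the
  values of a contraction on \<open>tau a\<close> and \<open>mom i\<close> have their geometric
  description only for indices below the rank and the dimension.\<close>

lemma mon_generator_induct:
  assumes "P 1" "\<And>a x. a \<in> R \<Longrightarrow> P x \<Longrightarrow> P (tau a * x)" "\<And>i x. i \<in> M \<Longrightarrow> P x \<Longrightarrow> P (mom i * x)"
    and "fset I \<subseteq> R" "set_mset \<mu> \<subseteq> M"
  shows "P (mon (I, \<mu>))"
  using assms(5)
proof (induction \<mu>)
  case empty
  have "\<forall>I. fset I = A \<longrightarrow> A \<subseteq> R \<longrightarrow> P (mon (I, {#}))" if "finite A" for A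
    using that
  \<comment> \<open>Inserting the least index on the left keeps the product sorted, so no sign
    appears.\<close>
  proof (induction A rule: finite_linorder_min_induct)
    case empty
    then show ?case
      using assms(1) by (metis bot_fset.rep_eq fset_inject one_superpoly_def)
  next
    case (insert b A)
    show ?case
    proof (intro allI impI)
      fix I assume I: "fset I = insert b A" "insert b A \<subseteq> R"
      define J where "J = I |-| {|b|}"
      have J: "fset J = A" "I = finsert b J" "b |\<notin>| J"
        using I insert(2) unfolding J_def by (auto simp: fset_inject[symmetric])
      have "{j. j |\<in>| J \<and> j < b} = {}"
        using insert(2) J(1) by force
      then have "mon (I, {#}) = tau b * mon (J, {#})"
        unfolding tau_times_mon using J(2,3) by (simp del: Collect_empty_eq)
      then show "P (mon (I, {#}))"
        using insert(3) J(1) I(2) assms(2) by auto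
    qed
  qed
  then show ?case using assms(4) finite_fset by blast
next
  case (add i \<mu>)
  then show ?case
    using assms(3)[of i "mon (I, \<mu>)"] by (simp add: mom_times_mon)
qed

lemma superpoly_mon_induct:
  assumes "\<And>k. P (mon k)" "\<And>x y. P x \<Longrightarrow> P y \<Longrightarrow> P (x + y)" "\<And>r x. P x \<Longrightarrow> P (r *\<^sub>R x)"
  shows "P x"
proof -
  have 0: "P 0" using assms(3)[of "mon k" 0 for k] assms(1) by simp
  have "P (\<Sum>k\<in>S. coeff x k *\<^sub>R mon k)" if "finite S" for S
    using that by induction (use assms 0 in auto)
  then show ?thesis
    using lin_ext_mon_self[of x] unfolding lin_ext_def by (metis finite_coeff)
qed

lemma superpoly_generator_induct [case_names one add scale tau mom]:
  assumes "P 1" "\<And>x y. P x \<Longrightarrow> P y \<Longrightarrow> P (x + y)" "\<And>r x. P x \<Longrightarrow> P (r *\<^sub>R x)"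
    and "\<And>a x. P x \<Longrightarrow> P (tau a * x)" "\<And>i x. P x \<Longrightarrow> P (mom i * x)"
  shows "P x"
proof (rule superpoly_mon_induct)
  fix k show "P (mon k)"
    by (cases k, simp) (rule mon_generator_induct[where R = UNIV and M = UNIV]; use assms in auto)
qed (use assms in auto)

section \<open>Parity and derivatives of superpolynomials\<close>

definition parity :: "superpoly \<Rightarrow> superpoly" where
  "parity = lin_ext (\<lambda>(I, \<mu>). (- 1) ^ fcard I *\<^sub>R mon (I, \<mu>))"

lemma linear_d_mom: "linear (d_mom i)" and linear_d_tau_left: "linear (d_tau_left a)"
  and linear_d_tau_right: "linear (d_tau_right a)" and linear_parity: "linear parity"
  and linear_substitute: "linear (substitute t P)"
  by (simp_all add: d_mom_def d_tau_left_def d_tau_right_def parity_def substitute_def linear_lin_ext)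

lemmas superlinear_simps [simp] =
  linear_add[OF linear_d_mom] linear_scale[OF linear_d_mom] linear_0[OF linear_d_mom]
  linear_neg[OF linear_d_mom] linear_diff[OF linear_d_mom] linear_sum[OF linear_d_mom]
  linear_add[OF linear_d_tau_left] linear_scale[OF linear_d_tau_left]
  linear_0[OF linear_d_tau_left] linear_neg[OF linear_d_tau_left]
  linear_diff[OF linear_d_tau_left] linear_sum[OF linear_d_tau_left]
  linear_add[OF linear_d_tau_right] linear_scale[OF linear_d_tau_right]
  linear_0[OF linear_d_tau_right] linear_neg[OF linear_d_tau_right]
  linear_diff[OF linear_d_tau_right] linear_sum[OF linear_d_tau_right]
  linear_add[OF linear_parity] linear_scale[OF linear_parity] linear_0[OF linear_parity]
  linear_neg[OF linear_parity] linear_diff[OF linear_parity] linear_sum[OF linear_parity]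
  linear_add[OF linear_substitute] linear_scale[OF linear_substitute]
  linear_0[OF linear_substitute] linear_neg[OF linear_substitute]
  linear_diff[OF linear_substitute] linear_sum[OF linear_substitute]

lemma d_mom_mon: "d_mom i (mon (I, \<mu>)) = real (count \<mu> i) *\<^sub>R mon (I, \<mu> - {#i#})"
  by (simp add: d_mom_def)

lemma d_tau_left_mon: "d_tau_left a (mon (I, \<mu>)) = (if a |\<in>| I
     then (- 1) ^ card {j. j |\<in>| I \<and> j < a} *\<^sub>R mon (I |-| {|a|}, \<mu>) else 0)"
  by (simp add: d_tau_left_def)

lemma d_tau_right_mon: "d_tau_right a (mon (I, \<mu>)) = (if a |\<in>| I
     then (- 1) ^ card {j. j |\<in>| I \<and> a < j} *\<^sub>R mon (I |-| {|a|}, \<mu>) else 0)"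
  by (simp add: d_tau_right_def)

lemma parity_mon: "parity (mon (I, \<mu>)) = (- 1) ^ fcard I *\<^sub>R mon (I, \<mu>)"
  by (simp add: parity_def)

lemma parity_one [simp]: "parity 1 = 1"
  by (simp add: one_superpoly_def parity_mon fcard.rep_eq)

lemma d_mom_one [simp]: "d_mom i 1 = 0"
  by (simp add: one_superpoly_def d_mom_mon)

lemma d_tau_left_one [simp]: "d_tau_left i 1 = 0"
  by (simp add: one_superpoly_def d_tau_left_mon)

lemma parity_tau_times: "parity (tau a * x) = - (tau a * parity x)"
proof (induction x rule: superpoly_mon_induct)
  case (1 k)
  obtain J \<nu> where "k = (J, \<nu>)" by (cases k)
  then show ?case
    by (auto simp: tau_times_mon parity_mon fcard_finsert_disjoint)
qed (simp_all add: algebra_simps)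

lemma parity_mom_times: "parity (mom i * x) = mom i * parity x"
proof (induction x rule: superpoly_mon_induct)
  case (1 k)
  obtain J \<nu> where "k = (J, \<nu>)" by (cases k)
  then show ?case
    by (auto simp: mom_times_mon parity_mon)
qed (simp_all add: algebra_simps)

lemma parity_mult: "parity (x * y) = parity x * parity y"
  by (induction x rule: superpoly_generator_induct)
    (simp_all add: algebra_simps parity_tau_times parity_mom_times)

lemma parity_tau [simp]: "parity (tau a) = - tau a"
  using parity_tau_times[of a 1] by simp

lemma parity_mom [simp]: "parity (mom a) = mom a"
  using parity_mom_times[of a 1] by simp

lemma parity_parity [simp]: "parity (parity x) = x"
  by (induction x rule: superpoly_generator_induct)
    (simp_all add: algebra_simps parity_tau_times parity_mom_times)

lemma d_mom_tau_times: "d_mom i (tau a * x) = tau a * d_mom i x"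
proof (induction x rule: superpoly_mon_induct)
  case (1 k)
  obtain J \<nu> where "k = (J, \<nu>)" by (cases k)
  then show ?case
    by (auto simp: tau_times_mon d_mom_mon)
qed (simp_all add: algebra_simps)

lemma d_mom_mom_times: "d_mom i (mom j * x) = (if i = j then x else 0) + mom j * d_mom i x"
proof (induction x rule: superpoly_mon_induct)
  case (1 k)
  obtain J \<nu> where k: "k = (J, \<nu>)" by (cases k)
  have "add_mset j \<nu> - {#i#} = add_mset j (\<nu> - {#i#})" if "i \<noteq> j"
    using that by (simp add: diff_add_mset_swap)
  moreover have "count \<nu> j \<noteq> 0 \<Longrightarrow> add_mset j (\<nu> - {#j#}) = \<nu>"
    by (simp add: count_inI)
  ultimately show ?case
    by (cases "count \<nu> j = 0") (auto simp: k mom_times_mon d_mom_mon algebra_simps)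
qed (simp_all add: algebra_simps)

lemma d_mom_mult: "d_mom i (x * y) = d_mom i x * y + x * d_mom i y"
  by (induction x rule: superpoly_generator_induct)
    (simp_all add: algebra_simps d_mom_tau_times d_mom_mom_times)

lemma d_tau_left_mom_times: "d_tau_left a (mom i * x) = mom i * d_tau_left a x"
proof (induction x rule: superpoly_mon_induct)
  case (1 k)
  obtain J \<nu> where "k = (J, \<nu>)" by (cases k)
  then show ?case
    by (auto simp: mom_times_mon d_tau_left_mon)
qed (simp_all add: algebra_simps)

text \<open>For distinct indices exactly one of \<open>a < b\<close> and \<open>b < a\<close> holds,
  so inserting \<open>a\<close> and deleting \<open>b\<close> in the two possible orders passes
  numbers of factors that differ by one. This is the minus sign.\<close>

lemma d_tau_left_tau_times:
  "d_tau_left b (tau a * x) = (if a = b then x else 0) - tau a * d_tau_left b x"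
proof (induction x rule: superpoly_mon_induct)
  case (1 k)
  obtain J \<nu> where k: "k = (J, \<nu>)" by (cases k)
  have fin: "finite {j. j |\<in>| J \<and> j < c}" for c
    by (rule finite_subset[of _ "fset J"]) auto
  show ?case
  proof (cases "a = b")
    case True
    have *: "{j. (j = b \<or> j |\<in>| J) \<and> j < b} = {j. j |\<in>| J \<and> j < b}"
      "{j. j |\<in>| J \<and> j \<noteq> b \<and> j < b} = {j. j |\<in>| J \<and> j < b}" by auto
    show ?thesis
    proof (cases "b |\<in>| J")
      case True
      then show ?thesis using \<open>a = b\<close> k *
        by (simp add: tau_times_mon d_tau_left_mon finsert_absorb
            flip: power_mult_distrib power_add)
    next
      case False
      then have "finsert b J |-| {|b|} = J" by auto
      then show ?thesis using \<open>a = b\<close> k * False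
        by (simp add: tau_times_mon d_tau_left_mon flip: power_mult_distrib)
    qed
  next
    case False
    show ?thesis
    proof (cases "b |\<in>| J \<and> a |\<notin>| J")
      case True
      have e: "finsert a J |-| {|b|} = finsert a (J |-| {|b|})" using False by auto
      have 1: "{j. (j = a \<or> j |\<in>| J) \<and> j < b} =
          (if a < b then insert a {j. j |\<in>| J \<and> j < b} else {j. j |\<in>| J \<and> j < b})" by auto
      have 2: "{j. j |\<in>| J \<and> j < a} =
          (if b < a then insert b {j. j |\<in>| J \<and> j \<noteq> b \<and> j < a} else {j. j |\<in>| J \<and> j \<noteq> b \<and> j < a})"
        using True by auto
      have f: "finite {j. j |\<in>| J \<and> j \<noteq> b \<and> j < a}"
        by (rule finite_subset[OF _ fin[of a]]) auto
      have c1: "card {j. (j = a \<or> j |\<in>| J) \<and> j < b} =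
          card {j. j |\<in>| J \<and> j < b} + (if a < b then 1 else 0)"
        unfolding 1 using True fin by auto
      have c2: "card {j. j |\<in>| J \<and> j < a} =
          card {j. j |\<in>| J \<and> j \<noteq> b \<and> j < a} + (if b < a then 1 else 0)"
        by (subst 2) (use True f in auto)
      show ?thesis
        using True False e c1 c2 k
        by (auto simp: tau_times_mon d_tau_left_mon power_add)
    next
      case nb: False
      then show ?thesis using False k
        by (auto simp: tau_times_mon d_tau_left_mon)
    qed
  qed
qed (auto simp add: algebra_simps simp flip: scaleR_add_right)

text \<open>Signs are carried by the operator \<open>parity\<close>, so that this and the later
  Leibniz rules hold for all elements and not just for homogeneous ones.\<close>

lemma d_tau_left_mult: "d_tau_left b (x * y) = d_tau_left b x * y + parity x * d_tau_left b y"
  by (induction x rule: superpoly_generator_induct)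
    (auto simp add: algebra_simps d_tau_left_tau_times d_tau_left_mom_times parity_tau_times
      parity_mom_times)

text \<open>The factors before and after the deleted one are together all the remaining ones, and
  their number is what \<open>parity\<close> measures. Right derivatives are reduced to left ones by
  this rule.\<close>

lemma d_tau_right_eq: "d_tau_right a x = parity (d_tau_left a x)"
proof (induction x rule: superpoly_mon_induct)
  case (1 k)
  obtain I \<mu> where k: "k = (I, \<mu>)" by (cases k)
  show ?case
  proof (cases "a |\<in>| I")
    case True
    let ?L = "{j. j |\<in>| I \<and> j < a}" and ?G = "{j. j |\<in>| I \<and> a < j}"
    have "fset (I |-| {|a|}) = ?L \<union> ?G" by auto
    moreover have "finite ?L" "finite ?G"
      by (rule finite_subset[of _ "fset I"]; auto)+
    ultimately have "fcard (I |-| {|a|}) = card ?L + card ?G"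
      unfolding fcard.rep_eq by (simp add: card_Un_disjoint disjoint_iff)
    then show ?thesis
      using True k by (simp add: d_tau_right_mon d_tau_left_mon parity_mon power_add
          flip: power_mult_distrib)
  qed (simp add: k d_tau_right_mon d_tau_left_mon)
qed simp_all

lemma d_mom_tau [simp]: "d_mom i (tau a) = 0"
  using d_mom_tau_times[of i a 1] by simp

lemma d_mom_mom [simp]: "d_mom i (mom j) = (if i = j then 1 else 0)"
  using d_mom_mom_times[of i j 1] by simp

lemma d_tau_left_tau [simp]: "d_tau_left b (tau a) = (if a = b then 1 else 0)"
  using d_tau_left_tau_times[of b a 1] by simp

lemma d_tau_left_mom [simp]: "d_tau_left b (mom a) = 0"
  using d_tau_left_mom_times[of b a 1] by simp

lemma d_mom_parity: "d_mom i (parity x) = parity (d_mom i x)"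
  by (induction x rule: superpoly_generator_induct)
    (simp_all add: d_mom_tau_times d_mom_mom_times parity_tau_times parity_mom_times)

lemma d_mom_commute: "d_mom i (d_mom j x) = d_mom j (d_mom i x)"
  by (induction x rule: superpoly_generator_induct)
    (simp_all add: d_mom_tau_times d_mom_mom_times)

lemma d_mom_d_tau_left: "d_mom i (d_tau_left b x) = d_tau_left b (d_mom i x)"
  by (induction x rule: superpoly_generator_induct)
    (simp_all add: d_mom_tau_times d_mom_mom_times d_tau_left_tau_times d_tau_left_mom_times)

lemma d_tau_left_anticommute: "d_tau_left a (d_tau_left b x) = - d_tau_left b (d_tau_left a x)"
  by (induction x rule: superpoly_generator_induct)
    (simp_all add: d_tau_left_tau_times d_tau_left_mom_times algebra_simps)

lemma parity_d_tau_left: "parity (d_tau_left b x) = - d_tau_left b (parity x)"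
  by (induction x rule: superpoly_generator_induct)
    (simp_all add: d_tau_left_tau_times d_tau_left_mom_times parity_tau_times parity_mom_times
      algebra_simps)

section \<open>Commutation rules\<close>

lemma tau_anticommute: "tau a * tau b = - (tau b * tau a)"
proof (cases "a = b")
  case True
  then show ?thesis by (simp add: tau_def mon_times_mon)
next
  case False
  have e: "finsert a {|b|} = finsert b {|a|}" by auto
  have "card {j. j = b \<and> j < a} = (if b < a then 1 else 0)"
    "card {j. j = a \<and> j < b} = (if a < b then 1 else 0)"
    by (auto simp: card_1_singleton_iff)
  then show ?thesis
    using False e tau_times_mon[of a "{|b|}" "{#}"] tau_times_mon[of b "{|a|}" "{#}"]
    by (auto simp: tau_def[of b] tau_def[of a])
qed

text \<open>Oddness is encoded as a rule for exchange with arbitrary elements: it is stable under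
  linear combinations and lets a coefficient move past any factor without splitting that factor into
  homogeneous parts.\<close>

definition odd_element :: "superpoly \<Rightarrow> bool" where
  "odd_element y \<longleftrightarrow> parity y = - y \<and> (\<forall>x. y * x = parity x * y)"

definition even_element :: "superpoly \<Rightarrow> bool" where
  "even_element y \<longleftrightarrow> parity y = y \<and> (\<forall>x. y * x = x * y)"

lemma odd_element_swap: "odd_element y \<Longrightarrow> y * x = parity x * y"
  and odd_element_parity: "odd_element y \<Longrightarrow> parity y = - y"
  by (auto simp: odd_element_def)

lemma even_element_swap: "even_element y \<Longrightarrow> y * x = x * y"
  and even_element_parity: "even_element y \<Longrightarrow> parity y = y"
  by (auto simp: even_element_def)

lemma mom_tau_commute: "mom i * tau a = tau a * mom i"
  by (simp add: tau_def mom_def mon_times_mon shuffle_sign_def)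

lemma mom_commute: "mom i * mom j = mom j * mom i"
  by (simp add: mom_def mon_times_mon add_mset_commute)

lemma odd_element_tau [simp]: "odd_element (tau a)"
proof -
  have "tau a * x = parity x * tau a" for x
  proof (induction x rule: superpoly_generator_induct)
    case (tau b x)
    have "tau a * (tau b * x) = - (tau b * (tau a * x))"
      using tau_anticommute[of a b] by (simp flip: mult.assoc)
    then show ?case using tau by (simp add: parity_tau_times mult.assoc)
  next
    case (mom i x)
    have "tau a * (mom i * x) = mom i * (tau a * x)"
      by (metis mom_tau_commute mult.assoc)
    then show ?case using mom by (simp add: parity_mom_times mult.assoc)
  qed (simp_all add: algebra_simps)
  then show ?thesis by (auto simp: odd_element_def)
qed

lemma even_element_mom [simp]: "even_element (mom i)"
proof -
  have "mom i * x = x * mom i" for x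
  proof (induction x rule: superpoly_generator_induct)
    case (tau b x)
    then show ?case by (metis mom_tau_commute mult.assoc)
  next
    case (mom j x)
    then show ?case by (metis mom_commute mult.assoc)
  qed (simp_all add: algebra_simps)
  then show ?thesis by (auto simp: even_element_def)
qed

lemma odd_element_linear [simp]:
  "odd_element 0" "odd_element x \<Longrightarrow> odd_element y \<Longrightarrow> odd_element (x + y)"
  "odd_element x \<Longrightarrow> odd_element (r *\<^sub>R x)" "odd_element x \<Longrightarrow> odd_element (- x)"
  by (auto simp: odd_element_def algebra_simps)

lemma even_element_linear [simp]:
  "even_element 0" "even_element x \<Longrightarrow> even_element y \<Longrightarrow> even_element (x + y)"
  "even_element x \<Longrightarrow> even_element (r *\<^sub>R x)" "even_element (1 :: superpoly)"
  by (auto simp: even_element_def algebra_simps)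

lemma odd_element_sum [intro]: "(\<And>i. i \<in> S \<Longrightarrow> odd_element (f i)) \<Longrightarrow> odd_element (sum f S)"
  by (induction S rule: infinite_finite_induct) auto

lemma even_element_sum [intro]: "(\<And>i. i \<in> S \<Longrightarrow> even_element (f i)) \<Longrightarrow> even_element (sum f S)"
  by (induction S rule: infinite_finite_induct) auto

lemma even_element_odd_times_odd:
  assumes "odd_element x" "odd_element y"
  shows "even_element (x * y)"
proof -
  note x = odd_element_swap[OF assms(1)] and y = odd_element_swap[OF assms(2)]
  have "x * y * z = z * (x * y)" for z
  proof -
    have "x * y * z = x * (parity z * y)" unfolding mult.assoc y[of z] ..
    also have "\<dots> = parity (parity z) * x * y"
      unfolding mult.assoc[symmetric] x[of "parity z"] ..
    finally show ?thesis by (simp add: mult.assoc)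
  qed
  then show ?thesis
    unfolding even_element_def parity_mult odd_element_parity[OF assms(1)]
      odd_element_parity[OF assms(2)] by simp
qed

section \<open>Substitution as an algebra homomorphism\<close>

lemma prod_list_insort_odd:
  fixes t :: "nat \<Rightarrow> superpoly"
  assumes "\<And>a. odd_element (t a)" "finite I"
  shows "t a * prod_list (map t (sorted_list_of_set I)) =
    (if a \<in> I then 0 else (- 1) ^ card {j \<in> I. j < a} *\<^sub>R
       prod_list (map t (sorted_list_of_set (insert a I))))"
proof -
  have anti: "t a * t b = - (t b * t a)" for a b
    unfolding odd_element_swap[OF assms(1)[of a]] odd_element_parity[OF assms(1)[of b]] by simp
  have sq: "t a * t a = 0" for a
  proof -
    have "2 *\<^sub>R (t a * t a) = 0"
      unfolding scaleR_2 by (subst (1) anti[of a a]) simp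
    then show ?thesis by simp
  qed
  \<comment> \<open>Sorting \<open>t a\<close> into place costs the same sign as
    \<open>tau_times_mon\<close>, so \<open>substitute\<close> will respect left multiplication by
    \<open>tau a\<close>.\<close>
  have "t a * prod_list (map t xs) = (if a \<in> set xs then 0 else
      (- 1) ^ card {j \<in> set xs. j < a} *\<^sub>R prod_list (map t (insort a xs)))"
    if "sorted xs" "distinct xs" for xs
    using that
  proof (induction xs)
    case (Cons b xs)
    have swap: "t a * (t b * y) = - (t b * (t a * y))" for y
      using anti[of a b] by (simp flip: mult.assoc)
    consider "a = b" | "a < b" | "b < a" by linarith
    then show ?case
    proof cases
      case 1
      then show ?thesis using sq[of a] by (simp flip: mult.assoc)
    next
      case 2
      then have "{j. (j = b \<or> j \<in> set xs) \<and> j < a} = {}" "a \<notin> set xs"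
        using Cons.prems by auto
      then show ?thesis using 2 by (simp del: Collect_empty_eq)
    next
      case 3
      then have "{j. (j = b \<or> j \<in> set xs) \<and> j < a} = insert b {j \<in> set xs. j < a}" by auto
      then have "card {j. (j = b \<or> j \<in> set xs) \<and> j < a} = Suc (card {j \<in> set xs. j < a})"
        using Cons.prems by simp
      then show ?thesis using 3 Cons by (auto simp: swap)
    qed
  qed simp
  from this[of "sorted_list_of_set I"] show ?thesis
    using assms(2) by (auto simp: sorted_list_of_set_insert)
qed

lemma prod_list_insort_even:
  assumes "\<And>a. even_element (P a)"
  shows "P a * prod_list (map P xs) = prod_list (map P (insort a xs))"
proof (induction xs)
  case (Cons b xs)
  have "P a * (P b * y) = P b * (P a * y)" for y
    using assms[of b] by (metis even_element_def mult.assoc)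
  then show ?case using Cons by simp
qed simp

lemma substitute_mon: "substitute t P (mon (I, \<mu>)) =
    prod_list (map t (sorted_list_of_set (fset I))) * prod_list (map P (sorted_list_of_multiset \<mu>))"
  by (simp add: substitute_def)

lemma substitute_tau_times:
  assumes "\<And>a. odd_element (t a)" "\<And>i. even_element (P i)"
  shows "substitute t P (tau a * x) = t a * substitute t P x"
proof (induction x rule: superpoly_mon_induct)
  case (1 k)
  obtain J \<nu> where k: "k = (J, \<nu>)" by (cases k)
  show ?case
    using prod_list_insort_odd[of t "fset J" a, OF assms(1) finite_fset]
    by (auto simp: k tau_times_mon substitute_mon mult.assoc[symmetric] mult_scaleR_left[symmetric]
        simp del: mult_scaleR_left)
qed (simp_all add: algebra_simps)

lemma substitute_mom_times:
  assumes "\<And>a. odd_element (t a)" "\<And>i. even_element (P i)"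
  shows "substitute t P (mom i * x) = P i * substitute t P x"
proof (induction x rule: superpoly_mon_induct)
  case (1 k)
  obtain J \<nu> where k: "k = (J, \<nu>)" by (cases k)
  have "P i * (y * z) = y * (P i * z)" for y z
    using assms(2)[of i] by (metis even_element_def mult.assoc)
  then show ?case
    by (simp add: k mom_times_mon substitute_def flip: prod_list_insort_even[of P, OF assms(2)])
qed (simp_all add: algebra_simps)

lemma substitute_one [simp]: "substitute t P 1 = 1"
  unfolding substitute_def by (subst one_superpoly_def) simp

lemma substitute_mult:
  assumes "\<And>a. odd_element (t a)" "\<And>i. even_element (P i)"
  shows "substitute t P (x * y) = substitute t P x * substitute t P y"
  by (induction x rule: superpoly_generator_induct)
    (simp_all add: algebra_simps substitute_tau_times[OF assms] substitute_mom_times[OF assms])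

lemma substitute_tau:
  assumes "\<And>a. odd_element (t a)" "\<And>i. even_element (P i)"
  shows "substitute t P (tau a) = t a"
  using substitute_tau_times[of t P a 1, OF assms] by simp

lemma substitute_mom:
  assumes "\<And>a. odd_element (t a)" "\<And>i. even_element (P i)"
  shows "substitute t P (mom i) = P i"
  using substitute_mom_times[of t P i 1, OF assms] by simp

section \<open>The grading\<close>

definition homogeneous :: "nat \<Rightarrow> nat \<Rightarrow> nat \<Rightarrow> superpoly set" where
  "homogeneous r n k = {a. \<forall>I \<mu>. coeff a (I, \<mu>) \<noteq> 0 \<longrightarrow>
     fset I \<subseteq> {..<r} \<and> set_mset \<mu> \<subseteq> {..<n} \<and> fcard I + 2 * size \<mu> = k}"

lemma subspace_homogeneous: "subspace (homogeneous r n k)"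
proof (rule subspaceI)
  fix x y assume *: "x \<in> homogeneous r n k" "y \<in> homogeneous r n k"
  have "coeff x k \<noteq> 0 \<or> coeff y k \<noteq> 0" if "coeff (x + y) k \<noteq> 0" for k
    using that by auto
  then show "x + y \<in> homogeneous r n k"
    using * unfolding homogeneous_def by blast
next
  fix c :: real and x assume "x \<in> homogeneous r n k"
  then show "c *\<^sub>R x \<in> homogeneous r n k"
    unfolding homogeneous_def mem_Collect_eq coeff_scaleR by (metis mult_zero_right)
qed (simp add: homogeneous_def)

lemmas homogeneous_0 [simp] = subspace_0[OF subspace_homogeneous]
  and homogeneous_add [intro] = subspace_add[OF subspace_homogeneous]
  and homogeneous_scale [intro] = subspace_scale[OF subspace_homogeneous]
  and homogeneous_diff [intro] = subspace_diff[OF subspace_homogeneous]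
  and homogeneous_neg [intro] = subspace_neg[OF subspace_homogeneous]
  and homogeneous_sum [intro] = subspace_sum[OF subspace_homogeneous]

lemma mon_homogeneous:
  "mon (I, \<mu>) \<in> homogeneous r n k \<longleftrightarrow>
     fset I \<subseteq> {..<r} \<and> set_mset \<mu> \<subseteq> {..<n} \<and> fcard I + 2 * size \<mu> = k"
  unfolding homogeneous_def mem_Collect_eq coeff_mon by simp

lemma homogeneous_induct [consumes 1, case_names mon zero add scale]:
  assumes "a \<in> homogeneous r n k"
    and mon: "\<And>I \<mu>. mon (I, \<mu>) \<in> homogeneous r n k \<Longrightarrow> P (mon (I, \<mu>))"
    and zero: "P 0" and add: "\<And>x y. P x \<Longrightarrow> P y \<Longrightarrow> P (x + y)" and scale: "\<And>r x. P x \<Longrightarrow> P (r *\<^sub>R x)"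
  shows "P a"
proof -
  have "P (\<Sum>q\<in>S. coeff a q *\<^sub>R mon q)" if "finite S" for S
    using that
  proof induction
    case (insert q S)
    obtain I \<mu> where q: "q = (I, \<mu>)" by (cases q)
    have "P (coeff a q *\<^sub>R mon q)"
    proof (cases "coeff a q = 0")
      case False
      then have "mon (I, \<mu>) \<in> homogeneous r n k"
        using assms(1) unfolding q by (simp add: mon_homogeneous) (simp add: homogeneous_def)
      then show ?thesis
        using mon scale by (simp add: q)
    qed (use zero in simp)
    then show ?case using insert add by simp
  qed (use zero in simp)
  then show ?thesis
    using lin_ext_mon_self[of a] unfolding lin_ext_def by (metis finite_coeff)
qed

lemma homogeneous_mult [intro]:
  assumes "x \<in> homogeneous r n k" "y \<in> homogeneous r n l" "m = k + l"
  shows "x * y \<in> homogeneous r n m"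
proof -
  have "mon (I, \<mu>) * mon (J, \<nu>) \<in> homogeneous r n (k + l)"
    if "mon (I, \<mu>) \<in> homogeneous r n k" "mon (J, \<nu>) \<in> homogeneous r n l" for I \<mu> J \<nu>
  proof (cases "I |\<inter>| J = {||}")
    case True
    then have "fcard (I |\<union>| J) = fcard I + fcard J"
      by (rule fcard_funion_disjoint)
    then show ?thesis
      using that True by (auto simp: mon_times_mon mon_homogeneous intro!: homogeneous_scale)
  qed (simp add: mon_times_mon)
  note mons = this
  have *: "mon (I, \<mu>) * y \<in> homogeneous r n (k + l)" if "mon (I, \<mu>) \<in> homogeneous r n k" for I \<mu>
    using assms(2) by (induction y rule: homogeneous_induct)
      (auto simp: distrib_left mons[OF that])
  from assms(1) show ?thesis
    unfolding assms(3) by (induction x rule: homogeneous_induct) (auto simp: distrib_right *)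
qed

lemma homogeneous_d_mom [intro]:
  "x \<in> homogeneous r n (k + 2) \<Longrightarrow> d_mom i x \<in> homogeneous r n k"
proof (induction rule: homogeneous_induct)
  case (mon I \<mu>)
  show ?case
  proof (cases "i \<in># \<mu>")
    case True
    then have "size (\<mu> - {#i#}) + 1 = size \<mu>"
      by (metis Suc_eq_plus1 size_Suc_Diff1)
    then show ?thesis using mon
      using set_mset_mono[OF diff_subset_eq_self, of \<mu> "{#i#}"]
      by (auto simp: d_mom_mon mon_homogeneous intro!: homogeneous_scale)
  qed (simp add: d_mom_mon not_in_iff)
qed auto

lemma homogeneous_d_mom_zero:
  "x \<in> homogeneous r n k \<Longrightarrow> k < 2 \<Longrightarrow> d_mom i x = 0"
proof (induction rule: homogeneous_induct)
  case (mon I \<mu>)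
  then have "fcard I + 2 * size \<mu> < 2" by (simp add: mon_homogeneous)
  then have "\<mu> = {#}" by (cases \<mu>) auto
  then show ?case by (simp add: d_mom_mon)
qed auto

lemma homogeneous_d_tau_left [intro]:
  "x \<in> homogeneous r n (Suc k) \<Longrightarrow> d_tau_left a x \<in> homogeneous r n k"
proof (induction rule: homogeneous_induct)
  case (mon I \<mu>)
  show ?case
  proof (cases "a |\<in>| I")
    case True
    then have "fcard (I |-| {|a|}) + 1 = fcard I"
      by (metis Suc_eq_plus1 fcard_Suc_fminus1)
    then show ?thesis using mon True
      by (auto simp: d_tau_left_mon mon_homogeneous intro!: homogeneous_scale)
  qed (simp add: d_tau_left_mon)
qed auto

lemma homogeneous_parity: "x \<in> homogeneous r n k \<Longrightarrow> parity x = (- 1) ^ k *\<^sub>R x"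
  by (induction rule: homogeneous_induct)
    (auto simp: parity_mon mon_homogeneous power_add scaleR_add_right mult.commute)

lemma homogeneous_tau: "a < r \<Longrightarrow> tau a \<in> homogeneous r n 1"
  by (simp add: tau_def mon_homogeneous fcard.rep_eq)

lemma homogeneous_tau' [intro]: "a < r \<Longrightarrow> tau a \<in> homogeneous r n (Suc 0)"
  using homogeneous_tau by simp

lemma homogeneous_one: "1 \<in> homogeneous r n 0"
  by (simp add: one_superpoly_def mon_homogeneous fcard.rep_eq)

lemma fcard_0_iff: "fcard I = 0 \<longleftrightarrow> I = {||}"
  by (simp add: fcard.rep_eq bot_fset.rep_eq flip: fset_inject)

lemma homogeneous_0_eq:
  assumes "x \<in> homogeneous r n 0"
  shows "x = coeff x ({||}, {#}) *\<^sub>R 1"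
proof (rule superpoly_eqI)
  fix k :: key
  show "coeff x k = coeff (coeff x ({||}, {#}) *\<^sub>R 1) k"
    using assms by (cases k; cases "coeff x k = 0")
      (auto simp: one_superpoly_def coeff_mon homogeneous_def fcard_0_iff)
qed

lemma homogeneous_1_eq:
  assumes "x \<in> homogeneous r n (Suc 0)"
  shows "x = (\<Sum>a<r. coeff x ({|a|}, {#}) *\<^sub>R tau a)"
proof (rule superpoly_eqI)
  fix k :: key
  obtain I \<mu> where k: "k = (I, \<mu>)" by (cases k)
  have "coeff (\<Sum>a<r. coeff x ({|a|}, {#}) *\<^sub>R tau a) k =
      (\<Sum>a<r. if k = ({|a|}, {#}) then coeff x k else 0)"
    unfolding coeff_sum by (rule sum.cong) (auto simp: tau_def coeff_mon)
  also have "\<dots> = coeff x k"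
  proof (cases "coeff x k = 0")
    case False
    then have "fset I \<subseteq> {..<r}" and e: "fcard I + 2 * size \<mu> = Suc 0"
      using assms k by (auto simp: homogeneous_def)
    moreover have "\<mu> = {#}" using e by (cases \<mu>) auto
    moreover from this e have "fcard I = 1" by simp
    moreover from this obtain b where "fset I = {b}"
      by (auto simp: fcard.rep_eq card_1_singleton_iff)
    moreover then have "I = {|b|}" by (simp flip: fset_inject)
    ultimately have "b < r" "k = ({|b|}, {#})" using k by auto
    then have "(\<Sum>a<r. if k = ({|a|}, {#}) then coeff x k else 0) =
        (\<Sum>a<r. if a = b then coeff x k else 0)"
      by (intro sum.cong) auto
    then show ?thesis using \<open>b < r\<close> by simp
  next
    case True
    show ?thesis unfolding True by (simp cong: if_cong)
  qed
  finally show "coeff x k = coeff (\<Sum>a<r. coeff x ({|a|}, {#}) *\<^sub>R tau a) k" by simp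
qed

lemma coeff_d_mom: "coeff (d_mom i x) (I, \<mu>) = real (Suc (count \<mu> i)) * coeff x (I, add_mset i \<mu>)"
proof (induction x rule: superpoly_mon_induct)
  case (1 k)
  obtain J \<nu> where k: "k = (J, \<nu>)" by (cases k)
  show ?case
  proof (cases "i \<in># \<nu>")
    case True
    then obtain \<nu>' where "\<nu> = add_mset i \<nu>'" by (metis multi_member_split)
    then show ?thesis by (auto simp: k d_mom_mon coeff_mon)
  next
    case False
    then show ?thesis by (auto simp: k d_mom_mon coeff_mon not_in_iff)
  qed
qed (simp_all add: algebra_simps)

lemma coeff_d_tau_left: "coeff (d_tau_left a x) (I, \<mu>) =
    (if a |\<in>| I then 0 else (- 1) ^ card {j. j |\<in>| I \<and> j < a} * coeff x (finsert a I, \<mu>))"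
proof (induction x rule: superpoly_mon_induct)
  case (1 k)
  obtain J \<nu> where k: "k = (J, \<nu>)" by (cases k)
  show ?case
  proof (cases "a |\<in>| J")
    case True
    then obtain J' where J': "J = finsert a J'" "a |\<notin>| J'" by (metis mk_disjoint_finsert)
    have *: "finsert a J' |-| {|a|} = J'" "finsert a I = finsert a J' \<longleftrightarrow> I = J'" if "a |\<notin>| I"
      using J' that by auto
    have "{j. (j = a \<or> j |\<in>| J') \<and> j < a} = {j. j |\<in>| J' \<and> j < a}" by auto
    then show ?thesis using J' * by (auto simp: k d_tau_left_mon coeff_mon)
  next
    case False
    then show ?thesis by (auto simp: k d_tau_left_mon coeff_mon)
  qed
qed (simp_all add: algebra_simps)

lemma d_mom_zero_iff: "(\<forall>i. d_mom i x = 0) \<longleftrightarrow> (\<forall>I \<mu>. coeff x (I, \<mu>) \<noteq> 0 \<longrightarrow> \<mu> = {#})"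
proof
  assume *: "\<forall>i. d_mom i x = 0"
  show "\<forall>I \<mu>. coeff x (I, \<mu>) \<noteq> 0 \<longrightarrow> \<mu> = {#}"
  proof (intro allI impI)
    fix I \<mu> assume **: "coeff x (I, \<mu>) \<noteq> 0"
    show "\<mu> = {#}"
    proof (rule ccontr)
      assume "\<mu> \<noteq> {#}"
      then obtain i \<mu>' where "\<mu> = add_mset i \<mu>'" by (metis multiset_cases)
      then show False using * ** coeff_d_mom[of i x I \<mu>'] by simp
    qed
  qed
next
  assume *: "\<forall>I \<mu>. coeff x (I, \<mu>) \<noteq> 0 \<longrightarrow> \<mu> = {#}"
  have "coeff (d_mom i x) (I, \<mu>) = 0" for i I \<mu>
    unfolding coeff_d_mom using * by force
  then show "\<forall>i. d_mom i x = 0" by (auto intro!: superpoly_eqI)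
qed

text \<open>In positive degree every monomial contains a generator, and the derivative in that
  direction keeps its coefficient up to a nonzero factor; constants, which all derivatives kill, are
  excluded by \<open>Suc k\<close>.\<close>

lemma homogeneous_eq_0I:
  assumes "x \<in> homogeneous r n (Suc k)" "\<And>i. i < n \<Longrightarrow> d_mom i x = 0"
    "\<And>a. a < r \<Longrightarrow> d_tau_left a x = 0"
  shows "x = 0"
proof (rule superpoly_eqI, rule ccontr)
  fix key assume *: "coeff x key \<noteq> coeff 0 key"
  obtain I \<mu> where k: "key = (I, \<mu>)" by (cases key)
  have h: "fset I \<subseteq> {..<r}" "set_mset \<mu> \<subseteq> {..<n}" "fcard I + 2 * size \<mu> = Suc k"
    using * assms(1) by (auto simp: k homogeneous_def)
  show False
  proof (cases "\<mu> = {#}")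
    case True
    then obtain a where a: "a |\<in>| I" using h(3) fcard_0_iff[of I] by auto
    then obtain J where "I = finsert a J" "a |\<notin>| J" by (metis mk_disjoint_finsert)
    moreover have "a < r" using a h(1) by auto
    ultimately show False
      using coeff_d_tau_left[of a x J \<mu>] assms(3)[of a] * by (simp add: k)
  next
    case False
    then obtain i \<nu> where "\<mu> = add_mset i \<nu>" by (metis multiset_cases)
    moreover then have "i < n" using h(2) by auto
    ultimately show False
      using coeff_d_mom[of i x I \<nu>] assms(2)[of i] * by (simp add: k)
  qed
qed

text \<open>A graded derivation only if the \<open>A i\<close> have one parity and the \<open>B b\<close> the other one.\<close>

definition superderivation ::
  "nat \<Rightarrow> nat \<Rightarrow> (nat \<Rightarrow> superpoly) \<Rightarrow> (nat \<Rightarrow> superpoly) \<Rightarrow> superpoly \<Rightarrow> superpoly" where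
  "superderivation r n A B x = (\<Sum>i<n. A i * d_mom i x) + (\<Sum>b<r. B b * d_tau_left b x)"

lemma linear_superderivation: "linear (superderivation r n A B)"
  by (rule linearI)
    (simp_all add: superderivation_def algebra_simps sum.distrib scaleR_sum_right)

lemmas superderivation_simps [simp] =
  linear_add[OF linear_superderivation] linear_scale[OF linear_superderivation]
  linear_0[OF linear_superderivation] linear_neg[OF linear_superderivation]
  linear_diff[OF linear_superderivation] linear_sum[OF linear_superderivation]

text \<open>The shape of the bracket with a section: an odd coefficient in front of the even
  \<open>d_mom\<close>, an even one in front of the odd \<open>d_tau_left\<close>. Either way
  passing \<open>x\<close> costs one \<open>parity\<close>.\<close>

lemma superderivation_odd_mult:
  assumes "\<And>i. i < n \<Longrightarrow> odd_element (A i)" "\<And>b. b < r \<Longrightarrow> even_element (B b)"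
  shows "superderivation r n A B (x * y) =
    superderivation r n A B x * y + parity x * superderivation r n A B y"
proof -
  have "A i * (x * z) = parity x * (A i * z)" if "i < n" for i z
    using odd_element_swap[OF assms(1)[OF that], of x] by (simp flip: mult.assoc)
  moreover have "B b * (parity x * z) = parity x * (B b * z)" if "b < r" for b z
    using even_element_swap[OF assms(2)[OF that], of "parity x"] by (simp flip: mult.assoc)
  ultimately show ?thesis
    by (simp add: superderivation_def d_mom_mult d_tau_left_mult algebra_simps sum.distrib
        sum_distrib_left sum_distrib_right)
qed

text \<open>The shape of the bracket with a quadratic element: the \<open>parity\<close> from
  \<open>d_tau_left_mult\<close> is undone when the odd coefficient moves past
  \<open>parity x\<close>.\<close>

lemma superderivation_even_mult:
  assumes "\<And>i. i < n \<Longrightarrow> even_element (A i)" "\<And>b. b < r \<Longrightarrow> odd_element (B b)"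
  shows "superderivation r n A B (x * y) =
    superderivation r n A B x * y + x * superderivation r n A B y"
proof -
  have "A i * (x * z) = x * (A i * z)" if "i < n" for i z
    using even_element_swap[OF assms(1)[OF that], of x] by (simp flip: mult.assoc)
  moreover have "B b * (parity x * z) = x * (B b * z)" if "b < r" for b z
    using odd_element_swap[OF assms(2)[OF that], of "parity x"] by (simp flip: mult.assoc)
  ultimately show ?thesis
    by (simp add: superderivation_def d_mom_mult d_tau_left_mult algebra_simps sum.distrib
        sum_distrib_left sum_distrib_right)
qed

lemma superderivation_tau [simp]:
  "superderivation r n A B (tau a) = (if a < r then B a else 0)"
  by (simp add: superderivation_def if_distrib[of "(*) _"] cong: if_cong)

lemma superderivation_mom [simp]:
  "superderivation r n A B (mom i) = (if i < n then A i else 0)"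
  by (simp add: superderivation_def if_distrib[of "(*) _"] cong: if_cong)

lemma superderivation_one [simp]: "superderivation r n A B 1 = 0"
  by (simp add: superderivation_def)

lemma parity_superderivation_even:
  assumes "\<And>i. i < n \<Longrightarrow> even_element (A i)" "\<And>b. b < r \<Longrightarrow> odd_element (B b)"
  shows "parity (superderivation r n A B x) = superderivation r n A B (parity x)"
  using even_element_parity[OF assms(1)] odd_element_parity[OF assms(2)]
  by (simp add: superderivation_def parity_mult d_mom_parity parity_d_tau_left)

lemma superderivation_homogeneous_odd:
  assumes "x \<in> homogeneous r n (Suc k)" "\<And>i. i < n \<Longrightarrow> A i \<in> homogeneous r n (Suc 0)"
    and B: "\<And>b. b < r \<Longrightarrow> B b \<in> homogeneous r n 0"
  shows "superderivation r n A B x \<in> homogeneous r n k"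
proof -
  have "A i * d_mom i x \<in> homogeneous r n k" if "i < n" for i
  proof (cases k)
    \<comment> \<open>An element of degree 1 contains no momentum, so the missing degree -1 does no
      harm.\<close>
    case 0
    then show ?thesis using homogeneous_d_mom_zero[OF assms(1)] by simp
  next
    case (Suc j)
    have "d_mom i x \<in> homogeneous r n j" using assms(1) Suc by (intro homogeneous_d_mom) simp
    from homogeneous_mult[OF assms(2)[OF that] this] show ?thesis using Suc by simp
  qed
  moreover have "B b * d_tau_left b x \<in> homogeneous r n k" if "b < r" for b
    by (rule homogeneous_mult[OF B[OF that] homogeneous_d_tau_left[OF assms(1)]]) simp
  ultimately show ?thesis
    unfolding superderivation_def by (intro homogeneous_add homogeneous_sum) simp_all
qed

lemma superderivation_homogeneous_even:
  assumes "x \<in> homogeneous r n k" "\<And>i. i < n \<Longrightarrow> A i \<in> homogeneous r n 2"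
    and B: "\<And>b. b < r \<Longrightarrow> B b \<in> homogeneous r n (Suc 0)"
  shows "superderivation r n A B x \<in> homogeneous r n k"
proof -
  have "A i * d_mom i x \<in> homogeneous r n k" if "i < n" for i
  proof (cases "k < 2")
    case True
    then show ?thesis using homogeneous_d_mom_zero[OF assms(1)] by simp
  next
    case False
    then obtain j where "k = j + 2" by (metis add.commute le_Suc_ex not_less)
    then have "d_mom i x \<in> homogeneous r n j" using assms(1) by auto
    from homogeneous_mult[OF assms(2)[OF that] this] \<open>k = j + 2\<close> show ?thesis by simp
  qed
  moreover have "B b * d_tau_left b x \<in> homogeneous r n k" if "b < r" for b
  proof (cases k)
    case 0
    then have "d_tau_left b x = d_tau_left b (coeff x ({||}, {#}) *\<^sub>R 1)"
      using homogeneous_0_eq[of x r n] assms(1) by simp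
    then show ?thesis by simp
  next
    case (Suc j)
    then have "d_tau_left b x \<in> homogeneous r n j" using assms(1) by auto
    from homogeneous_mult[OF B[OF that] this] Suc show ?thesis by simp
  qed
  ultimately show ?thesis
    unfolding superderivation_def by (intro homogeneous_add homogeneous_sum) simp_all
qed

section \<open>Smooth functions on open subsets of $\mathbb R^n$\<close>

lemma openin_Euclidean_space_iff:
  "openin (Euclidean_space n) V \<longleftrightarrow> (\<exists>W. open W \<and> V = W \<inter> {x. \<forall>i\<ge>n. x i = 0})"
  unfolding Euclidean_space_def openin_subtopology euclidean_product_topology
  by (simp add: open_openin[symmetric])

lemma openin_Euclidean_space_Int_open:
  "openin (Euclidean_space n) V \<Longrightarrow> open W \<Longrightarrow> openin (Euclidean_space n) (V \<inter> W)"
  unfolding openin_Euclidean_space_iff by (elim exE conjE, rule_tac x = "Wa \<inter> W" in exI) auto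

text \<open>From index \<open>n\<close> on all coordinates are 0, so a basic neighbourhood of the
  product topology imposes only \<open>n\<close> conditions, and the smallest of their widths
  serves.\<close>

lemma openin_Euclidean_space_box:
  assumes "openin (Euclidean_space n) V" "y \<in> V"
  obtains \<epsilon> where "\<epsilon> > 0"
    "\<And>z. (\<And>i. i < n \<Longrightarrow> \<bar>z i - y i\<bar> < \<epsilon>) \<Longrightarrow> (\<And>i. i \<ge> n \<Longrightarrow> z i = 0) \<Longrightarrow> z \<in> V"
proof -
  obtain W where W: "open W" "V = W \<inter> {x. \<forall>i\<ge>n. x i = 0}"
    using assms(1) unfolding openin_Euclidean_space_iff by blast
  then have "openin (product_topology (\<lambda>i. euclidean) UNIV) W" "y \<in> W"
    using assms(2) by (auto simp: open_fun_def)
  from product_topology_open_contains_basis[OF this]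
  obtain X where X: "y \<in> (\<Pi>\<^sub>E i\<in>UNIV. X i)" "\<And>i. open (X i)" "(\<Pi>\<^sub>E i\<in>UNIV. X i) \<subseteq> W"
    unfolding open_openin[symmetric] by blast
  have "\<exists>e>0. \<forall>t. \<bar>t - y i\<bar> < e \<longrightarrow> t \<in> X i" for i
  proof -
    have "y i \<in> X i" using X(1) by auto
    then obtain e where "e > 0" "ball (y i) e \<subseteq> X i"
      using X(2)[of i] open_contains_ball by blast
    then show ?thesis by (intro exI[of _ e]) (auto simp: subset_iff dist_real_def abs_minus_commute)
  qed
  then obtain e where e: "\<And>i. e i > 0" "\<And>i t. \<bar>t - y i\<bar> < e i \<Longrightarrow> t \<in> X i" by metis
  \<comment> \<open>The additional 1 keeps the minimum defined when \<open>n = 0\<close>.\<close>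
  define \<epsilon> where "\<epsilon> = Min (insert 1 (e ` {..<n}))"
  show ?thesis
  proof
    show "\<epsilon> > 0" using e(1) unfolding \<epsilon>_def by simp
    fix z assume z: "\<And>i. i < n \<Longrightarrow> \<bar>z i - y i\<bar> < \<epsilon>" "\<And>i. i \<ge> n \<Longrightarrow> z i = 0"
    have "z i \<in> X i" for i
    proof (cases "i < n")
      case True
      then have "\<epsilon> \<le> e i" unfolding \<epsilon>_def by simp
      then show ?thesis using z(1)[OF True] e(2) by simp
    next
      case False
      then have "z i = y i" using z(2) assms(2) W(2) by simp
      then show ?thesis using e by simp
    qed
    then show "z \<in> V" using X(3) W(2) z(2) by auto
  qed
qed

lemma openin_Euclidean_space_zero:
  "openin (Euclidean_space n) V \<Longrightarrow> y \<in> V \<Longrightarrow> i \<ge> n \<Longrightarrow> y i = 0"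
  unfolding openin_Euclidean_space_iff by auto

text \<open>\<open>partial\<close> differentiates along lines in the whole function space. Near a
  point of an open \<open>V\<close> such a line stays in \<open>V\<close>, so derivatives depend
  only on the values on \<open>V\<close>.\<close>

lemma eventually_coordinate_line:
  assumes "openin (Euclidean_space n) V" "y \<in> V" "i < n"
  shows "eventually (\<lambda>t. y(i := t) \<in> V) (nhds (y i))"
proof -
  obtain \<epsilon> where \<epsilon>: "\<epsilon> > 0"
    "\<And>z. (\<And>i. i < n \<Longrightarrow> \<bar>z i - y i\<bar> < \<epsilon>) \<Longrightarrow> (\<And>i. i \<ge> n \<Longrightarrow> z i = 0) \<Longrightarrow> z \<in> V"
    using openin_Euclidean_space_box[OF assms(1,2)] by metis
  show ?thesis
    unfolding eventually_nhds_metric dist_real_def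
  proof (intro exI[of _ \<epsilon>] conjI allI impI \<epsilon>(1))
    fix t assume "\<bar>t - y i\<bar> < \<epsilon>"
    then show "y(i := t) \<in> V"
      by (intro \<epsilon>(2)) (use openin_Euclidean_space_zero[OF assms(1,2)] assms(3) \<epsilon>(1) in auto)
  qed
qed

lemma partial_cong:
  assumes "openin (Euclidean_space n) V" "y \<in> V" "i < n" "\<And>z. z \<in> V \<Longrightarrow> f z = g z"
  shows "partial i f y = partial i g y"
  unfolding partial_def
  by (rule deriv_cong_ev) (use eventually_mono[OF eventually_coordinate_line[OF assms(1-3)]] assms(4) in auto)

lemma partial_DERIV:
  "(\<lambda>t. f (y(i := t))) differentiable at (y i) \<longleftrightarrow>
     ((\<lambda>t. f (y(i := t))) has_field_derivative partial i f y) (at (y i))"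
  unfolding partial_def by (simp add: DERIV_deriv_iff_real_differentiable)

lemma Ck_on_cong:
  assumes "openin (Euclidean_space n) V" "Ck_on n k V f" "\<And>z. z \<in> V \<Longrightarrow> f z = g z"
  shows "Ck_on n k V g"
  using assms(2,3)
proof (induction k arbitrary: f g)
  case 0
  then show ?case by (simp cong: continuous_on_cong)
next
  case (Suc k)
  have "(\<lambda>t. g (y(i := t))) differentiable at (y i)" if "i < n" "y \<in> V" for i y
  proof -
    have "((\<lambda>t. f (y(i := t))) has_field_derivative partial i f y) (at (y i))"
      using Suc.prems(1) that partial_DERIV by auto
    then have "((\<lambda>t. g (y(i := t))) has_field_derivative partial i f y) (at (y i))"
    proof (subst DERIV_cong_ev[symmetric, OF refl _ refl])
      show "\<forall>\<^sub>F t in nhds (y i). f (y(i := t)) = g (y(i := t))"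
        using eventually_coordinate_line[OF assms(1) that(2,1)]
        by (rule eventually_mono) (rule Suc.prems(2))
    qed
    then show ?thesis unfolding real_differentiable_def ..
  qed
  moreover have "continuous_on V g"
    using Suc.prems by (simp cong: continuous_on_cong)
  moreover have "Ck_on n k V (partial i g)" if "i < n" for i
  proof (rule Suc.IH)
    show "Ck_on n k V (partial i f)" using Suc.prems(1) that by simp
    show "partial i f z = partial i g z" if "z \<in> V" for z
      by (rule partial_cong[OF assms(1) that \<open>i < n\<close> Suc.prems(2)])
  qed
  ultimately show ?case by simp
qed

lemma Ck_on_subset: "Ck_on n k V f \<Longrightarrow> V' \<subseteq> V \<Longrightarrow> Ck_on n k V' f"
  by (induction k arbitrary: f) (auto intro: continuous_on_subset)

lemma Ck_on_continuous: "Ck_on n k V f \<Longrightarrow> continuous_on V f"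
  by (cases k) auto

lemma Ck_on_Suc_D: "Ck_on n (Suc k) V f \<Longrightarrow> Ck_on n k V f"
proof (induction k arbitrary: f)
  case (Suc k)
  then show ?case by (subst Ck_on.simps) (use Ck_on.simps(2)[of n "Suc k" V f] in blast)
qed simp

lemma Ck_on_DERIV:
  "Ck_on n (Suc k) V f \<Longrightarrow> i < n \<Longrightarrow> y \<in> V \<Longrightarrow>
     ((\<lambda>t. f (y(i := t))) has_field_derivative partial i f y) (at (y i))"
  using partial_DERIV by auto

lemma Ck_on_SucI:
  assumes "openin (Euclidean_space n) V"
    and "\<And>i y. i < n \<Longrightarrow> y \<in> V \<Longrightarrow> ((\<lambda>t. f (y(i := t))) has_field_derivative f' i y) (at (y i))"
    and "\<And>i. i < n \<Longrightarrow> Ck_on n k V (f' i)" "continuous_on V f"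
  shows "Ck_on n (Suc k) V f"
proof -
  have "partial i f y = f' i y" if "i < n" "y \<in> V" for i y
    unfolding partial_def by (rule DERIV_imp_deriv) (rule assms(2)[OF that])
  then have "Ck_on n k V (partial i f)" if "i < n" for i
    using that by (intro Ck_on_cong[OF assms(1) assms(3)]) auto
  then show ?thesis
    using assms(2,4) by (auto simp: real_differentiable_def)
qed

lemma Ck_on_const: "openin (Euclidean_space n) V \<Longrightarrow> Ck_on n k V (\<lambda>_. c)"
proof (induction k arbitrary: c)
  case (Suc k)
  then show ?case by (intro Ck_on_SucI[where f' = "\<lambda>_ _. 0"]) auto
qed simp

lemma Ck_on_add:
  assumes "openin (Euclidean_space n) V"
  shows "Ck_on n k V f \<Longrightarrow> Ck_on n k V g \<Longrightarrow> Ck_on n k V (\<lambda>y. f y + g y)"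
proof (induction k arbitrary: f g)
  case (Suc k)
  show ?case
  proof (rule Ck_on_SucI[OF assms, where f' = "\<lambda>i y. partial i f y + partial i g y"])
    show "continuous_on V (\<lambda>y. f y + g y)"
      using Suc.prems by (auto intro!: continuous_intros)
    show "((\<lambda>t. f (y(i := t)) + g (y(i := t))) has_field_derivative
        partial i f y + partial i g y) (at (y i))" if "i < n" "y \<in> V" for i y
      by (rule DERIV_add[OF Ck_on_DERIV[OF Suc.prems(1) that] Ck_on_DERIV[OF Suc.prems(2) that]])
  qed (use Suc.prems Suc.IH in auto)
qed (auto intro: continuous_intros)

lemma Ck_on_mult:
  assumes "openin (Euclidean_space n) V"
  shows "Ck_on n k V f \<Longrightarrow> Ck_on n k V g \<Longrightarrow> Ck_on n k V (\<lambda>y. f y * g y)"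
proof (induction k arbitrary: f g)
  case (Suc k)
  show ?case
  proof (rule Ck_on_SucI[OF assms, where f' = "\<lambda>i y. partial i f y * g y + f y * partial i g y"])
    show "continuous_on V (\<lambda>y. f y * g y)"
      using Suc.prems by (auto intro!: continuous_intros)
    show "((\<lambda>t. f (y(i := t)) * g (y(i := t))) has_field_derivative
        partial i f y * g y + f y * partial i g y) (at (y i))" if "i < n" "y \<in> V" for i y
      using DERIV_mult[OF Ck_on_DERIV[OF Suc.prems(1) that] Ck_on_DERIV[OF Suc.prems(2) that]]
      unfolding fun_upd_triv by (simp only: add.commute mult.commute)
    show "Ck_on n k V (\<lambda>y. partial i f y * g y + f y * partial i g y)" if "i < n" for i
      using Suc.prems Suc.IH that by (intro Ck_on_add[OF assms] Suc.IH) (auto intro: Ck_on_Suc_D)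
  qed
qed (auto intro: continuous_intros)

lemma Ck_on_sum:
  assumes "openin (Euclidean_space n) V" "\<And>i. i \<in> S \<Longrightarrow> Ck_on n k V (f i)"
  shows "Ck_on n k V (\<lambda>y. \<Sum>i\<in>S. f i y)"
  using assms(2)
  by (induction S rule: infinite_finite_induct) (auto intro: Ck_on_const Ck_on_add assms(1))

lemma continuous_on_local:
  fixes V :: "'a::t2_space set"
  assumes "\<And>y. y \<in> V \<Longrightarrow> \<exists>W. open W \<and> y \<in> W \<and> continuous_on (V \<inter> W) f"
  shows "continuous_on V f"
proof (subst continuous_on_eq_continuous_within, rule ballI)
  fix y assume y: "y \<in> V"
  then obtain W where W: "open W" "y \<in> W" "continuous_on (V \<inter> W) f" using assms by blast
  then have "continuous (at y within (V \<inter> W)) f"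
    using y by (auto simp: continuous_on_eq_continuous_within)
  moreover have "at y within (V \<inter> W) = at y within V"
    by (rule at_within_nhd[of _ W]) (use W in auto)
  ultimately show "continuous (at y within V) f" by simp
qed

lemma Ck_on_local:
  assumes "\<And>y. y \<in> V \<Longrightarrow> \<exists>W. open W \<and> y \<in> W \<and> Ck_on n k (V \<inter> W) f"
  shows "Ck_on n k V f"
  using assms
proof (induction k arbitrary: f)
  case 0
  then show ?case by (auto intro: continuous_on_local)
next
  case (Suc k)
  have "continuous_on V f"
    using Suc.prems by (intro continuous_on_local) (metis Ck_on_continuous)
  moreover have "(\<lambda>t. f (y(i := t))) differentiable at (y i)" if "i < n" "y \<in> V" for i y
    using Suc.prems[OF that(2)] that by auto
  moreover have "Ck_on n k V (partial i f)" if "i < n" for i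
  proof (rule Suc.IH)
    fix y assume "y \<in> V"
    from Suc.prems[OF this] show "\<exists>W. open W \<and> y \<in> W \<and> Ck_on n k (V \<inter> W) (partial i f)"
      using that by auto
  qed
  ultimately show ?case by simp
qed

section \<open>The chain rule and compositions\<close>

lemma continuous_on_box:
  fixes h :: "(nat \<Rightarrow> real) \<Rightarrow> real"
  assumes "openin (Euclidean_space n) V" "continuous_on V h" "y \<in> V" "\<delta> > 0"
  obtains \<epsilon> where "\<epsilon> > 0"
    "\<And>z. (\<And>i. i < n \<Longrightarrow> \<bar>z i - y i\<bar> < \<epsilon>) \<Longrightarrow> (\<And>i. i \<ge> n \<Longrightarrow> z i = 0) \<Longrightarrow>
       z \<in> V \<and> \<bar>h z - h y\<bar> < \<delta>"
proof -
  obtain W where W: "open W" "W \<inter> V = h -` ball (h y) \<delta> \<inter> V"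
    using assms(2) unfolding continuous_on_open_invariant by (metis open_ball)
  have "openin (Euclidean_space n) (V \<inter> W)"
    by (rule openin_Euclidean_space_Int_open[OF assms(1) W(1)])
  moreover have "y \<in> V \<inter> W" using W(2) assms(3,4) by auto
  ultimately obtain \<epsilon> where \<epsilon>: "\<epsilon> > 0"
    "\<And>z. (\<And>i. i < n \<Longrightarrow> \<bar>z i - y i\<bar> < \<epsilon>) \<Longrightarrow> (\<And>i. i \<ge> n \<Longrightarrow> z i = 0) \<Longrightarrow> z \<in> V \<inter> W"
    using openin_Euclidean_space_box by metis
  have "z \<in> V \<and> \<bar>h z - h y\<bar> < \<delta>" if "z \<in> V \<inter> W" for z
  proof -
    have "z \<in> h -` ball (h y) \<delta> \<inter> V" using that W(2) by blast
    then show ?thesis by (simp add: dist_real_def abs_minus_commute)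
  qed
  then show ?thesis using that[of \<epsilon>] \<epsilon> by blast
qed

text \<open>The order of the end points is left open, since a coordinate of the curve in the chain
  rule may move either way or rest.\<close>

lemma mean_value_unordered:
  fixes f :: "real \<Rightarrow> real"
  assumes "\<And>x. \<bar>x - a\<bar> \<le> \<bar>b - a\<bar> \<Longrightarrow> DERIV f x :> f' x"
  obtains x where "\<bar>x - a\<bar> \<le> \<bar>b - a\<bar>" "f b - f a = (b - a) * f' x"
proof -
  consider "a < b" | "b < a" | "a = b" by linarith
  then show ?thesis
  proof cases
    case 1
    then obtain z where "a < z" "z < b" "f b - f a = (b - a) * f' z"
      using MVT2[of a b f f'] assms by auto
    then show ?thesis using that[of z] by simp
  next
    case 2
    then obtain z where "b < z" "z < a" "f a - f b = (a - b) * f' z"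
      using MVT2[of b a f f'] assms by auto
    then show ?thesis using that[of z] by (simp add: algebra_simps)
  next
    case 3
    then show ?thesis using that[of a] by simp
  qed
qed

text \<open>The increment along the curve telescopes into steps in which a single coordinate moves.
  The mean value theorem turns each step into a value of a partial derivative at a nearby point, and
  continuity of the partial derivatives gives the limit. The hypothesis \<open>zero\<close> keeps
  the curve within the first \<open>n\<close> coordinates.\<close>

lemma chain_rule_curve:
  fixes \<gamma> :: "real \<Rightarrow> nat \<Rightarrow> real"
  assumes V: "openin (Euclidean_space n) V" and f: "Ck_on n (Suc k) V f" and "\<gamma> t0 \<in> V"
    and \<gamma>': "\<And>i. i < n \<Longrightarrow> ((\<lambda>t. \<gamma> t i) has_field_derivative d i) (at t0)"
    and zero: "eventually (\<lambda>t. \<forall>i\<ge>n. \<gamma> t i = 0) (nhds t0)"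
  shows "((\<lambda>t. f (\<gamma> t)) has_field_derivative (\<Sum>i<n. partial i f (\<gamma> t0) * d i)) (at t0)"
proof -
  define y where "y = \<gamma> t0"
  \<comment> \<open>The first \<open>m\<close> coordinates have moved, the others still rest at the
    base point.\<close>
  define trunc where "trunc m t i = (if i < m then \<gamma> t i else y i)" for m t i
  have trunc0: "trunc m t0 = y" for m by (auto simp: trunc_def y_def)
  have yz: "y i = 0" if "i \<ge> n" for i
    using openin_Euclidean_space_zero[OF V] assms(3) that y_def by simp
  have near: "eventually (\<lambda>t. \<forall>i<n. \<bar>\<gamma> t i - y i\<bar> < \<epsilon>) (at t0)" if "\<epsilon> > 0" for \<epsilon>
  proof -
    have "eventually (\<lambda>t. \<bar>\<gamma> t i - y i\<bar> < \<epsilon>) (at t0)" if "i < n" for i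
      using DERIV_isCont[OF \<gamma>'[OF that]] \<open>\<epsilon> > 0\<close> unfolding y_def isCont_def tendsto_iff dist_real_def
      by blast
    then have "eventually (\<lambda>t. \<forall>i\<in>{..<n}. \<bar>\<gamma> t i - y i\<bar> < \<epsilon>) (at t0)"
      by (intro eventually_ball_finite) auto
    then show ?thesis by (simp add: Ball_def)
  qed
  have step: "((\<lambda>t. f (trunc (Suc m) t) - f (trunc m t)) has_field_derivative
      partial m f y * d m) (at t0)" if m: "m < n" for m
  proof -
    let ?g = "\<lambda>t. f (trunc (Suc m) t) - f (trunc m t)"
    let ?p = "partial m f y"
    \<comment> \<open>The difference quotient in the moving coordinate. Its default
      \<open>?p\<close> makes \<open>q\<close> converge to \<open>?p\<close> also through times at
      which the coordinate returns to its initial value; the product formula \<open>g\<close> holds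
      there since both sides vanish.\<close>
    define q where "q t = (if \<gamma> t m = y m then ?p else ?g t / (\<gamma> t m - y m))" for t
    have g: "?g t = q t * (\<gamma> t m - y m)" for t
    proof (cases "\<gamma> t m = y m")
      case True
      then have "trunc (Suc m) t = trunc m t"
        by (auto simp: trunc_def fun_eq_iff less_Suc_eq)
      then show ?thesis using True by simp
    qed (simp add: q_def)
    have cont: "continuous_on V (partial m f)"
      using f m Ck_on_continuous by auto
    have "(q \<longlongrightarrow> ?p) (at t0)"
      unfolding tendsto_iff dist_real_def
    proof (intro allI impI)
      fix \<delta> :: real assume \<delta>: "\<delta> > 0"
      obtain \<epsilon> where \<epsilon>: "\<epsilon> > 0"
        "\<And>z. (\<And>i. i < n \<Longrightarrow> \<bar>z i - y i\<bar> < \<epsilon>) \<Longrightarrow> (\<And>i. i \<ge> n \<Longrightarrow> z i = 0) \<Longrightarrow>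
           z \<in> V \<and> \<bar>partial m f z - ?p\<bar> < \<delta>"
        using continuous_on_box[OF V cont _ \<delta>, of y] assms(3) y_def by metis
      have close: "\<bar>q t - ?p\<bar> < \<delta>" if t: "\<forall>i<n. \<bar>\<gamma> t i - y i\<bar> < \<epsilon>" for t
      proof (cases "\<gamma> t m = y m")
        case False
        define z where "z s = (trunc m t)(m := s)" for s
        have z: "z s \<in> V" "\<bar>partial m f (z s) - ?p\<bar> < \<delta>" if "\<bar>s - y m\<bar> \<le> \<bar>\<gamma> t m - y m\<bar>" for s
        proof -
          have "z s \<in> V \<and> \<bar>partial m f (z s) - ?p\<bar> < \<delta>"
          proof (rule \<epsilon>(2))
            show "\<bar>z s i - y i\<bar> < \<epsilon>" if "i < n" for i
              using t m that \<open>\<bar>s - y m\<bar> \<le> _\<close> \<epsilon>(1) unfolding z_def trunc_def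
              by (auto intro: le_less_trans)
            show "z s i = 0" if "i \<ge> n" for i
              using that m yz unfolding z_def trunc_def by auto
          qed
          then show "z s \<in> V" "\<bar>partial m f (z s) - ?p\<bar> < \<delta>" by auto
        qed
        have "DERIV (\<lambda>s. f (z s)) s :> partial m f (z s)" if "\<bar>s - y m\<bar> \<le> \<bar>\<gamma> t m - y m\<bar>" for s
          using Ck_on_DERIV[OF f m z(1)[OF that]] by (simp add: z_def)
        then obtain s where s: "\<bar>s - y m\<bar> \<le> \<bar>\<gamma> t m - y m\<bar>"
          "f (z (\<gamma> t m)) - f (z (y m)) = (\<gamma> t m - y m) * partial m f (z s)"
          using mean_value_unordered[of "y m" "\<gamma> t m" "\<lambda>s. f (z s)" "\<lambda>s. partial m f (z s)"] by metis
        have "z (\<gamma> t m) = trunc (Suc m) t" "z (y m) = trunc m t"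
          by (auto simp: z_def trunc_def fun_eq_iff less_Suc_eq)
        then have "q t = partial m f (z s)" using s(2) False by (simp add: q_def)
        then show ?thesis using z(2)[OF s(1)] by simp
      qed (simp add: q_def \<delta>)
      show "eventually (\<lambda>t. \<bar>q t - ?p\<bar> < \<delta>) (at t0)"
        using eventually_mono[OF near[OF \<epsilon>(1)] close] .
    qed
    moreover have "((\<lambda>t. (\<gamma> t m - y m) / (t - t0)) \<longlongrightarrow> d m) (at t0)"
      using \<gamma>'[OF m] unfolding has_field_derivative_iff y_def .
    ultimately have "((\<lambda>t. q t * ((\<gamma> t m - y m) / (t - t0))) \<longlongrightarrow> ?p * d m) (at t0)"
      by (rule tendsto_mult)
    then show ?thesis
      unfolding has_field_derivative_iff g trunc0 by (simp add: y_def)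
  qed
  have "((\<lambda>t. f (trunc m t)) has_field_derivative (\<Sum>i<m. partial i f y * d i)) (at t0)"
    if "m \<le> n" for m
    using that
  proof (induction m)
    case 0
    then show ?case by (simp add: trunc_def)
  next
    case (Suc m)
    then show ?case using DERIV_add[OF Suc.IH step[of m]] by simp
  qed
  from this[of n] have "((\<lambda>t. f (trunc n t)) has_field_derivative (\<Sum>i<n. partial i f y * d i)) (at t0)"
    by simp
  moreover have "eventually (\<lambda>t. f (trunc n t) = f (\<gamma> t)) (nhds t0)"
    using zero
  proof eventually_elim
    case (elim t)
    then have "trunc n t = \<gamma> t" using yz by (auto simp: trunc_def fun_eq_iff)
    then show ?case by simp
  qed
  ultimately show ?thesis
    unfolding y_def by (subst (asm) DERIV_cong_ev[OF refl _ refl]) auto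
qed

lemma continuous_on_Euclidean_map:
  fixes F :: "'a::topological_space \<Rightarrow> nat \<Rightarrow> real"
  assumes "\<And>i. i < n \<Longrightarrow> continuous_on W (\<lambda>y. F y i)" "\<And>y i. y \<in> W \<Longrightarrow> i \<ge> n \<Longrightarrow> F y i = 0"
  shows "continuous_on W F"
proof (rule continuous_on_coordinatewise_then_product)
  fix i
  show "continuous_on W (\<lambda>y. F y i)"
  proof (cases "i < n")
    case False
    then show ?thesis using assms(2) by (simp cong: continuous_on_cong)
  qed (use assms(1) in auto)
qed

text \<open>The induction on the order is for all \<open>f\<close> at once, since the chain rule
  replaces \<open>f\<close> by its partial derivatives while \<open>F\<close> stays.\<close>

lemma Ck_on_compose:
  assumes W: "openin (Euclidean_space m) W" and V: "openin (Euclidean_space n) V"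
    and F: "\<And>y. y \<in> W \<Longrightarrow> F y \<in> V"
  shows "(\<And>i. i < n \<Longrightarrow> Ck_on m k W (\<lambda>y. F y i)) \<Longrightarrow> Ck_on n k V f \<Longrightarrow> Ck_on m k W (\<lambda>y. f (F y))"
proof (induction k arbitrary: f)
  case 0
  have "continuous_on W F"
    by (rule continuous_on_Euclidean_map[of n])
      (use 0 F openin_Euclidean_space_zero[OF V] in auto)
  then show ?case using 0(2) F by (auto intro: continuous_on_compose2[of V])
next
  case (Suc k)
  show ?case
  proof (rule Ck_on_SucI[OF W,
        where f' = "\<lambda>j y. \<Sum>i<n. partial i f (F y) * partial j (\<lambda>y. F y i) y"])
    fix j y assume jy: "j < m" "y \<in> W"
    have "eventually (\<lambda>t. \<forall>i\<ge>n. F (y(j := t)) i = 0) (nhds (y j))"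
      using eventually_coordinate_line[OF W jy(2,1)]
      by (rule eventually_mono) (use F openin_Euclidean_space_zero[OF V] in auto)
    note chain_rule_curve[OF V Suc.prems(2), of "\<lambda>t. F (y(j := t))" "y j", OF _ _ this]
    note chain = this[unfolded fun_upd_triv]
    show "((\<lambda>t. f (F (y(j := t)))) has_field_derivative
        (\<Sum>i<n. partial i f (F y) * partial j (\<lambda>y. F y i) y)) (at (y j))"
      by (rule chain[OF F[OF jy(2)]]) (rule Ck_on_DERIV[OF Suc.prems(1) jy])
  next
    fix j assume j: "j < m"
    show "Ck_on m k W (\<lambda>y. \<Sum>i<n. partial i f (F y) * partial j (\<lambda>y. F y i) y)"
    proof (intro Ck_on_sum[OF W] Ck_on_mult[OF W])
      fix i assume i: "i \<in> {..<n}"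
      show "Ck_on m k W (\<lambda>y. partial i f (F y))"
      proof (rule Suc.IH)
        show "Ck_on m k W (\<lambda>y. F y i)" if "i < n" for i
          by (rule Ck_on_Suc_D[OF Suc.prems(1)[OF that]])
        show "Ck_on n k V (partial i f)" using Suc.prems(2) i by simp
      qed
      show "Ck_on m k W (partial j (\<lambda>y. F y i))"
        using Suc.prems(1)[of i] \<open>i \<in> _\<close> j by auto
    qed
  next
    have "continuous_on W F"
      by (rule continuous_on_Euclidean_map[of n])
        (use Ck_on_continuous[OF Suc.prems(1)] F openin_Euclidean_space_zero[OF V] in auto)
    then show "continuous_on W (\<lambda>y. f (F y))"
      using Ck_on_continuous[OF Suc.prems(2)] F by (auto intro: continuous_on_compose2[of V])
  qed
qed

text \<open>A family \<open>H\<close> closed under differentiation on \<open>T\<close> replaces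
  explicit formulas for the higher derivatives of the outer function.\<close>

lemma Ck_on_compose_real:
  assumes V: "openin (Euclidean_space n) V"
    and H: "\<And>h. h \<in> H \<Longrightarrow> \<exists>h'\<in>H. \<forall>t\<in>T. DERIV h t :> h' t"
    and T: "\<And>y. y \<in> V \<Longrightarrow> F y \<in> T" and "h \<in> H"
  shows "Ck_on n k V F \<Longrightarrow> Ck_on n k V (\<lambda>y. h (F y))"
  using \<open>h \<in> H\<close>
proof (induction k arbitrary: h)
  have cont: "continuous_on V (\<lambda>y. h (F y))" if "h \<in> H" "continuous_on V F" for h
  proof -
    have "continuous_on T h"
      using H[OF that(1)] by (metis DERIV_isCont continuous_at_imp_continuous_on)
    then show ?thesis using that(2) T by (auto intro: continuous_on_compose2[of T])
  qed
  {
    case 0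
    then show ?case using cont by auto
  next
    case (Suc k)
    obtain h' where h': "h' \<in> H" "\<And>t. t \<in> T \<Longrightarrow> DERIV h t :> h' t"
      using H[OF Suc.prems(2)] by blast
    show ?case
    proof (rule Ck_on_SucI[OF V, where f' = "\<lambda>i y. h' (F y) * partial i F y"])
      fix i y assume iy: "i < n" "y \<in> V"
      show "((\<lambda>t. h (F (y(i := t)))) has_field_derivative h' (F y) * partial i F y) (at (y i))"
        by (rule DERIV_chain2[OF _ Ck_on_DERIV[OF Suc.prems(1) iy]]) (use h' T iy in auto)
    next
      fix i assume "i < n"
      then show "Ck_on n k V (\<lambda>y. h' (F y) * partial i F y)"
        using Suc.prems Suc.IH[OF Ck_on_Suc_D[OF Suc.prems(1)] h'(1)]
        by (intro Ck_on_mult[OF V]) auto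
    qed (use cont Suc.prems Ck_on_continuous in blast)
  }
qed

lemma Ck_on_powr:
  assumes "openin (Euclidean_space n) V" "\<And>y. y \<in> V \<Longrightarrow> F y > 0" "Ck_on n k V F"
  shows "Ck_on n k V (\<lambda>y. F y powr s)"
proof -
  \<comment> \<open>The constant factor closes the family: differentiating a power brings down its
    exponent.\<close>
  let ?H = "{h. \<exists>c s. h = (\<lambda>t :: real. c * t powr s)}"
  have "\<exists>h'\<in>?H. \<forall>t\<in>{0<..}. DERIV h t :> h' t" if hH: "h \<in> ?H" for h
  proof -
    obtain c s where h: "h = (\<lambda>t. c * t powr s)" using hH by blast
    have "\<forall>t\<in>{0<..}. DERIV h t :> (\<lambda>t. (c * s) * t powr (s - 1)) t"
      unfolding h by (auto intro!: derivative_eq_intros)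
    moreover have "(\<lambda>t. (c * s) * t powr (s - 1)) \<in> ?H" by blast
    ultimately show ?thesis by (rule bexI)
  qed
  moreover have "(\<lambda>t. t powr s) \<in> ?H"
    by (rule CollectI, rule exI[of _ 1], rule exI[of _ s]) simp
  ultimately show ?thesis
    using Ck_on_compose_real[where H = ?H and T = "{0<..}" and h = "\<lambda>t. t powr s"] assms by auto
qed

section \<open>The function exp(-1/t), flat at 0\<close>

definition flat_exp :: "real poly \<Rightarrow> real \<Rightarrow> real" where
  "flat_exp p t = (if t > 0 then poly p (1 / t) * exp (- (1 / t)) else 0)"

lemma poly_times_exp_tendsto_0: "((\<lambda>s. poly p s * exp (- s)) \<longlongrightarrow> (0::real)) at_top"
proof -
  have "((\<lambda>s. \<Sum>i\<le>degree p. poly.coeff p i * (s ^ i / exp s)) \<longlongrightarrow> (\<Sum>i\<le>degree p. poly.coeff p i * 0)) at_top"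
    by (intro tendsto_intros tendsto_power_div_exp_0)
  then show ?thesis
    by (simp add: poly_altdef sum_distrib_right exp_minus divide_inverse mult.assoc)
qed

lemma flat_exp_tendsto_0: "(flat_exp p \<longlongrightarrow> 0) (at 0)"
proof -
  have "((\<lambda>t. poly p (1 / t) * exp (- (1 / t))) \<longlongrightarrow> 0) (at_right 0)"
    using filterlim_compose[OF poly_times_exp_tendsto_0 filterlim_inverse_at_top_right, of p]
    by (simp add: inverse_eq_divide)
  moreover have "eventually (\<lambda>t. poly p (1 / t) * exp (- (1 / t)) = flat_exp p t) (at_right 0)"
    by (auto simp: flat_exp_def eventually_at_filter)
  ultimately have "(flat_exp p \<longlongrightarrow> 0) (at_right 0)"
    by (rule Lim_transform_eventually)
  moreover have "(flat_exp p \<longlongrightarrow> 0) (at_left 0)"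
    by (rule Lim_transform_eventually[OF tendsto_const])
      (auto simp: flat_exp_def eventually_at_filter)
  ultimately show ?thesis by (simp add: filterlim_split_at)
qed

text \<open>With s = 1/t one has ds/dt = - s^2, so the derivative of p(s) exp(-s) is s^2 (p(s) -
  p'(s)) exp(-s), and \<open>[:0, 0, 1:]\<close> is s^2. Thus all derivatives of the basic flat
  function stay in the range of \<open>flat_exp\<close>.\<close>

lemma DERIV_flat_exp:
  "DERIV (flat_exp p) t :> flat_exp ([:0, 0, 1:] * (p - pderiv p)) t"
proof -
  consider "t > 0" | "t < 0" | "t = 0" by linarith
  then show ?thesis
  proof cases
    case 1
    have "DERIV (\<lambda>t. poly p (1 / t) * exp (- (1 / t))) t :>
        flat_exp ([:0, 0, 1:] * (p - pderiv p)) t"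
      using 1 by (auto intro!: derivative_eq_intros simp: flat_exp_def field_simps power2_eq_square)
    moreover have "eventually (\<lambda>t. poly p (1 / t) * exp (- (1 / t)) = flat_exp p t) (nhds t)"
      using eventually_nhds_in_open[of "{0<..}" t] 1
      by (auto elim!: eventually_mono simp: flat_exp_def)
    ultimately show ?thesis by (subst (asm) DERIV_cong_ev[OF refl _ refl])
  next
    case 2
    have "eventually (\<lambda>t. 0 = flat_exp p t) (nhds t)"
      using eventually_nhds_in_open[of "{..<0}" t] 2
      by (auto elim!: eventually_mono simp: flat_exp_def)
    moreover have "DERIV (\<lambda>t. 0) t :> flat_exp ([:0, 0, 1:] * (p - pderiv p)) t"
      using 2 by (simp add: flat_exp_def)
    ultimately show ?thesis by (subst (asm) DERIV_cong_ev[OF refl _ refl])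
  next
    case 3
    \<comment> \<open>Division by the argument is multiplication by s, so the difference quotient at
      0 is again of the form \<open>flat_exp\<close> and tends to 0.\<close>
    have "flat_exp (pCons 0 p) s = (flat_exp p s - flat_exp p 0) / (s - 0)" for s
      by (simp add: flat_exp_def)
    then have "((\<lambda>s. (flat_exp p s - flat_exp p 0) / (s - 0)) \<longlongrightarrow> 0) (at 0)"
      using flat_exp_tendsto_0[of "pCons 0 p"] by (metis (mono_tags, lifting) tendsto_cong always_eventually)
    then show ?thesis
      unfolding 3 has_field_derivative_iff by (simp add: flat_exp_def)
  qed
qed

lemma Ck_on_flat_exp:
  assumes "openin (Euclidean_space n) V" "Ck_on n k V F"
  shows "Ck_on n k V (\<lambda>y. flat_exp p (F y))"
  by (rule Ck_on_compose_real[where H = "range flat_exp" and T = UNIV])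
    (use assms DERIV_flat_exp in blast)+

section \<open>Smooth functions on manifolds\<close>

lemma openin_top_of_set_Euclidean:
  assumes "openin (Euclidean_space n) S"
  shows "subtopology (Euclidean_space n) S = top_of_set S"
proof -
  have "{x. \<forall>i\<ge>n. x i = 0} \<inter> S = S"
    using openin_subset[OF assms] by (auto simp: topspace_Euclidean_space)
  then show ?thesis
    by (simp add: Euclidean_space_def subtopology_subtopology euclidean_product_topology)
qed

lemma is_chart_inj: "is_chart n (U, \<phi>) \<Longrightarrow> inj_on \<phi> U"
  using homeomorphic_imp_injective_map by (fastforce simp: is_chart_def)

lemma is_chart_image_open:
  assumes "is_chart n (U, \<phi>)" "open W" "W \<subseteq> U"
  shows "openin (Euclidean_space n) (\<phi> ` W)"
proof -
  have "open_map (top_of_set U) (subtopology (Euclidean_space n) (\<phi> ` U)) \<phi>"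
    using assms(1) homeomorphic_imp_open_map by (auto simp: is_chart_def)
  moreover have "openin (top_of_set U) W"
    using assms(2,3) by (simp add: open_subset)
  ultimately show ?thesis
    using assms(1) by (auto simp: open_map_def is_chart_def openin_open_subtopology)
qed

lemma is_chart_homeomorphism:
  assumes "is_chart n (U, \<phi>)"
  shows "continuous_on U \<phi>" "continuous_on (\<phi> ` U) (inv_into U \<phi>)"
proof -
  have "homeomorphic_map (top_of_set U) (top_of_set (\<phi> ` U)) \<phi>"
    using assms openin_top_of_set_Euclidean[of n "\<phi> ` U"] by (simp add: is_chart_def)
  then obtain g where g: "homeomorphic_maps (top_of_set U) (top_of_set (\<phi> ` U)) \<phi> g"
    by (auto simp: homeomorphic_map_maps)
  then show "continuous_on U \<phi>" by (simp add: homeomorphic_maps_def)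
  have "continuous_on (\<phi> ` U) g" using g by (simp add: homeomorphic_maps_def)
  moreover have "g y = inv_into U \<phi> y" if "y \<in> \<phi> ` U" for y
    using that g is_chart_inj[OF assms] by (auto simp: homeomorphic_maps_def)
  ultimately show "continuous_on (\<phi> ` U) (inv_into U \<phi>)"
    by (metis continuous_on_cong)
qed

lemma is_chart_restrict:
  assumes "is_chart n (U, \<phi>)" "open W" "W \<subseteq> U"
  shows "is_chart n (W, \<phi>)"
proof -
  have "homeomorphic_map (top_of_set U) (top_of_set (\<phi> ` U)) \<phi>"
    using assms openin_top_of_set_Euclidean[of n "\<phi> ` U"] by (simp add: is_chart_def)
  then have "homeomorphic_map (subtopology (top_of_set U) W) (subtopology (top_of_set (\<phi> ` U)) (\<phi> ` W)) \<phi>"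
    by (rule homeomorphic_map_subtopologies)
      (use assms(3) is_chart_inj[OF assms(1)] in \<open>auto simp: inj_on_def\<close>)
  moreover have "U \<inter> W = W" "\<phi> ` U \<inter> \<phi> ` W = \<phi> ` W" using assms(3) by auto
  ultimately have "homeomorphic_map (top_of_set W) (top_of_set (\<phi> ` W)) \<phi>"
    by (simp add: subtopology_subtopology)
  then show ?thesis
    using assms is_chart_image_open[OF assms]
    by (simp add: is_chart_def openin_top_of_set_Euclidean)
qed

section \<open>Smoothness with respect to a maximal atlas\<close>

locale smooth_manifold =
  fixes M :: "('m::{t2_space,second_countable_topology}, 'z) manifold_scheme"
  assumes manifold: "is_manifold M"
begin

lemma chart: "(U, \<phi>) \<in> charts M \<Longrightarrow> is_chart (dimension M) (U, \<phi>)"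
  using manifold unfolding is_manifold_def by (elim conjE) (rule bspec)

lemma chart_open: "(U, \<phi>) \<in> charts M \<Longrightarrow> open U"
  using chart[of U \<phi>] by (simp add: is_chart_def)

lemma chart_exists: obtains U \<phi> where "(U, \<phi>) \<in> charts M" "x \<in> U"
proof -
  have "x \<in> (\<Union>c\<in>charts M. fst c)" using manifold by (simp add: is_manifold_def)
  then show ?thesis using that by auto
qed

lemma chart_inv [simp]: "(U, \<phi>) \<in> charts M \<Longrightarrow> x \<in> U \<Longrightarrow> inv_into U \<phi> (\<phi> x) = x"
  by (rule inv_into_f_f[OF is_chart_inj[OF chart]])

lemma chart_image_open:
  assumes "(U, \<phi>) \<in> charts M" "open W"
  shows "openin (Euclidean_space (dimension M)) (\<phi> ` (W \<inter> U))"
  by (rule is_chart_image_open[OF chart[OF assms(1)]]) (use assms chart_open in auto)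

lemma smooth_onD:
  assumes "smooth_on M W f" "(U, \<phi>) \<in> charts M"
  shows "Ck_on (dimension M) k (\<phi> ` (W \<inter> U)) (\<lambda>y. f (inv_into U \<phi> y))"
  using assms by (auto simp: smooth_on_def Cinf_on_def)

lemma smooth_onI:
  assumes "\<And>U \<phi> k. (U, \<phi>) \<in> charts M \<Longrightarrow>
    Ck_on (dimension M) k (\<phi> ` (W \<inter> U)) (\<lambda>y. f (inv_into U \<phi> y))"
  shows "smooth_on M W f"
  using assms by (auto simp: smooth_on_def Cinf_on_def)

lemma smooth_on_cong:
  assumes "open W" "smooth_on M W f" "\<And>x. x \<in> W \<Longrightarrow> f x = g x"
  shows "smooth_on M W g"
proof (rule smooth_onI)
  fix U \<phi> k assume c: "(U, \<phi>) \<in> charts M"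
  show "Ck_on (dimension M) k (\<phi> ` (W \<inter> U)) (\<lambda>y. g (inv_into U \<phi> y))"
    by (rule Ck_on_cong[OF chart_image_open[OF c assms(1)] smooth_onD[OF assms(2) c]])
      (use assms(3) c in auto)
qed

lemma smooth_on_subset: "smooth_on M W f \<Longrightarrow> W' \<subseteq> W \<Longrightarrow> smooth_on M W' f"
  by (rule smooth_onI, rule Ck_on_subset[OF smooth_onD]) auto

lemma smooth_on_const: "open W \<Longrightarrow> smooth_on M W (\<lambda>_. c)"
  by (rule smooth_onI, rule Ck_on_const[OF chart_image_open])

lemma smooth_on_add:
  "open W \<Longrightarrow> smooth_on M W f \<Longrightarrow> smooth_on M W g \<Longrightarrow> smooth_on M W (\<lambda>x. f x + g x)"
  by (rule smooth_onI, rule Ck_on_add[OF chart_image_open smooth_onD smooth_onD])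

lemma smooth_on_mult:
  "open W \<Longrightarrow> smooth_on M W f \<Longrightarrow> smooth_on M W g \<Longrightarrow> smooth_on M W (\<lambda>x. f x * g x)"
  by (rule smooth_onI, rule Ck_on_mult[OF chart_image_open smooth_onD smooth_onD])

lemma smooth_on_cmult: "open W \<Longrightarrow> smooth_on M W f \<Longrightarrow> smooth_on M W (\<lambda>x. c * f x)"
  by (intro smooth_on_mult smooth_on_const)

lemma smooth_on_minus: "open W \<Longrightarrow> smooth_on M W f \<Longrightarrow> smooth_on M W (\<lambda>x. - f x)"
  using smooth_on_cmult[of W f "-1"] by simp

lemma smooth_on_diff:
  "open W \<Longrightarrow> smooth_on M W f \<Longrightarrow> smooth_on M W g \<Longrightarrow> smooth_on M W (\<lambda>x. f x - g x)"
  using smooth_on_add[OF _ _ smooth_on_minus, of W f g] by simp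

lemma smooth_on_sum:
  "open W \<Longrightarrow> (\<And>i. i \<in> S \<Longrightarrow> smooth_on M W (f i)) \<Longrightarrow> smooth_on M W (\<lambda>x. \<Sum>i\<in>S. f i x)"
  by (rule smooth_onI, rule Ck_on_sum[OF chart_image_open smooth_onD])

lemma smooth_on_prod:
  "open W \<Longrightarrow> (\<And>i. i \<in> S \<Longrightarrow> smooth_on M W (f i)) \<Longrightarrow> smooth_on M W (\<lambda>x. \<Prod>i\<in>S. f i x)"
  by (induction S rule: infinite_finite_induct) (auto intro: smooth_on_const smooth_on_mult)

lemma smooth_on_powr:
  assumes "open W" "smooth_on M W f" "\<And>x. x \<in> W \<Longrightarrow> f x > 0"
  shows "smooth_on M W (\<lambda>x. f x powr s)"
  by (rule smooth_onI, rule Ck_on_powr[OF chart_image_open _ smooth_onD[OF assms(2)]])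
    (use assms(1,3) in auto)

lemma smooth_on_flat_exp:
  "open W \<Longrightarrow> smooth_on M W f \<Longrightarrow> smooth_on M W (\<lambda>x. flat_exp p (f x))"
  by (rule smooth_onI, rule Ck_on_flat_exp[OF chart_image_open smooth_onD])

lemma smooth_on_local:
  assumes "open W" "\<And>x. x \<in> W \<Longrightarrow> \<exists>W'. open W' \<and> x \<in> W' \<and> smooth_on M (W \<inter> W') f"
  shows "smooth_on M W f"
proof (rule smooth_onI, rule Ck_on_local)
  fix U \<phi> k y assume c: "(U, \<phi>) \<in> charts M" and "y \<in> \<phi> ` (W \<inter> U)"
  then obtain x where x: "x \<in> W" "x \<in> U" "y = \<phi> x" by auto
  then obtain W' where W': "open W'" "x \<in> W'" "smooth_on M (W \<inter> W') f" using assms(2) by blast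
  \<comment> \<open>\<open>Ck_on_local\<close> localizes by open sets of the whole function space,
    so the chart image of \<open>W'\<close> is written as the trace of such a set.\<close>
  obtain T where T: "open T" "\<phi> ` (W' \<inter> U) = T \<inter> {x. \<forall>i\<ge>dimension M. x i = 0}"
    using chart_image_open[OF c W'(1)] unfolding openin_Euclidean_space_iff by blast
  have sub: "\<phi> ` U \<subseteq> {x. \<forall>i\<ge>dimension M. x i = 0}"
    using openin_subset[OF chart_image_open[OF c open_UNIV]] by (auto simp: topspace_Euclidean_space)
  have "\<phi> ` (W \<inter> U) \<inter> T \<subseteq> \<phi> ` (W \<inter> W' \<inter> U)"
  proof
    fix z assume z: "z \<in> \<phi> ` (W \<inter> U) \<inter> T"
    then obtain w where w: "w \<in> W" "w \<in> U" "z = \<phi> w" by auto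
    then have "\<phi> w \<in> \<phi> ` (W' \<inter> U)" using z T(2) sub by blast
    then have "w \<in> W'" using inj_onD[OF is_chart_inj[OF chart[OF c]]] w by blast
    then show "z \<in> \<phi> ` (W \<inter> W' \<inter> U)" using w by auto
  qed
  then have "Ck_on (dimension M) k (\<phi> ` (W \<inter> U) \<inter> T) (\<lambda>y. f (inv_into U \<phi> y))"
    by (rule Ck_on_subset[OF smooth_onD[OF W'(3) c]])
  moreover have "y \<in> T" using T(2) x W'(2) by blast
  ultimately show "\<exists>T. open T \<and> y \<in> T \<and>
      Ck_on (dimension M) k (\<phi> ` (W \<inter> U) \<inter> T) (\<lambda>y. f (inv_into U \<phi> y))"
    using T(1) by blast
qed

lemma transition_smooth:
  assumes "(U, \<phi>) \<in> charts M" "(V, \<psi>) \<in> charts M" "i < dimension M"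
  shows "Ck_on (dimension M) k (\<phi> ` (U \<inter> V)) (\<lambda>y. \<psi> (inv_into U \<phi> y) i)"
proof -
  have "\<forall>c\<in>charts M. \<forall>d\<in>charts M. smooth_transition (dimension M) c d"
    using manifold unfolding is_manifold_def by (elim conjE)
  from bspec[OF bspec[OF this assms(1)] assms(2)] show ?thesis
    using assms(3) by (simp add: smooth_transition_def Cinf_on_def)
qed

text \<open>Composition with the transition maps carries smoothness from one chart to every chart of
  the atlas.\<close>

lemma smooth_on_chartI:
  assumes c: "(U, \<phi>) \<in> charts M" and W: "open W" "W \<subseteq> U"
    and f: "\<And>k. Ck_on (dimension M) k (\<phi> ` W) (\<lambda>y. f (inv_into U \<phi> y))"
  shows "smooth_on M W f"
proof (rule smooth_onI)
  fix V \<psi> k assume d: "(V, \<psi>) \<in> charts M"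
  have "Ck_on (dimension M) k (\<psi> ` (W \<inter> V)) (\<lambda>y. f (inv_into U \<phi> (\<phi> (inv_into V \<psi> y))))"
  proof (rule Ck_on_compose[where n = "dimension M" and V = "\<phi> ` (W \<inter> U)"
        and F = "\<lambda>y. \<phi> (inv_into V \<psi> y)" and f = "\<lambda>y. f (inv_into U \<phi> y)"])
    show "Ck_on (dimension M) k (\<psi> ` (W \<inter> V)) (\<lambda>y. \<phi> (inv_into V \<psi> y) i)"
      if "i < dimension M" for i
      by (rule Ck_on_subset[OF transition_smooth[OF d c that]]) (use W in auto)
    show "Ck_on (dimension M) k (\<phi> ` (W \<inter> U)) (\<lambda>y. f (inv_into U \<phi> y))"
      by (rule Ck_on_subset[OF f]) auto
  qed (use chart_image_open c d W in auto)
  then show "Ck_on (dimension M) k (\<psi> ` (W \<inter> V)) (\<lambda>y. f (inv_into V \<psi> y))"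
    by (rule Ck_on_cong[OF chart_image_open[OF d W(1)]]) (use c d W in auto)
qed

lemma smooth_on_coordinate:
  assumes "(U, \<phi>) \<in> charts M" "i < dimension M"
  shows "smooth_on M U (\<lambda>x. \<phi> x i)"
  by (rule smooth_onI) (use transition_smooth[OF _ assms] in \<open>simp add: Int_commute\<close>)

lemma smooth_on_continuous:
  assumes "open W" "smooth_on M W f"
  shows "continuous_on W f"
proof (rule continuous_on_local)
  fix x assume "x \<in> W"
  obtain U \<phi> where c: "(U, \<phi>) \<in> charts M" "x \<in> U" by (rule chart_exists)
  have "continuous_on (W \<inter> U) (\<lambda>x. f (inv_into U \<phi> (\<phi> x)))"
    by (rule continuous_on_compose2[OF Ck_on_continuous[OF smooth_onD[OF assms(2) c(1), of 0]]
          continuous_on_subset[OF is_chart_homeomorphism(1)[OF chart[OF c(1)]]]]) auto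
  moreover have "f (inv_into U \<phi> (\<phi> x)) = f x" if "x \<in> W \<inter> U" for x
    using that c by simp
  ultimately have "continuous_on (W \<inter> U) f" by (metis (no_types, lifting) continuous_on_cong)
  then show "\<exists>U. open U \<and> x \<in> U \<and> continuous_on (W \<inter> U) f"
    using c chart_open by blast
qed

text \<open>Transition maps of the smaller chart are restrictions, so maximality of the atlas admits
  it. A coordinate system needs a chart and a frame on the same domain, which is reached by
  shrinking both.\<close>

lemma chart_restrict:
  assumes c: "(U, \<phi>) \<in> charts M" and W: "open W" "W \<subseteq> U"
  shows "(W, \<phi>) \<in> charts M"
proof -
  have inv: "inv_into W \<phi> y = inv_into U \<phi> y" if "y \<in> \<phi> ` W" for y
    using that W(2) inj_on_subset[OF is_chart_inj[OF chart[OF c]] W(2)] c by auto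
  have "smooth_transition (dimension M) (W, \<phi>) (V, \<psi>) \<and> smooth_transition (dimension M) (V, \<psi>) (W, \<phi>)"
    if d: "(V, \<psi>) \<in> charts M" for V \<psi>
  proof
    have "Ck_on (dimension M) k (\<phi> ` (W \<inter> V)) (\<lambda>y. \<psi> (inv_into W \<phi> y) i)"
      if "i < dimension M" for i k
    proof (rule Ck_on_cong)
      show "Ck_on (dimension M) k (\<phi> ` (W \<inter> V)) (\<lambda>y. \<psi> (inv_into U \<phi> y) i)"
        by (rule Ck_on_subset[OF transition_smooth[OF c d that]]) (use W in auto)
      show "openin (Euclidean_space (dimension M)) (\<phi> ` (W \<inter> V))"
        by (rule is_chart_image_open[OF chart[OF c]]) (use W chart_open[OF d] in auto)
      show "\<psi> (inv_into U \<phi> z) i = \<psi> (inv_into W \<phi> z) i" if "z \<in> \<phi> ` (W \<inter> V)" for z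
        using inv[of z] that by auto
    qed
    then show "smooth_transition (dimension M) (W, \<phi>) (V, \<psi>)"
      by (simp add: smooth_transition_def Cinf_on_def)
    have "Ck_on (dimension M) k (\<psi> ` (V \<inter> W)) (\<lambda>y. \<phi> (inv_into V \<psi> y) i)"
      if "i < dimension M" for i k
      by (rule Ck_on_subset[OF transition_smooth[OF d c that]]) (use W in auto)
    then show "smooth_transition (dimension M) (V, \<psi>) (W, \<phi>)"
      by (simp add: smooth_transition_def Cinf_on_def)
  qed
  moreover have "\<forall>c. is_chart (dimension M) c \<and> (\<forall>d\<in>charts M. smooth_transition (dimension M) c d \<and>
      smooth_transition (dimension M) d c) \<longrightarrow> c \<in> charts M"
    using manifold unfolding is_manifold_def by (elim conjE)
  ultimately show ?thesis
    using is_chart_restrict[OF chart[OF c] W] by (metis prod.collapse)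
qed

section \<open>Derivatives in charts and extension by bump functions\<close>

lemma chart_deriv_eq: "chart_deriv (U, \<phi>) i f x = partial i (\<lambda>y. f (inv_into U \<phi> y)) (\<phi> x)"
  by (simp add: chart_deriv_def)

lemma chart_deriv_cong:
  assumes c: "(U, \<phi>) \<in> charts M" and W: "open W" "x \<in> W" "x \<in> U" and "i < dimension M"
    and "\<And>y. y \<in> W \<Longrightarrow> y \<in> U \<Longrightarrow> f y = g y"
  shows "chart_deriv (U, \<phi>) i f x = chart_deriv (U, \<phi>) i g x"
  unfolding chart_deriv_eq
  by (rule partial_cong[OF chart_image_open[OF c W(1)]]) (use assms in auto)

lemma chart_deriv_DERIV:
  assumes "(U, \<phi>) \<in> charts M" "smooth_on M W f" "x \<in> W" "x \<in> U" "i < dimension M"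
  shows "((\<lambda>t. f (inv_into U \<phi> ((\<phi> x)(i := t)))) has_field_derivative chart_deriv (U, \<phi>) i f x)
    (at (\<phi> x i))"
  unfolding chart_deriv_eq
  by (rule Ck_on_DERIV[OF smooth_onD[OF assms(2,1), of "Suc 0"]]) (use assms in auto)

lemma chart_derivI:
  assumes "((\<lambda>t. f (inv_into U \<phi> ((\<phi> x)(i := t)))) has_field_derivative D) (at (\<phi> x i))"
  shows "chart_deriv (U, \<phi>) i f x = D"
  unfolding chart_deriv_eq partial_def by (rule DERIV_imp_deriv[OF assms])

lemma chart_deriv_const [simp]: "chart_deriv (U, \<phi>) i (\<lambda>_. c) x = 0"
  by (rule chart_derivI) simp

lemma chart_deriv_add:
  assumes "(U, \<phi>) \<in> charts M" "smooth_on M W f" "smooth_on M W g" "x \<in> W" "x \<in> U" "i < dimension M"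
  shows "chart_deriv (U, \<phi>) i (\<lambda>y. f y + g y) x =
    chart_deriv (U, \<phi>) i f x + chart_deriv (U, \<phi>) i g x"
  by (rule chart_derivI[OF DERIV_add[OF chart_deriv_DERIV[OF assms(1,2,4-6)]
        chart_deriv_DERIV[OF assms(1,3-6)]]])

lemma chart_deriv_mult:
  assumes "(U, \<phi>) \<in> charts M" "smooth_on M W f" "smooth_on M W g" "x \<in> W" "x \<in> U" "i < dimension M"
  shows "chart_deriv (U, \<phi>) i (\<lambda>y. f y * g y) x =
    chart_deriv (U, \<phi>) i f x * g x + f x * chart_deriv (U, \<phi>) i g x"
proof (rule chart_derivI)
  show "((\<lambda>t. f (inv_into U \<phi> ((\<phi> x)(i := t))) * g (inv_into U \<phi> ((\<phi> x)(i := t))))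
      has_field_derivative chart_deriv (U, \<phi>) i f x * g x + f x * chart_deriv (U, \<phi>) i g x) (at (\<phi> x i))"
    using DERIV_mult[OF chart_deriv_DERIV[OF assms(1,2,4,5,6)] chart_deriv_DERIV[OF assms(1,3,4,5,6)]]
    unfolding fun_upd_triv chart_inv[OF assms(1,5)] by (simp only: add.commute mult.commute)
qed

lemma chart_deriv_sum:
  assumes "(U, \<phi>) \<in> charts M" "open W" "\<And>a. a \<in> S \<Longrightarrow> smooth_on M W (f a)"
    "x \<in> W" "x \<in> U" "i < dimension M"
  shows "chart_deriv (U, \<phi>) i (\<lambda>y. \<Sum>a\<in>S. f a y) x = (\<Sum>a\<in>S. chart_deriv (U, \<phi>) i (f a) x)"
  using assms(3)
proof (induction S rule: infinite_finite_induct)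
  case (insert a S)
  then show ?case
    by (simp add: chart_deriv_add[OF assms(1) _ smooth_on_sum[OF assms(2)] assms(4-6)])
qed simp_all

lemma smooth_on_chart_deriv:
  assumes c: "(U, \<phi>) \<in> charts M" and W: "open W" "W \<subseteq> U" and f: "smooth_on M W f"
    and i: "i < dimension M"
  shows "smooth_on M W (chart_deriv (U, \<phi>) i f)"
proof (rule smooth_on_chartI[OF c W])
  fix k
  have WU: "W \<inter> U = W" using W by auto
  have "Ck_on (dimension M) k (\<phi> ` W) (partial i (\<lambda>y. f (inv_into U \<phi> y)))"
    using smooth_onD[OF f c, of "Suc k"] i by (simp add: WU)
  then show "Ck_on (dimension M) k (\<phi> ` W) (\<lambda>y. chart_deriv (U, \<phi>) i f (inv_into U \<phi> y))"
    by (rule Ck_on_cong[OF is_chart_image_open[OF chart[OF c] W]])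
      (use W c in \<open>auto simp: chart_deriv_eq\<close>)
qed

lemma chart_deriv_chain:
  assumes c: "(U, \<phi>) \<in> charts M" and d: "(V, \<psi>) \<in> charts M" and W: "open W" and f: "smooth_on M W f"
    and x: "x \<in> W" "x \<in> U" "x \<in> V" and j: "j < dimension M"
  shows "chart_deriv (V, \<psi>) j f x =
    (\<Sum>i<dimension M. chart_deriv (V, \<psi>) j (\<lambda>y. \<phi> y i) x * chart_deriv (U, \<phi>) i f x)"
proof (rule chart_derivI)
  \<comment> \<open>The coordinate line of \<psi>, seen in the chart \<phi>, is the curve for the
    chain rule.\<close>
  let ?\<gamma> = "\<lambda>t. \<phi> (inv_into V \<psi> ((\<psi> x)(j := t)))"
  let ?W = "W \<inter> U \<inter> V"
  have oW: "open ?W" using W chart_open c d by auto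
  have ev: "eventually (\<lambda>t. (\<psi> x)(j := t) \<in> \<psi> ` (?W \<inter> V)) (nhds (\<psi> x j))"
    by (rule eventually_coordinate_line[OF chart_image_open[OF d oW]]) (use x j in auto)
  then have ev': "eventually (\<lambda>t. inv_into V \<psi> ((\<psi> x)(j := t)) \<in> ?W) (nhds (\<psi> x j))"
    by (rule eventually_mono) (use d in auto)
  have "((\<lambda>t. f (inv_into U \<phi> (?\<gamma> t))) has_field_derivative
      (\<Sum>i<dimension M. partial i (\<lambda>y. f (inv_into U \<phi> y)) (?\<gamma> (\<psi> x j)) *
         chart_deriv (V, \<psi>) j (\<lambda>y. \<phi> y i) x)) (at (\<psi> x j))"
  proof (rule chain_rule_curve[OF chart_image_open[OF c W] smooth_onD[OF f c, of "Suc 0"]])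
    show "?\<gamma> (\<psi> x j) \<in> \<phi> ` (W \<inter> U)" using x d by simp
    show "((\<lambda>t. ?\<gamma> t i) has_field_derivative chart_deriv (V, \<psi>) j (\<lambda>y. \<phi> y i) x) (at (\<psi> x j))"
      if "i < dimension M" for i
      by (rule chart_deriv_DERIV[OF d smooth_on_coordinate[OF c that] x(2,3) j])
    show "\<forall>\<^sub>F t in nhds (\<psi> x j). \<forall>i\<ge>dimension M. ?\<gamma> t i = 0"
      using ev'
      by (rule eventually_mono)
        (use openin_Euclidean_space_zero[OF chart_image_open[OF c open_UNIV]] in auto)
  qed
  moreover have "eventually (\<lambda>t. f (inv_into U \<phi> (?\<gamma> t)) = f (inv_into V \<psi> ((\<psi> x)(j := t))))
      (nhds (\<psi> x j))"
    using ev' by (rule eventually_mono) (use c in simp)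
  ultimately have "((\<lambda>t. f (inv_into V \<psi> ((\<psi> x)(j := t)))) has_field_derivative
      (\<Sum>i<dimension M. partial i (\<lambda>y. f (inv_into U \<phi> y)) (?\<gamma> (\<psi> x j)) *
         chart_deriv (V, \<psi>) j (\<lambda>y. \<phi> y i) x)) (at (\<psi> x j))"
    by (subst (asm) DERIV_cong_ev[OF refl _ refl])
  then show "((\<lambda>t. f (inv_into V \<psi> ((\<psi> x)(j := t)))) has_field_derivative
      (\<Sum>i<dimension M. chart_deriv (V, \<psi>) j (\<lambda>y. \<phi> y i) x * chart_deriv (U, \<phi>) i f x))
      (at (\<psi> x j))"
    using x d by (simp add: chart_deriv_eq mult.commute)
qed

lemma chart_deriv_coordinate:
  assumes c: "(U, \<phi>) \<in> charts M" and x: "x \<in> U" and i: "i < dimension M"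
  shows "chart_deriv (U, \<phi>) i (\<lambda>y. \<phi> y j) x = (if i = j then 1 else 0)"
proof (rule chart_derivI)
  have ev: "eventually (\<lambda>t. (\<phi> x)(i := t) \<in> \<phi> ` (UNIV \<inter> U)) (nhds (\<phi> x i))"
    by (rule eventually_coordinate_line[OF chart_image_open[OF c open_UNIV]]) (use x i in auto)
  have "eventually (\<lambda>t. (if i = j then t else \<phi> x j) = \<phi> (inv_into U \<phi> ((\<phi> x)(i := t))) j)
      (nhds (\<phi> x i))"
    using ev by (rule eventually_mono) (auto simp: f_inv_into_f)
  moreover have "((\<lambda>t. if i = j then t else \<phi> x j) has_field_derivative (if i = j then 1 else 0))
      (at (\<phi> x i))"
    by (cases "i = j") auto
  ultimately show "((\<lambda>t. \<phi> (inv_into U \<phi> ((\<phi> x)(i := t))) j) has_field_derivative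
      (if i = j then 1 else 0)) (at (\<phi> x i))"
    by (subst (asm) DERIV_cong_ev[OF refl _ refl])
qed

text \<open>One flat factor per coordinate, positive only within distance \<open>R\<close>. The
  support lies in the preimage of a compact box; compact sets are closed in a Hausdorff space, so
  extension by 0 stays smooth across the boundary of the chart domain. The value at
  \<open>x0\<close> only has to be invertible, as sections are later rescaled by it.\<close>

lemma bump_exists:
  assumes W: "open W" "x0 \<in> W"
  obtains f K where "smooth_on M UNIV f" "f x0 \<noteq> 0" "closed K" "K \<subseteq> W" "\<And>x. x \<notin> K \<Longrightarrow> f x = 0"
proof -
  obtain U \<phi> where c: "(U, \<phi>) \<in> charts M" "x0 \<in> U" by (rule chart_exists)
  let ?n = "dimension M"
  let ?y = "\<phi> x0"
  obtain \<epsilon> where \<epsilon>: "\<epsilon> > 0"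
    "\<And>z. (\<And>i. i < ?n \<Longrightarrow> \<bar>z i - ?y i\<bar> < \<epsilon>) \<Longrightarrow> (\<And>i. i \<ge> ?n \<Longrightarrow> z i = 0) \<Longrightarrow> z \<in> \<phi> ` (W \<inter> U)"
    using openin_Euclidean_space_box[OF chart_image_open[OF c(1) W(1)], of ?y] W(2) c(2) by blast
  \<comment> \<open>Half the radius puts the closed box inside the open one.\<close>
  define R where "R = \<epsilon> / 2"
  have R: "R > 0" "R < \<epsilon>" using \<epsilon>(1) by (auto simp: R_def)
  \<comment> \<open>The factor \<open>{0}\<close> at the indices from \<open>?n\<close> on makes
    this a product of compact sets, and compactness follows for the infinite product.\<close>
  define K0 where "K0 = (\<Pi>\<^sub>E i\<in>UNIV. if i < ?n then {?y i - R..?y i + R} else {0})"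
  have K0_iff: "z \<in> K0 \<longleftrightarrow> (\<forall>i<?n. \<bar>z i - ?y i\<bar> \<le> R) \<and> (\<forall>i\<ge>?n. z i = 0)" for z
    unfolding K0_def PiE_UNIV_domain Pi_iff by (smt (verit) abs_le_iff atLeastAtMost_iff not_less singletonD singletonI UNIV_I)
  have "compactin (product_topology (\<lambda>i. euclidean) UNIV) K0"
    unfolding K0_def by (subst compactin_PiE) (auto simp: compactin_euclidean_iff)
  then have "compact K0" by (simp add: euclidean_product_topology compactin_euclidean_iff)
  moreover have K0: "K0 \<subseteq> \<phi> ` (W \<inter> U)"
  proof
    fix z assume "z \<in> K0"
    then show "z \<in> \<phi> ` (W \<inter> U)" using R by (intro \<epsilon>(2)) (force simp: K0_iff)+
  qed
  ultimately have "compact (inv_into U \<phi> ` K0)"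
    by (intro compact_continuous_image continuous_on_subset[OF is_chart_homeomorphism(2)[OF chart[OF c(1)]]])
      auto
  then have closed: "closed (inv_into U \<phi> ` K0)" by (rule compact_imp_closed)
  have KW: "inv_into U \<phi> ` K0 \<subseteq> W \<inter> U" using K0 c by force
  define f where "f x = (if x \<in> U then \<Prod>i<?n. flat_exp 1 (R\<^sup>2 - (\<phi> x i - ?y i)\<^sup>2) else 0)" for x
  have f0: "f x = 0" if "x \<notin> inv_into U \<phi> ` K0" for x
  proof (cases "x \<in> U")
    case True
    then have "\<phi> x \<notin> K0" using that c by (metis chart_inv image_eqI)
    moreover have "\<phi> x i = 0" if "i \<ge> ?n" for i
      using openin_Euclidean_space_zero[OF chart_image_open[OF c(1) open_UNIV], of "\<phi> x"] that True by auto
    ultimately obtain i where i: "i < ?n" "\<not> \<bar>\<phi> x i - ?y i\<bar> \<le> R" using K0_iff by auto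
    then have "R\<^sup>2 \<le> (\<phi> x i - ?y i)\<^sup>2" using R(1) by (simp add: abs_le_square_iff[symmetric])
    then have "flat_exp 1 (R\<^sup>2 - (\<phi> x i - ?y i)\<^sup>2) = 0" by (simp add: flat_exp_def)
    then show ?thesis using i(1) True by (auto simp: f_def)
  qed (simp add: f_def)
  have fU: "smooth_on M U f"
  proof (rule smooth_on_cong)
    show "smooth_on M U (\<lambda>x. \<Prod>i<?n. flat_exp 1 (R\<^sup>2 - (\<phi> x i - ?y i)\<^sup>2))"
      unfolding power2_eq_square
      by (intro smooth_on_prod smooth_on_flat_exp smooth_on_diff smooth_on_const smooth_on_mult
          smooth_on_coordinate chart_open[OF c(1)] c(1)) auto
  qed (use chart_open c in \<open>auto simp: f_def\<close>)
  have "smooth_on M UNIV f"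
  proof (rule smooth_on_local)
    fix x :: 'm
    show "\<exists>W'. open W' \<and> x \<in> W' \<and> smooth_on M (UNIV \<inter> W') f"
    proof (cases "x \<in> U")
      case True
      then show ?thesis using fU chart_open c by (intro exI[of _ U]) auto
    next
      case False
      have "smooth_on M (- inv_into U \<phi> ` K0) f"
        by (rule smooth_on_cong[OF _ smooth_on_const[of _ 0]]) (use closed f0 in auto)
      then show ?thesis using closed KW False by (intro exI[of _ "- inv_into U \<phi> ` K0"]) auto
    qed
  qed simp
  moreover have "f x0 \<noteq> 0" using c R by (simp add: f_def flat_exp_def)
  ultimately show ?thesis using that closed KW f0 by blast
qed

text \<open>As \<open>K\<close> lies in \<open>W\<close>, the open sets \<open>W\<close> and
  \<open>- K\<close> cover everything; \<open>h\<close> is a smooth product on the one and 0 on the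
  other.\<close>

lemma smooth_on_extend:
  assumes f: "smooth_on M UNIV f" and K: "closed K" "K \<subseteq> W" "\<And>x. x \<notin> K \<Longrightarrow> f x = 0"
    and V: "open V" and W: "open W" and g: "smooth_on M (V \<inter> W) g"
    and h: "\<And>x. x \<in> V \<inter> W \<Longrightarrow> h x = f x * g x" "\<And>x. x \<in> V - W \<Longrightarrow> h x = 0"
  shows "smooth_on M V h"
proof (rule smooth_on_local[OF V])
  fix x assume x: "x \<in> V"
  show "\<exists>W'. open W' \<and> x \<in> W' \<and> smooth_on M (V \<inter> W') h"
  proof (cases "x \<in> W")
    case True
    have "smooth_on M (V \<inter> W) h"
      by (rule smooth_on_cong[OF _ smooth_on_mult[OF _ smooth_on_subset[OF f] g]]) (use V W h in auto)
    then show ?thesis using True W by blast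
  next
    case False
    have "smooth_on M (V \<inter> - K) h"
    proof (rule smooth_on_cong[OF _ smooth_on_const[of _ 0]])
      show "0 = h y" if "y \<in> V \<inter> - K" for y
        using h[of y] K(3)[of y] that by (cases "y \<in> W") auto
    qed (use V K in auto)
    then show ?thesis using False K by (intro exI[of _ "- K"]) auto
  qed
qed

end

section \<open>Metric vector bundles\<close>

lemma basis_familyI:
  fixes f :: "nat \<Rightarrow> 'v::real_vector"
  assumes S: "subspace S" "\<And>a. a < r \<Longrightarrow> f a \<in> S"
    and span: "\<And>v. v \<in> S \<Longrightarrow> \<exists>c. v = (\<Sum>a<r. c a *\<^sub>R f a)"
    and indep: "\<And>c a. (\<Sum>a<r. c a *\<^sub>R f a) = 0 \<Longrightarrow> a < r \<Longrightarrow> c a = 0"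
  shows "inj_on f {..<r}" "independent (f ` {..<r})" "span (f ` {..<r}) = S"
proof -
  show inj: "inj_on f {..<r}"
  proof (rule inj_onI, rule ccontr)
    fix a b assume ab: "a \<in> {..<r}" "b \<in> {..<r}" "f a = f b" "a \<noteq> b"
    \<comment> \<open>A vector occurring twice gives a vanishing combination with coefficients 1 and
      -1.\<close>
    have "(\<Sum>i<r. ((if i = a then 1 else 0) - (if i = b then 1 else 0)) *\<^sub>R f i) =
        (\<Sum>i<r. if i = a then f i else 0) - (\<Sum>i<r. if i = b then f i else 0)"
      unfolding sum_subtractf[symmetric] by (rule sum.cong) auto
    also have "\<dots> = 0" using ab by simp
    finally have "(if a = a then 1 else 0) - (if a = b then 1 else 0) = (0 :: real)"
      by (rule indep) (use ab in auto)
    then show False using ab by simp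
  qed
  show "independent (f ` {..<r})"
  proof (rule independent_if_scalars_zero)
    fix c x assume *: "(\<Sum>x\<in>f ` {..<r}. c x *\<^sub>R x) = 0" "x \<in> f ` {..<r}"
    then have "(\<Sum>a<r. c (f a) *\<^sub>R f a) = 0" by (simp add: sum.reindex[OF inj])
    then show "c x = 0" using *(2) indep[of "\<lambda>a. c (f a)"] by auto
  qed simp
  show "span (f ` {..<r}) = S"
  proof
    show "span (f ` {..<r}) \<subseteq> S" by (rule span_minimal) (use S in auto)
    show "S \<subseteq> span (f ` {..<r})"
    proof
      fix v assume "v \<in> S"
      then obtain c where "v = (\<Sum>a<r. c a *\<^sub>R f a)" using span by blast
      moreover have "(\<Sum>a<r. c a *\<^sub>R f a) \<in> span (f ` {..<r})"
        by (rule span_sum, rule span_scale, rule span_base) simp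
      ultimately show "v \<in> span (f ` {..<r})" by simp
    qed
  qed
qed

locale metric_vector_bundle =
  fixes E :: "('m::{t2_space,second_countable_topology}, 'v::real_vector, 'z) metric_bundle_scheme"
  assumes metric_bundle: "is_metric_bundle E"
begin

lemma vector_bundle: "is_vector_bundle E" and metric: "is_metric E"
  using metric_bundle by (auto simp: is_metric_bundle_def)

sublocale smooth_manifold E
  by standard (use vector_bundle in \<open>simp add: is_vector_bundle_def\<close>)

abbreviation "r \<equiv> rank E"
abbreviation "n \<equiv> dimension E"

lemma subspace_fibre: "subspace (fibre E x)"
  using vector_bundle by (simp add: is_vector_bundle_def)

lemmas fibre_add [intro] = subspace_add[OF subspace_fibre]
  and fibre_scale [intro] = subspace_scale[OF subspace_fibre]
  and fibre_sum [intro] = subspace_sum[OF subspace_fibre]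
  and fibre_diff [intro] = subspace_diff[OF subspace_fibre]
  and fibre_0 [simp] = subspace_0[OF subspace_fibre]

lemma frame: "(U, e) \<in> frames E \<Longrightarrow> is_frame E (U, e)"
  using vector_bundle unfolding is_vector_bundle_def by (elim conjE) (rule bspec)

lemma frame_open: "(U, e) \<in> frames E \<Longrightarrow> open U"
  using frame[of U e] by (simp add: is_frame_def)

lemma frame_exists: obtains U e where "(U, e) \<in> frames E" "x \<in> U"
proof -
  have "x \<in> (\<Union>c\<in>frames E. fst c)" using vector_bundle by (simp add: is_vector_bundle_def)
  then show ?thesis using that by auto
qed

lemma frame_coord_smooth:
  assumes "(U, e) \<in> frames E" "(V, d) \<in> frames E" "a < r" "b < r"
  shows "smooth_on E (U \<inter> V) (\<lambda>x. frame_coord E d x (e b x) a)"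
proof -
  have "\<forall>c\<in>frames E. \<forall>d\<in>frames E. frames_compatible E c d"
    using vector_bundle unfolding is_vector_bundle_def by (elim conjE)
  from bspec[OF bspec[OF this assms(1)] assms(2)] show ?thesis
    using assms(3,4) by (simp add: frames_compatible_def)
qed

lemma frame_maximal:
  assumes "is_frame E c" "\<And>d. d \<in> frames E \<Longrightarrow> frames_compatible E c d"
    "\<And>d. d \<in> frames E \<Longrightarrow> frames_compatible E d c"
  shows "c \<in> frames E"
proof -
  have "\<forall>c. is_frame E c \<and> (\<forall>d\<in>frames E. frames_compatible E c d \<and> frames_compatible E d c) \<longrightarrow>
      c \<in> frames E"
    using vector_bundle unfolding is_vector_bundle_def by (elim conjE)
  then show ?thesis using assms by (cases c) auto
qed

context
  fixes U e x
  assumes fr: "is_frame E (U, e)" and x: "x \<in> U"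
begin

lemma frame_in_fibre: "a < r \<Longrightarrow> e a x \<in> fibre E x"
proof -
  assume "a < r"
  then have "e a x \<in> span ((\<lambda>a. e a x) ` {..<r})" by (intro span_base imageI) simp
  then show ?thesis using fr x by (simp add: is_frame_def)
qed

lemma frame_coord_combination:
  assumes "a < r"
  shows "frame_coord E e x (\<Sum>b<r. c b *\<^sub>R e b x) a = c a"
proof -
  let ?B = "(\<lambda>a. e a x) ` {..<r}"
  have i: "independent ?B" and inj: "inj_on (\<lambda>a. e a x) {..<r}"
    using fr x by (auto simp: is_frame_def)
  have "representation ?B (\<Sum>b<r. c b *\<^sub>R e b x) (e a x) =
      (\<Sum>b<r. c b * representation ?B (e b x) (e a x))"
    by (subst representation_sum[OF i])
      (simp_all add: span_scale span_base representation_scale[OF i])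
  also have "\<dots> = (\<Sum>b<r. if b = a then c b else 0)"
    by (rule sum.cong) (use assms inj in \<open>auto simp: representation_basis[OF i] inj_on_def\<close>)
  finally show ?thesis using assms by (simp add: frame_coord_def)
qed

lemma frame_expansion:
  assumes "v \<in> fibre E x"
  shows "v = (\<Sum>a<r. frame_coord E e x v a *\<^sub>R e a x)"
proof -
  let ?B = "(\<lambda>a. e a x) ` {..<r}"
  have i: "independent ?B" and inj: "inj_on (\<lambda>a. e a x) {..<r}" and s: "v \<in> span ?B"
    using fr x assms by (auto simp: is_frame_def)
  have "(\<Sum>b\<in>?B. representation ?B v b *\<^sub>R b) = v"
    by (rule sum_representation_eq[OF i s]) auto
  then show ?thesis by (simp add: sum.reindex[OF inj] frame_coord_def)
qed

lemma frame_coord_linear: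
  assumes "u \<in> fibre E x" "v \<in> fibre E x" "a < r"
  shows "frame_coord E e x (p *\<^sub>R u + q *\<^sub>R v) a =
    p * frame_coord E e x u a + q * frame_coord E e x v a"
proof -
  have "p *\<^sub>R u + q *\<^sub>R v =
      (\<Sum>a<r. (p * frame_coord E e x u a + q * frame_coord E e x v a) *\<^sub>R e a x)"
    by (subst frame_expansion[OF assms(1)], subst frame_expansion[OF assms(2)])
      (simp add: scaleR_sum_right sum.distrib algebra_simps)
  then show ?thesis using frame_coord_combination[OF assms(3)] by simp
qed

lemma frame_coord_frame:
  assumes "a < r" "b < r"
  shows "frame_coord E e x (e b x) a = (if a = b then 1 else 0)"
proof -
  have "e b x = (\<Sum>i<r. (if i = b then 1 else 0) *\<^sub>R e i x)"
    using assms by (simp add: if_distrib[of "\<lambda>c. c *\<^sub>R _"] cong: if_cong)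
  from arg_cong[OF this, of "\<lambda>v. frame_coord E e x v a"] show ?thesis
    unfolding frame_coord_combination[OF assms(1)] .
qed

end

lemma frame_coord_sum:
  assumes "is_frame E (U, e)" "x \<in> U" "a < r" "\<And>i. i \<in> S \<Longrightarrow> v i \<in> fibre E x"
  shows "frame_coord E e x (\<Sum>i\<in>S. c i *\<^sub>R v i) a = (\<Sum>i\<in>S. c i * frame_coord E e x (v i) a)"
  using assms(4)
proof (induction S rule: infinite_finite_induct)
  case (insert i S)
  then show ?case
    using frame_coord_linear[OF assms(1,2), of "v i" "\<Sum>i\<in>S. c i *\<^sub>R v i" a "c i" 1] assms(3) by auto
qed (use frame_coord_linear[OF assms(1,2), of 0 0 a 0 0] assms(3) in auto)

section \<open>The fibre metric\<close>

lemma metric_linear: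
  assumes "u \<in> fibre E x" "v \<in> fibre E x" "w \<in> fibre E x"
  shows "metric E x (p *\<^sub>R u + q *\<^sub>R v) w = p * metric E x u w + q * metric E x v w"
  using metric assms unfolding is_metric_def by (elim conjE) blast

lemma metric_sym: "u \<in> fibre E x \<Longrightarrow> v \<in> fibre E x \<Longrightarrow> metric E x u v = metric E x v u"
  using metric unfolding is_metric_def by (elim conjE) blast

lemma metric_nondegenerate:
  assumes "u \<in> fibre E x" "\<And>v. v \<in> fibre E x \<Longrightarrow> metric E x u v = 0"
  shows "u = 0"
proof -
  have "\<forall>x. \<forall>u\<in>fibre E x. (\<forall>v\<in>fibre E x. metric E x u v = 0) \<longrightarrow> u = 0"
    using metric unfolding is_metric_def by (elim conjE)
  then show ?thesis using assms by simp
qed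

lemma metric_smooth:
  assumes "(U, e) \<in> frames E" "a < r" "b < r"
  shows "smooth_on E U (\<lambda>x. metric E x (e a x) (e b x))"
proof -
  have "\<forall>(U, e)\<in>frames E. \<forall>a<rank E. \<forall>b<rank E. smooth_on E U (\<lambda>x. metric E x (e a x) (e b x))"
    using metric unfolding is_metric_def by (elim conjE)
  from bspec[OF this assms(1)] show ?thesis using assms(2,3) by simp
qed

lemma metric_sum:
  assumes "w \<in> fibre E x" "\<And>i. i \<in> S \<Longrightarrow> v i \<in> fibre E x"
  shows "metric E x (\<Sum>i\<in>S. c i *\<^sub>R v i) w = (\<Sum>i\<in>S. c i * metric E x (v i) w)"
  using assms(2)
proof (induction S rule: infinite_finite_induct)
  case (insert i S)
  then show ?case
    using metric_linear[of "v i" x "\<Sum>i\<in>S. c i *\<^sub>R v i" w "c i" 1] assms(1) by auto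
qed (use metric_linear[of 0 x 0 w 0 0] assms(1) in auto)

lemma metric_sum_right:
  assumes "w \<in> fibre E x" "\<And>i. i \<in> S \<Longrightarrow> v i \<in> fibre E x"
  shows "metric E x w (\<Sum>i\<in>S. c i *\<^sub>R v i) = (\<Sum>i\<in>S. c i * metric E x w (v i))"
proof -
  have "metric E x w (\<Sum>i\<in>S. c i *\<^sub>R v i) = metric E x (\<Sum>i\<in>S. c i *\<^sub>R v i) w"
    by (rule metric_sym) (use assms in auto)
  also have "\<dots> = (\<Sum>i\<in>S. c i * metric E x (v i) w)"
    by (rule metric_sum[OF assms])
  also have "\<dots> = (\<Sum>i\<in>S. c i * metric E x w (v i))"
    by (rule sum.cong) (use assms metric_sym in auto)
  finally show ?thesis .
qed

lemma metric_diff: "u \<in> fibre E x \<Longrightarrow> v \<in> fibre E x \<Longrightarrow> w \<in> fibre E x \<Longrightarrow>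
    metric E x (u - v) w = metric E x u w - metric E x v w"
  using metric_linear[of u x v w 1 "-1"] by simp

lemma metric_scale: "u \<in> fibre E x \<Longrightarrow> w \<in> fibre E x \<Longrightarrow>
    metric E x (c *\<^sub>R u) w = c * metric E x u w"
  using metric_linear[of u x u w c 0] by simp

section \<open>New frames from old ones\<close>

lemma frame_restrict:
  assumes f: "(U, e) \<in> frames E" and W: "open W" "W \<subseteq> U"
  shows "(W, e) \<in> frames E"
proof (rule frame_maximal)
  show "is_frame E (W, e)" using frame[OF f] W by (auto simp: is_frame_def)
  fix d assume d: "d \<in> frames E"
  obtain V d' where [simp]: "d = (V, d')" by (cases d)
  show "frames_compatible E (W, e) d"
    unfolding frames_compatible_def using d W
    by (auto intro!: smooth_on_subset[OF frame_coord_smooth[OF f]])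
  show "frames_compatible E d (W, e)"
    unfolding frames_compatible_def using d W
    by (auto intro!: smooth_on_subset[OF frame_coord_smooth[OF _ f]])
qed

lemma frame_replace:
  assumes f: "(U, e) \<in> frames E" and W: "open W" "W \<subseteq> U" and k: "k < r"
    and c: "\<And>a. a < r \<Longrightarrow> smooth_on E W (c a)"
    and h: "smooth_on E W h" "\<And>x. x \<in> W \<Longrightarrow> h x * c k x = 1"
  shows "(W, e(k := \<lambda>x. \<Sum>a<r. c a x *\<^sub>R e a x)) \<in> frames E"
proof -
  define e' where "e' = e(k := \<lambda>x. \<Sum>a<r. c a x *\<^sub>R e a x)"
  \<comment> \<open>Coordinates in the new frame, found by solving for the old \<open>e k\<close>
    and inserting; \<open>h x\<close> stands for division by \<open>c k x\<close>.\<close>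
  define C where "C x v a = (if a = k then h x * frame_coord E e x v k
    else frame_coord E e x v a - h x * frame_coord E e x v k * c a x)" for x v a
  have fW: "is_frame E (W, e)" using frame[OF frame_restrict[OF f W]] .
  have comb: "(\<Sum>a<r. d a *\<^sub>R e' a x) = (\<Sum>a<r. (if a = k then d k * c k x else d a + d k * c a x) *\<^sub>R e a x)"
    for d x
  proof -
    have "(\<Sum>a<r. d a *\<^sub>R e' a x) = d k *\<^sub>R e' k x + (\<Sum>a\<in>{..<r} - {k}. d a *\<^sub>R e' a x)"
      using k by (subst sum.remove[of _ k]) auto
    also have "(\<Sum>a\<in>{..<r} - {k}. d a *\<^sub>R e' a x) = (\<Sum>a<r. if a = k then 0 else d a *\<^sub>R e a x)"
      using k by (subst (2) sum.remove[of _ k]) (auto intro!: sum.cong simp: e'_def)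
    finally show ?thesis
      by (simp add: e'_def scaleR_sum_right flip: sum.distrib)
        (rule sum.cong, auto simp: algebra_simps)
  qed
  have expand: "v = (\<Sum>a<r. C x v a *\<^sub>R e' a x)" if "x \<in> W" "v \<in> fibre E x" for x v
  proof -
    have "(\<Sum>a<r. C x v a *\<^sub>R e' a x) = (\<Sum>a<r. frame_coord E e x v a *\<^sub>R e a x)"
      unfolding comb
    proof (rule sum.cong)
      fix a assume "a \<in> {..<r}"
      have "h x * frame_coord E e x v k * c k x = frame_coord E e x v k"
        using h(2)[OF that(1)] by (metis mult.assoc mult.commute mult.right_neutral)
      then show "(if a = k then C x v k * c k x else C x v a + C x v k * c a x) *\<^sub>R e a x =
          frame_coord E e x v a *\<^sub>R e a x"
        by (simp add: C_def)
    qed simp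
    then show ?thesis using frame_expansion[OF fW that] by simp
  qed
  have e'_fibre: "e' a x \<in> fibre E x" if "x \<in> W" "a < r" for a x
    using frame_in_fibre[OF fW that(1)] that(2) by (auto simp: e'_def)
  have basis: "inj_on (\<lambda>a. e' a x) {..<r} \<and> independent ((\<lambda>a. e' a x) ` {..<r}) \<and>
      span ((\<lambda>a. e' a x) ` {..<r}) = fibre E x" if x: "x \<in> W" for x
  proof -
    have indep: "d a = 0" if "(\<Sum>a<r. d a *\<^sub>R e' a x) = 0" "a < r" for d a
    proof -
      have *: "(if a = k then d k * c k x else d a + d k * c a x) = 0" if "a < r" for a
        using frame_coord_combination[OF fW x that, of "\<lambda>a. if a = k then d k * c k x else d a + d k * c a x"]
          \<open>(\<Sum>a<r. d a *\<^sub>R e' a x) = 0\<close> frame_coord_combination[OF fW x that, of "\<lambda>_. 0"]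
        unfolding comb by simp
      have "d k = 0" using *[OF k] h(2)[OF x] by auto
      then show ?thesis using *[OF that(2)] by (auto split: if_splits)
    qed
    have span: "\<exists>c. v = (\<Sum>a<r. c a *\<^sub>R e' a x)" if "v \<in> fibre E x" for v
      using expand[OF x that] by blast
    show ?thesis
      by (intro conjI; rule basis_familyI[OF subspace_fibre e'_fibre[OF x]];
          (erule span | erule (1) indep | assumption))
  qed
  then have fr': "is_frame E (W, e')" using W by (simp add: is_frame_def)
  have C: "frame_coord E e' x v a = C x v a" if "x \<in> W" "v \<in> fibre E x" "a < r" for x v a
    using frame_coord_combination[OF fr' that(1,3), of "C x v"] expand[OF that(1,2)] by simp
  have "(W, e') \<in> frames E"
  proof (rule frame_maximal[OF fr'])
    fix d assume d: "d \<in> frames E"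
    obtain V d' where [simp]: "d = (V, d')" by (cases d)
    have oV: "open V" using frame_open d by simp
    have s1: "smooth_on E (W \<inter> V) (\<lambda>x. frame_coord E d' x (e b x) a)" if "a < r" "b < r" for a b
      by (rule smooth_on_subset[OF frame_coord_smooth[OF f _ that]]) (use d W in auto)
    have s2: "smooth_on E (V \<inter> W) (\<lambda>x. frame_coord E e x (d' b x) a)" if "a < r" "b < r" for a b
      by (rule smooth_on_subset[OF frame_coord_smooth[OF _ f that]]) (use d W in auto)
    have fd: "is_frame E (V, d')" using frame d by simp
    have "smooth_on E (W \<inter> V) (\<lambda>x. frame_coord E d' x (e' b x) a)" if "a < r" "b < r" for a b
    proof (cases "b = k")
      case True
      have "smooth_on E (W \<inter> V) (\<lambda>x. \<Sum>i<r. c i x * frame_coord E d' x (e i x) a)"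
        by (intro smooth_on_sum smooth_on_mult s1 that smooth_on_subset[OF c]) (use W oV in auto)
      moreover have "(\<Sum>i<r. c i x * frame_coord E d' x (e i x) a) = frame_coord E d' x (e' b x) a"
        if "x \<in> W \<inter> V" for x
        unfolding True e'_def fun_upd_same
        by (rule frame_coord_sum[OF fd, symmetric]) (use that \<open>a < r\<close> frame_in_fibre[OF fW] in auto)
      ultimately show ?thesis using W oV by (auto elim: smooth_on_cong[rotated])
    qed (use s1 that in \<open>simp add: e'_def\<close>)
    then show "frames_compatible E (W, e') d" by (simp add: frames_compatible_def)
    have "smooth_on E (V \<inter> W) (\<lambda>x. frame_coord E e' x (d' b x) a)" if "a < r" "b < r" for a b
    proof (rule smooth_on_cong)
      have "smooth_on E (V \<inter> W) h" "smooth_on E (V \<inter> W) (c a)"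
        using smooth_on_subset[OF h(1)] smooth_on_subset[OF c[OF that(1)]] by auto
      then show "smooth_on E (V \<inter> W) (\<lambda>x. C x (d' b x) a)"
        unfolding C_def using W oV that k
        by (cases "a = k") (auto intro!: smooth_on_diff smooth_on_mult s2)
      show "C x (d' b x) a = frame_coord E e' x (d' b x) a" if "x \<in> V \<inter> W" for x
        using that C frame_in_fibre[OF fd] \<open>a < r\<close> \<open>b < r\<close> by simp
    qed (use W oV in auto)
    then show "frames_compatible E d (W, e')" by (simp add: frames_compatible_def)
  qed
  then show ?thesis by (simp add: e'_def)
qed

text \<open>Smooth Gram--Schmidt for an indefinite metric: the next vector is first corrected by a
  constant combination of the frame so that its component orthogonal to the previous vectors is
  not isotropic.\<close>

lemma partial_orthonormal_frame:
  assumes "k \<le> r"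
  shows "\<exists>W e s. (W, e) \<in> frames E \<and> x0 \<in> W \<and> (\<forall>a<k. s a * s a = (1 :: real)) \<and>
    (\<forall>x\<in>W. \<forall>a<k. \<forall>b<k. metric E x (e a x) (e b x) = (if a = b then s a else 0))"
  using assms
proof (induction k)
  case 0
  obtain U e where "(U, e) \<in> frames E" "x0 \<in> U" by (rule frame_exists)
  then show ?case by auto
next
  case (Suc k)
  then have "k \<le> r" by simp
  from Suc.IH[OF this] obtain U e s where f: "(U, e) \<in> frames E" and x0: "x0 \<in> U"
    and s': "\<forall>a<k. s a * s a = (1 :: real)"
    and on': "\<forall>x\<in>U. \<forall>a<k. \<forall>b<k. metric E x (e a x) (e b x) = (if a = b then s a else 0)"
    by blast
  note s = s'[rule_format] and on = on'[rule_format]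
  have k: "k < r" using Suc.prems by simp
  note fr = frame[OF f] and oU = frame_open[OF f]
  \<comment> \<open>Projection to the orthogonal complement of the first \<open>k\<close> vectors;
    division by the square length \<open>s a\<close> is multiplication by \<open>s a\<close>, since
    \<open>s a * s a = 1\<close>.\<close>
  define P where "P x v = v - (\<Sum>a<k. (s a * metric E x v (e a x)) *\<^sub>R e a x)" for x v
  have ef: "e a x \<in> fibre E x" if "x \<in> U" "a < r" for a x
    using frame_in_fibre[OF fr that(1)] that(2) .
  have Pf: "P x v \<in> fibre E x" if "x \<in> U" "v \<in> fibre E x" for x v
    unfolding P_def using that k by (intro fibre_diff fibre_sum fibre_scale ef) auto
  have P_orth: "metric E x (P x v) (e b x) = 0" if x: "x \<in> U" and v: "v \<in> fibre E x" and b: "b < k" for x v b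
  proof -
    have "metric E x (\<Sum>a<k. (s a * metric E x v (e a x)) *\<^sub>R e a x) (e b x) =
        (\<Sum>a<k. s a * metric E x v (e a x) * metric E x (e a x) (e b x))"
      by (rule metric_sum) (use x b k ef in auto)
    also have "\<dots> = (\<Sum>a<k. if a = b then s b * s b * metric E x v (e b x) else 0)"
      by (rule sum.cong) (use on[OF x] b in auto)
    also have "\<dots> = metric E x v (e b x)" using b s[OF b] by simp
    finally show ?thesis
      unfolding P_def using x v b k ef by (subst metric_diff) (auto intro!: fibre_sum fibre_scale ef)
  qed
  have PP: "metric E x (P x u) (P x v) = metric E x (P x u) v" if x: "x \<in> U" and "u \<in> fibre E x" "v \<in> fibre E x" for x u v
  proof -
    have S: "(\<Sum>a<k. (s a * metric E x v (e a x)) *\<^sub>R e a x) \<in> fibre E x"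
      using x k by (intro fibre_sum fibre_scale ef) auto
    have "metric E x (\<Sum>a<k. (s a * metric E x v (e a x)) *\<^sub>R e a x) (P x u) =
        (\<Sum>a<k. s a * metric E x v (e a x) * metric E x (e a x) (P x u))"
      by (rule metric_sum) (use x that k ef Pf in auto)
    also have "\<dots> = 0"
      using P_orth[OF x that(2)] metric_sym[OF ef[OF x] Pf[OF x that(2)]] k by (intro sum.neutral) auto
    finally have "metric E x (P x v) (P x u) = metric E x v (P x u)"
      using that S Pf[OF x] by (subst P_def, subst metric_diff) auto
    then show ?thesis
      using metric_sym[OF Pf[OF x that(2)] Pf[OF x that(3)]] metric_sym[OF that(3) Pf[OF x that(2)]]
      by simp
  qed
  define z where "z = P x0 (e k x0)"
  \<comment> \<open>Otherwise \<open>e k\<close> would be a combination of the earlier vectors,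
    although its own coordinate is 1.\<close>
  have z0: "z \<noteq> 0"
  proof
    assume "z = 0"
    then have "e k x0 = (\<Sum>a<k. (s a * metric E x0 (e k x0) (e a x0)) *\<^sub>R e a x0)"
      by (simp add: z_def P_def)
    also have "\<dots> = (\<Sum>a<r. (if a < k then s a * metric E x0 (e k x0) (e a x0) else 0) *\<^sub>R e a x0)"
      using k by (intro sum.mono_neutral_cong_left) auto
    finally have *: "e k x0 =
      (\<Sum>a<r. (if a < k then s a * metric E x0 (e k x0) (e a x0) else 0) *\<^sub>R e a x0)" .
    have "frame_coord E e x0 (e k x0) k = 0"
      by (subst *, subst frame_coord_combination[OF fr x0 k]) simp
    then show False using frame_coord_frame[OF fr x0 k k] by simp
  qed
  have zf: "z \<in> fibre E x0" unfolding z_def by (rule Pf[OF x0 ef[OF x0 k]])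
  obtain w where w: "w \<in> fibre E x0" "metric E x0 (P x0 w) (P x0 w) \<noteq> 0" "frame_coord E e x0 w k \<noteq> 0"
  proof (cases "metric E x0 z z = 0")
    case False
    then show ?thesis using that[of "e k x0"] ef[OF x0 k] frame_coord_frame[OF fr x0 k k] by (simp add: z_def)
  next
    case True
    obtain y where y: "y \<in> fibre E x0" "metric E x0 z y \<noteq> 0"
      using metric_nondegenerate[OF zf] z0 by blast
    define A B c where "A = metric E x0 z y" and "B = metric E x0 (P x0 y) (P x0 y)"
      and "c = frame_coord E e x0 y k"
    \<comment> \<open>The first two values are zeros of the square length
      \<open>t * (2 * A + t * B)\<close>, the third makes the coordinate \<open>1 + t * c\<close>
      along \<open>e k\<close> vanish. For \<open>B = 0\<close> or \<open>c = 0\<close> the quotient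
      is 0 by convention, which is excluded anyway.\<close>
    obtain t where t: "t \<notin> {0, - 2 * A / B, - 1 / c}"
      using ex_new_if_finite[OF infinite_UNIV_char_0, of "{0, - 2 * A / B, - 1 / c}"] by auto
    define w where "w = 1 *\<^sub>R e k x0 + t *\<^sub>R y"
    have wf: "w \<in> fibre E x0" unfolding w_def using y ef[OF x0 k] by auto
    have lin: "metric E x0 w v = metric E x0 (e k x0) v + t * metric E x0 y v" if "v \<in> fibre E x0" for v
      unfolding w_def using metric_linear[OF ef[OF x0 k] y(1) that, of 1 t] by simp
    have Pw: "P x0 w = 1 *\<^sub>R z + t *\<^sub>R P x0 y"
    proof -
      have "(\<Sum>a<k. (s a * metric E x0 w (e a x0)) *\<^sub>R e a x0) =
          (\<Sum>a<k. (s a * metric E x0 (e k x0) (e a x0)) *\<^sub>R e a x0) +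
          t *\<^sub>R (\<Sum>a<k. (s a * metric E x0 y (e a x0)) *\<^sub>R e a x0)"
        unfolding scaleR_sum_right sum.distrib[symmetric]
        by (rule sum.cong) (use k ef[OF x0] in \<open>auto simp: lin algebra_simps\<close>)
      then show ?thesis unfolding P_def z_def w_def by (simp add: algebra_simps)
    qed
    have Pyf: "P x0 y \<in> fibre E x0" by (rule Pf[OF x0 y(1)])
    have Pwf: "P x0 w \<in> fibre E x0" by (rule Pf[OF x0 wf])
    have zPy: "metric E x0 z (P x0 y) = A"
      unfolding A_def z_def by (rule PP[OF x0 ef[OF x0 k] y(1)])
    have "metric E x0 (P x0 w) (P x0 w) = metric E x0 z (P x0 w) + t * metric E x0 (P x0 y) (P x0 w)"
      by (subst (1) Pw) (use metric_linear[OF zf Pyf Pwf, of 1 t] in simp)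
    also have "metric E x0 z (P x0 w) = t * A"
      using metric_sym[OF zf Pwf] metric_linear[OF zf Pyf zf, of 1 t] metric_sym[OF Pyf zf] True zPy
      unfolding Pw by simp
    also have "metric E x0 (P x0 y) (P x0 w) = A + t * B"
      using metric_sym[OF Pyf Pwf] metric_linear[OF zf Pyf Pyf, of 1 t] zPy
      unfolding Pw B_def by simp
    finally have "metric E x0 (P x0 w) (P x0 w) = t * (2 * A + t * B)" by (simp add: algebra_simps)
    moreover have "2 * A + t * B \<noteq> 0"
      using t y(2) by (cases "B = 0") (auto simp: A_def field_simps)
    ultimately have 1: "metric E x0 (P x0 w) (P x0 w) \<noteq> 0" using t by simp
    have "frame_coord E e x0 w k = 1 + t * c"
      unfolding w_def c_def
      using frame_coord_linear[OF fr x0 ef[OF x0 k] y(1) k, of 1 t] frame_coord_frame[OF fr x0 k k] by simp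
    moreover have "1 + t * c \<noteq> 0" using t by (cases "c = 0") (auto simp: field_simps)
    ultimately show ?thesis using that[OF wf 1] by simp
  qed
  \<comment> \<open>The coordinates of \<open>w\<close> are frozen, which continues \<open>w\<close>
    to all of \<open>U\<close> as a smooth field.\<close>
  define \<gamma> where "\<gamma> a = frame_coord E e x0 w a" for a
  define w' where "w' x = (\<Sum>a<r. \<gamma> a *\<^sub>R e a x)" for x
  have w'0: "w' x0 = w" unfolding w'_def \<gamma>_def using frame_expansion[OF fr x0 w(1)] by simp
  have w'f: "w' x \<in> fibre E x" if "x \<in> U" for x unfolding w'_def using that ef by auto
  define d where "d a x = \<gamma> a - (if a < k then s a * metric E x (w' x) (e a x) else 0)" for a x
  have Pw': "P x (w' x) = (\<Sum>a<r. d a x *\<^sub>R e a x)" if "x \<in> U" for x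
  proof -
    have "(\<Sum>a<k. (s a * metric E x (w' x) (e a x)) *\<^sub>R e a x) =
        (\<Sum>a<r. (if a < k then s a * metric E x (w' x) (e a x) else 0) *\<^sub>R e a x)"
      using k by (intro sum.mono_neutral_cong_left) auto
    then show ?thesis
      unfolding P_def d_def w'_def[of x] by (simp add: scaleR_diff_left sum_subtractf)
  qed
  define Q where "Q x = metric E x (P x (w' x)) (P x (w' x))" for x
  have d_smooth: "smooth_on E U (d a)" if "a < r" for a
  proof (cases "a < k")
    case True
    have "smooth_on E U (\<lambda>x. metric E x (w' x) (e a x))"
    proof (rule smooth_on_cong[OF oU])
      show "smooth_on E U (\<lambda>x. \<Sum>b<r. \<gamma> b * metric E x (e b x) (e a x))"
        by (intro smooth_on_sum smooth_on_cmult oU metric_smooth[OF f]) (use that in auto)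
      show "(\<Sum>b<r. \<gamma> b * metric E x (e b x) (e a x)) = metric E x (w' x) (e a x)" if "x \<in> U" for x
        unfolding w'_def by (rule metric_sum[symmetric]) (use ef that \<open>a < r\<close> in auto)
    qed
    then show ?thesis
      using True unfolding d_def by (simp add: smooth_on_diff smooth_on_const smooth_on_cmult oU)
  next
    case False
    then have "d a = (\<lambda>_. \<gamma> a)" by (auto simp: d_def)
    then show ?thesis by (simp add: smooth_on_const oU)
  qed
  have Q_smooth: "smooth_on E U Q"
  proof (rule smooth_on_cong[OF oU])
    show "smooth_on E U (\<lambda>x. \<Sum>a<r. \<Sum>b<r. d a x * (d b x * metric E x (e a x) (e b x)))"
      by (intro smooth_on_sum smooth_on_mult oU metric_smooth[OF f] d_smooth) auto
    show "(\<Sum>a<r. \<Sum>b<r. d a x * (d b x * metric E x (e a x) (e b x))) = Q x" if x: "x \<in> U" for x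
    proof -
      have "Q x = (\<Sum>a<r. d a x * metric E x (e a x) (P x (w' x)))"
        unfolding Q_def by (subst (1) Pw'[OF x], rule metric_sum) (use x ef Pf w'f in auto)
      also have "\<dots> = (\<Sum>a<r. d a x * (\<Sum>b<r. d b x * metric E x (e a x) (e b x)))"
        unfolding Pw'[OF x] by (intro sum.cong refl arg_cong2[of _ _ _ _ "(*)"] metric_sum_right)
          (use x ef in auto)
      finally show ?thesis by (simp add: sum_distrib_left)
    qed
  qed
  \<comment> \<open>The sign of the new vector is decided at \<open>x0\<close>; where
    \<open>Q\<close> keeps this sign, \<open>\<sigma> * Q\<close> is positive and has smooth real
    powers.\<close>
  define \<sigma> where "\<sigma> = sgn (Q x0)"
  have Q0: "Q x0 \<noteq> 0" using w(2) by (simp add: Q_def w'0)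
  then have \<sigma>: "\<sigma> * \<sigma> = 1" by (simp add: \<sigma>_def sgn_if)
  define W where "W = {x \<in> U. \<sigma> * Q x > 0}"
  have W: "open W" "W \<subseteq> U" "x0 \<in> W"
  proof -
    have "continuous_on U (\<lambda>x. \<sigma> * Q x)"
      by (intro continuous_intros smooth_on_continuous[OF oU Q_smooth])
    from continuous_open_preimage[OF this oU open_greaterThan[of 0]] show "open W"
      by (simp add: W_def vimage_def Int_def)
    show "x0 \<in> W" using x0 Q0 by (simp add: W_def \<sigma>_def sgn_if)
  qed (auto simp: W_def)
  define q where "q p x = (\<sigma> * Q x) powr p" for p x
  have q_smooth: "smooth_on E W (q p)" for p
    unfolding q_def using W
    by (intro smooth_on_powr smooth_on_cmult smooth_on_subset[OF Q_smooth]) (auto simp: W_def)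
  \<comment> \<open>Normalization by the inverse square root of \<open>\<sigma> * Q\<close>, which
    is the absolute value of \<open>Q\<close> on the chosen \<open>W\<close>.\<close>
  define c where "c a x = q (- (1 / 2)) x * d a x" for a x
  define e' where "e' = e(k := \<lambda>x. \<Sum>a<r. c a x *\<^sub>R e a x)"
  have "(W, e') \<in> frames E"
    unfolding e'_def
  proof (rule frame_replace[OF f W(1,2) k])
    show "smooth_on E W (c a)" if "a < r" for a
      unfolding c_def using W that by (intro smooth_on_mult q_smooth smooth_on_subset[OF d_smooth])
    \<comment> \<open>The inverse of \<open>c k\<close>: the correction involves earlier vectors
      only, so the coefficient of \<open>e k\<close> before normalization is the constant
      \<open>\<gamma> k\<close>.\<close>
    show "smooth_on E W (\<lambda>x. (1 / \<gamma> k) * q (1 / 2) x)"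
      by (intro smooth_on_cmult q_smooth W)
    fix x assume x: "x \<in> W"
    then have "\<sigma> * Q x > 0" unfolding W_def by blast
    then have "\<sigma> * Q x \<noteq> 0" by (rule less_imp_neq[THEN not_sym])
    then have "q (1 / 2) x * q (- (1 / 2)) x = 1"
      unfolding q_def powr_add[symmetric] by simp
    moreover have "d k x = \<gamma> k" "\<gamma> k \<noteq> 0" using w(3) by (simp_all add: d_def \<gamma>_def)
    ultimately show "1 / \<gamma> k * q (1 / 2) x * c k x = 1"
      by (simp add: c_def field_simps)
  qed
  moreover have "metric E x (e' a x) (e' b x) = (if a = b then (s(k := \<sigma>)) a else 0)"
    if x: "x \<in> W" and ab: "a < Suc k" "b < Suc k" for x a b
  proof -
    have xU: "x \<in> U" using x W by auto
    have e'k: "e' k x = q (- (1 / 2)) x *\<^sub>R P x (w' x)"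
      by (simp add: e'_def c_def Pw'[OF xU] scaleR_sum_right)
    have Pff: "P x (w' x) \<in> fibre E x" by (rule Pf[OF xU w'f[OF xU]])
    have kf: "e' k x \<in> fibre E x" unfolding e'k using Pff by auto
    have lt: "e' a x = e a x" if "a < k" for a using that by (simp add: e'_def)
    have orth: "metric E x (e' k x) (e b x) = 0" if "b < k" for b
      unfolding e'k using P_orth[OF xU w'f[OF xU] that] ef[OF xU, of b] that k Pff
      by (simp add: metric_scale)
    have "metric E x (e' k x) (e' k x) = q (- (1 / 2)) x * metric E x (P x (w' x)) (e' k x)"
      using kf Pff by (subst (1) e'k) (rule metric_scale)
    also have "metric E x (P x (w' x)) (e' k x) = q (- (1 / 2)) x * Q x"
      using metric_sym[OF Pff kf] metric_scale[OF Pff Pff] unfolding e'k Q_def by simp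
    also have "q (- (1 / 2)) x * (q (- (1 / 2)) x * Q x) = (\<sigma> * Q x) powr (- 1) * Q x"
      unfolding mult.assoc[symmetric] unfolding q_def powr_add[symmetric] by simp
    also have "\<dots> = \<sigma>"
    proof -
      have pos: "\<sigma> * Q x > 0" using x unfolding W_def by blast
      then have nz: "\<sigma> \<noteq> 0" "Q x \<noteq> 0" by auto
      have "(\<sigma> * Q x) powr (- 1) * Q x = 1 / \<sigma>"
        using pos nz by (simp add: powr_minus powr_one field_simps)
      also have "\<dots> = \<sigma>" using \<sigma> nz by (simp add: field_simps)
      finally show ?thesis .
    qed
    finally have kk: "metric E x (e' k x) (e' k x) = \<sigma>" .
    show ?thesis
    proof (cases "a = k"; cases "b = k")
      assume "a \<noteq> k" "b = k"
      then show ?thesis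
        using orth[of a] ab lt[of a] metric_sym[OF kf ef[OF xU, of a]] k by simp
    qed (use kk orth ab lt on[OF xU] in auto)
  qed
  moreover have "(s(k := \<sigma>)) a * (s(k := \<sigma>)) a = 1" if "a < Suc k" for a
    using that s \<sigma> by (cases "a = k") auto
  ultimately show ?case using W(3) by (intro exI[of _ W] exI[of _ e'] exI[of _ "s(k := \<sigma>)"]) auto
qed

lemma coord_system_exists:
  obtains U \<phi> e where "(U, \<phi>, e) \<in> coord_systems E" "x0 \<in> U"
proof -
  from partial_orthonormal_frame[of r x0] obtain W e s where f: "(W, e) \<in> frames E" "x0 \<in> W"
    "\<forall>x\<in>W. \<forall>a<r. \<forall>b<r. metric E x (e a x) (e b x) = (if a = b then s a else 0)"
    by blast
  obtain U \<phi> where c: "(U, \<phi>) \<in> charts E" "x0 \<in> U" by (rule chart_exists)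
  have "open (U \<inter> W)" using chart_open[OF c(1)] frame_open[OF f(1)] by auto
  then have "(U \<inter> W, \<phi>, e) \<in> coord_systems E"
    using chart_restrict[OF c(1)] frame_restrict[OF f(1)] f(3) by (simp add: coord_systems_def)
  then show ?thesis using that c f by blast
qed

text \<open>In an orthonormal frame the representing vector is explicit. It supplies the dual frame
  behind the inverse Gram matrix, and the vector behind a superpolynomial of degree 1.\<close>

lemma metric_representable:
  assumes L: "\<And>u v p q. u \<in> fibre E x \<Longrightarrow> v \<in> fibre E x \<Longrightarrow> L (p *\<^sub>R u + q *\<^sub>R v) = p * L u + q * (L v :: real)"
  shows "\<exists>u\<in>fibre E x. \<forall>v\<in>fibre E x. metric E x u v = L v"
proof -
  from partial_orthonormal_frame[of r x] obtain W e s where f: "(W, e) \<in> frames E" and x: "x \<in> W"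
    and on': "\<forall>x\<in>W. \<forall>a<r. \<forall>b<r. metric E x (e a x) (e b x) = (if a = b then s a else 0)"
    and s': "\<forall>a<r. s a * s a = (1 :: real)"
    by blast
  note s = s'[rule_format] and on = on'[rule_format]
  note ef = frame_in_fibre[OF frame[OF f] x]
  define u where "u = (\<Sum>a<r. (s a * L (e a x)) *\<^sub>R e a x)"
  have u: "u \<in> fibre E x" unfolding u_def using ef by auto
  have ue: "metric E x u (e b x) = L (e b x)" if b: "b < r" for b
  proof -
    have "metric E x u (e b x) = (\<Sum>a<r. s a * L (e a x) * metric E x (e a x) (e b x))"
      unfolding u_def by (rule metric_sum) (use ef b in auto)
    also have "\<dots> = (\<Sum>a<r. if a = b then s b * s b * L (e b x) else 0)"
      by (rule sum.cong) (use on[OF x] b in auto)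
    finally show ?thesis using b s[OF b] by simp
  qed
  have Lsum: "L (\<Sum>a\<in>A. c a *\<^sub>R e a x) = (\<Sum>a\<in>A. c a * L (e a x))" if "A \<subseteq> {..<r}" for A c
  proof -
    have "finite A" using that finite_subset by auto
    then show ?thesis using that
    proof induction
      case empty
      then show ?case using L[of 0 0 0 0] by simp
    next
      case (insert a A)
      then show ?case using L[of "e a x" "\<Sum>a\<in>A. c a *\<^sub>R e a x" "c a" 1] ef
        by (auto simp: fibre_sum fibre_scale subset_iff)
    qed
  qed
  have "metric E x u v = L v" if v: "v \<in> fibre E x" for v
  proof -
    have "metric E x u v = (\<Sum>a<r. frame_coord E e x v a * L (e a x))"
      by (subst frame_expansion[OF frame[OF f] x v], subst metric_sum_right[OF u])
        (use ef ue in auto)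
    also have "\<dots> = L v"
      using Lsum[of "{..<r}" "frame_coord E e x v"] frame_expansion[OF frame[OF f] x v] by simp
    finally show ?thesis .
  qed
  then show ?thesis using u by blast
qed

end

section \<open>Local brackets\<close>

context smooth_manifold
begin

lemma chart_deriv_cmult:
  assumes "(U, \<phi>) \<in> charts M" "smooth_on M U f" "x \<in> U" "i < dimension M"
  shows "chart_deriv (U, \<phi>) i (\<lambda>y. f y * c) x = chart_deriv (U, \<phi>) i f x * c"
  using chart_deriv_mult[OF assms(1,2) smooth_on_const[OF chart_open[OF assms(1)]] assms(3,3,4), of c]
  by simp

text \<open>Finite sums of smooth functions times fixed elements, with the values outside
  \<open>W\<close> left free by \<open>eq_on\<close>. Coefficientwise smoothness alone would not
  keep the family of differentiated coefficients finite, and \<open>Superpoly\<close> in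
  \<open>d_base\<close> is meaningful only for finite support.\<close>

inductive smooth_super :: "'m set \<Rightarrow> ('m \<Rightarrow> superpoly) \<Rightarrow> bool" for W where
  base: "smooth_on M W f \<Longrightarrow> smooth_super W (\<lambda>x. f x *\<^sub>R m)"
| add: "smooth_super W a \<Longrightarrow> smooth_super W b \<Longrightarrow> smooth_super W (\<lambda>x. a x + b x)"
| eq_on: "smooth_super W a \<Longrightarrow> (\<And>x. x \<in> W \<Longrightarrow> a x = b x) \<Longrightarrow> smooth_super W b"

context
  fixes W :: "'m set" assumes W: "open W"
begin

lemma smooth_super_const: "smooth_super W (\<lambda>_. m)"
  using smooth_super.base[OF smooth_on_const[OF W], of 1 m] by simp

lemma smooth_super_sum:
  "(\<And>i. i \<in> S \<Longrightarrow> smooth_super W (a i)) \<Longrightarrow> smooth_super W (\<lambda>x. \<Sum>i\<in>S. a i x)"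
  by (induction S rule: infinite_finite_induct) (auto intro: smooth_super_const smooth_super.add)

lemma smooth_super_scale:
  assumes "smooth_on M W f" "smooth_super W a"
  shows "smooth_super W (\<lambda>x. f x *\<^sub>R a x)"
  using assms(2)
proof induction
  case (base g m)
  show ?case
    using smooth_super.base[OF smooth_on_mult[OF W assms(1) base]] by simp
next
  case (add a b)
  then show ?case using smooth_super.add by (simp add: scaleR_add_right)
next
  case (eq_on a b)
  then show ?case by (auto intro: smooth_super.eq_on)
qed

lemma smooth_super_linear:
  assumes "linear L" "smooth_super W a"
  shows "smooth_super W (\<lambda>x. L (a x))"
  using assms(2)
proof induction
  case (base g m)
  then show ?case using smooth_super.base[OF base] by (simp add: linear_scale[OF assms(1)])
next
  case (add a b)
  then show ?case using smooth_super.add by (simp add: linear_add[OF assms(1)])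
next
  case (eq_on a b)
  then show ?case by (auto intro: smooth_super.eq_on)
qed

lemma smooth_super_mult:
  assumes "smooth_super W a" "smooth_super W b"
  shows "smooth_super W (\<lambda>x. a x * b x)"
  using assms(1)
proof induction
  case (base g m)
  then show ?case
    using smooth_super_scale[OF base smooth_super_linear[OF linear_times_right assms(2)]] by simp
next
  case (add a b)
  then show ?case using smooth_super.add by (simp add: distrib_right)
next
  case (eq_on a b)
  then show ?case by (auto intro: smooth_super.eq_on)
qed

lemma smooth_super_coeff:
  assumes "smooth_super W a"
  shows "smooth_on M W (\<lambda>x. coeff (a x) k)"
  using assms
proof induction
  case (base f m)
  then show ?case using smooth_on_mult[OF W base smooth_on_const[OF W]] by simp
next
  case (add a b)
  then show ?case using smooth_on_add[OF W] by simp
next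
  case (eq_on a b)
  then show ?case by (auto intro: smooth_on_cong[OF W])
qed

end

text \<open>The induction bounds the support of the differentiated coefficients, after which
  \<open>Superpoly\<close> can be inverted.\<close>

lemma coeff_d_base:
  assumes c: "(U, \<phi>) \<in> charts M" and x: "x \<in> U" and i: "i < dimension M" and "smooth_super U a"
  shows "coeff (d_base (U, \<phi>) i a x) k = chart_deriv (U, \<phi>) i (\<lambda>y. coeff (a y) k) x"
proof -
  let ?D = "\<lambda>a k. chart_deriv (U, \<phi>) i (\<lambda>y. coeff (a y) k) x"
  have "finite {k. ?D a k \<noteq> 0}"
    using assms(4)
  proof induction
    case (base f m)
    have "?D (\<lambda>x. f x *\<^sub>R m) k = chart_deriv (U, \<phi>) i f x * coeff m k" for k
      using chart_deriv_cmult[OF c base x i] by simp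
    then show ?case by (auto intro: finite_subset[OF _ finite_coeff[of m]])
  next
    case (add a b)
    have "?D (\<lambda>x. a x + b x) k = ?D a k + ?D b k" for k
      using chart_deriv_add[OF c smooth_super_coeff smooth_super_coeff x x i] add(1,2) chart_open[OF c]
      by simp
    then have "{k. ?D (\<lambda>x. a x + b x) k \<noteq> 0} \<subseteq> {k. ?D a k \<noteq> 0} \<union> {k. ?D b k \<noteq> 0}" by auto
    then show ?case using add finite_subset by blast
  next
    case (eq_on a b)
    have "?D b k = ?D a k" for k
      by (rule chart_deriv_cong[OF c chart_open[OF c] x x i]) (use eq_on in auto)
    then show ?case using eq_on by simp
  qed
  then show ?thesis by (simp add: d_base_def Superpoly_inverse)
qed

lemma d_base_cong:
  assumes c: "(U, \<phi>) \<in> charts M" and x: "x \<in> U" and i: "i < dimension M"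
    and "\<And>y. y \<in> U \<Longrightarrow> a y = b y"
  shows "d_base (U, \<phi>) i a x = d_base (U, \<phi>) i b x"
  unfolding d_base_def
  by (intro arg_cong[of _ _ Superpoly] ext chart_deriv_cong[OF c chart_open[OF c] x x i])
    (use assms(4) in auto)

lemma d_base_base:
  assumes c: "(U, \<phi>) \<in> charts M" and x: "x \<in> U" and i: "i < dimension M" and f: "smooth_on M U f"
  shows "d_base (U, \<phi>) i (\<lambda>y. f y *\<^sub>R m) x = chart_deriv (U, \<phi>) i f x *\<^sub>R m"
  by (rule superpoly_eqI)
    (use coeff_d_base[OF c x i smooth_super.base[OF f]] chart_deriv_cmult[OF c f x i] in simp)

lemma d_base_add:
  assumes c: "(U, \<phi>) \<in> charts M" and x: "x \<in> U" and i: "i < dimension M"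
    and a: "smooth_super U a" and b: "smooth_super U b"
  shows "d_base (U, \<phi>) i (\<lambda>y. a y + b y) x = d_base (U, \<phi>) i a x + d_base (U, \<phi>) i b x"
  by (rule superpoly_eqI)
    (use coeff_d_base[OF c x i] smooth_super.add[OF a b] a b chart_open[OF c]
      chart_deriv_add[OF c smooth_super_coeff smooth_super_coeff x x i] in simp)

lemma d_base_sum:
  assumes c: "(U, \<phi>) \<in> charts M" and x: "x \<in> U" and i: "i < dimension M"
    and f: "\<And>j. j \<in> J \<Longrightarrow> smooth_on M U (f j)"
  shows "d_base (U, \<phi>) i (\<lambda>y. \<Sum>j\<in>J. f j y *\<^sub>R m j) x = (\<Sum>j\<in>J. chart_deriv (U, \<phi>) i (f j) x *\<^sub>R m j)"
  using f
proof (induction J rule: infinite_finite_induct)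
  case (insert j J)
  have "smooth_super U (\<lambda>y. \<Sum>j\<in>J. f j y *\<^sub>R m j)"
    using insert.prems by (intro smooth_super_sum smooth_super.base chart_open[OF c]) auto
  then show ?case
    using insert d_base_add[OF c x i smooth_super.base[of _ "f j" "m j"]] d_base_base[OF c x i]
    by simp
qed (simp_all add: d_base_def zero_superpoly_def)

end

text \<open>Bounded degree in finitely many variables: this turns a graded function into a finite
  sum, as \<open>smooth_super\<close> requires.\<close>

lemma finite_homogeneous_keys:
  "finite {(I :: nat fset, \<mu> :: nat multiset). fset I \<subseteq> {..<r} \<and> set_mset \<mu> \<subseteq> {..<n} \<and> fcard I + 2 * size \<mu> = (k :: nat)}"
  (is "finite ?K")
proof -
  have "finite {I :: nat fset. fset I \<subseteq> {..<r}}"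
    using finite_vimageI[of "Pow {..<r}" fset] by (simp add: vimage_def inj_def fset_inject Pow_def)
  moreover have "finite {\<mu> :: nat multiset. set_mset \<mu> \<subseteq> {..<n} \<and> size \<mu> \<le> k}"
  proof -
    have "{\<mu> :: nat multiset. set_mset \<mu> \<subseteq> {..<n} \<and> size \<mu> \<le> k} \<subseteq>
        mset ` {xs. set xs \<subseteq> {..<n} \<and> length xs \<le> k}"
    proof
      fix \<mu> :: "nat multiset"
      assume \<mu>: "\<mu> \<in> {\<mu>. set_mset \<mu> \<subseteq> {..<n} \<and> size \<mu> \<le> k}"
      obtain xs where "\<mu> = mset xs" by (metis ex_mset)
      then show "\<mu> \<in> mset ` {xs. set xs \<subseteq> {..<n} \<and> length xs \<le> k}" using \<mu> by auto
    qed
    then show ?thesis using finite_lists_length_le[of "{..<n}" k] finite_subset by blast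
  qed
  ultimately have "finite ({I. fset I \<subseteq> {..<r}} \<times> {\<mu>. set_mset \<mu> \<subseteq> {..<n} \<and> size \<mu> \<le> k})"
    by (rule finite_cartesian_product)
  then show ?thesis by (rule finite_subset[rotated]) auto
qed

lemma homogeneous_mono: "n \<le> n' \<Longrightarrow> homogeneous r n k \<subseteq> homogeneous r n' k"
proof
  fix x assume "n \<le> n'" "x \<in> homogeneous r n k"
  then show "x \<in> homogeneous r n' k"
    unfolding homogeneous_def mem_Collect_eq by (metis lessThan_subset_iff order_trans)
qed

lemma homogeneous_pureI:
  assumes "x \<in> homogeneous r n k" "\<And>i. i < n \<Longrightarrow> d_mom i x = 0"
  shows "x \<in> homogeneous r 0 k"
proof -
  have "\<mu> = {#}" if "coeff x (I, \<mu>) \<noteq> 0" for I \<mu>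
  proof (rule ccontr)
    assume "\<mu> \<noteq> {#}"
    then obtain i \<nu> where "\<mu> = add_mset i \<nu>" by (metis multiset_cases)
    moreover have "set_mset \<mu> \<subseteq> {..<n}" using assms(1) that by (simp add: homogeneous_def)
    ultimately show False using coeff_d_mom[of i x I \<nu>] assms(2)[of i] that by simp
  qed
  then show ?thesis using assms(1) by (simp add: homogeneous_def)
qed

lemma homogeneous_pure_d_mom: "x \<in> homogeneous r 0 k \<Longrightarrow> d_mom i x = 0"
  using d_mom_zero_iff[of x] by (auto simp: homogeneous_def)

lemma homogeneous_pure_subset: "x \<in> homogeneous r 0 k \<Longrightarrow> x \<in> homogeneous r n k"
  using homogeneous_mono[of 0 n] by auto

section \<open>Sections and the inverse Gram matrix\<close>

context metric_vector_bundle
begin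

lemma coord_chart: "(U, \<phi>, e) \<in> coord_systems E \<Longrightarrow> (U, \<phi>) \<in> charts E"
  and coord_frame: "(U, \<phi>, e) \<in> coord_systems E \<Longrightarrow> (U, e) \<in> frames E"
  by (auto simp: coord_systems_def)

lemma coord_open: "(U, \<phi>, e) \<in> coord_systems E \<Longrightarrow> open U"
  using coord_chart chart_open by blast

lemma gram_const:
  "(U, \<phi>, e) \<in> coord_systems E \<Longrightarrow> x \<in> U \<Longrightarrow> y \<in> U \<Longrightarrow> a < r \<Longrightarrow> b < r \<Longrightarrow>
    metric E x (e a x) (e b x) = metric E y (e a y) (e b y)"
  unfolding coord_systems_def by blast

lemma coord_fibre:
  "(U, \<phi>, e) \<in> coord_systems E \<Longrightarrow> x \<in> U \<Longrightarrow> a < r \<Longrightarrow> e a x \<in> fibre E x"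
  using frame_in_fibre[OF frame[OF coord_frame]] by blast

lemma section_fibre: "u \<in> sections E \<Longrightarrow> u x \<in> fibre E x"
  by (simp add: sections_def)

lemma section_coord_smooth:
  assumes "u \<in> sections E" "(U, e) \<in> frames E" "a < r"
  shows "smooth_on E U (\<lambda>x. frame_coord E e x (u x) a)"
proof -
  have "\<forall>(U, e)\<in>frames E. \<forall>a<rank E. smooth_on E U (\<lambda>x. frame_coord E e x (u x) a)"
    using assms(1) unfolding sections_def by blast
  from bspec[OF this assms(2)] show ?thesis using assms(3) by simp
qed

lemma sectionsI:
  assumes "\<And>x. u x \<in> fibre E x"
    "\<And>U e a. (U, e) \<in> frames E \<Longrightarrow> a < r \<Longrightarrow> smooth_on E U (\<lambda>x. frame_coord E e x (u x) a)"
  shows "u \<in> sections E"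
  using assms unfolding sections_def by blast

lemma section_combination:
  assumes "u \<in> sections E" "v \<in> sections E" "smooth_on E UNIV f" "smooth_on E UNIV h"
  shows "(\<lambda>x. f x *\<^sub>R u x + h x *\<^sub>R v x) \<in> sections E"
proof (rule sectionsI)
  show "f x *\<^sub>R u x + h x *\<^sub>R v x \<in> fibre E x" for x
    using section_fibre assms by auto
  fix U e a assume f: "(U, e) \<in> frames E" and a: "a < r"
  note oU = frame_open[OF f]
  show "smooth_on E U (\<lambda>x. frame_coord E e x (f x *\<^sub>R u x + h x *\<^sub>R v x) a)"
  proof (rule smooth_on_cong[OF oU])
    show "smooth_on E U (\<lambda>x. f x * frame_coord E e x (u x) a + h x * frame_coord E e x (v x) a)"
      by (intro smooth_on_add smooth_on_mult oU section_coord_smooth[OF _ f a] assms(1,2)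
          smooth_on_subset[OF assms(3)] smooth_on_subset[OF assms(4)]) auto
  qed (use frame_coord_linear[OF frame[OF f] _ section_fibre section_fibre a] assms in simp)
qed

lemma metric_section_smooth:
  assumes u: "u \<in> sections E" and f: "(U, e) \<in> frames E" and b: "b < r"
  shows "smooth_on E U (\<lambda>x. metric E x (u x) (e b x))"
proof (rule smooth_on_cong[OF frame_open[OF f]])
  show "smooth_on E U (\<lambda>x. \<Sum>a<r. frame_coord E e x (u x) a * metric E x (e a x) (e b x))"
    by (intro smooth_on_sum smooth_on_mult frame_open[OF f] section_coord_smooth[OF u f] metric_smooth[OF f] b)
      auto
  show "(\<Sum>a<r. frame_coord E e x (u x) a * metric E x (e a x) (e b x)) = metric E x (u x) (e b x)"
    if x: "x \<in> U" for x
    by (subst (2) frame_expansion[OF frame[OF f] x section_fibre[OF u]], rule metric_sum[symmetric])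
      (use frame_in_fibre[OF frame[OF f] x] b in auto)
qed

lemma metric_sections_smooth:
  assumes u: "u \<in> sections E" and v: "v \<in> sections E"
  shows "smooth_on E UNIV (\<lambda>x. metric E x (u x) (v x))"
proof (rule smooth_on_local)
  fix x0 :: 'm
  obtain U e where f: "(U, e) \<in> frames E" "x0 \<in> U" by (rule frame_exists)
  note oU = frame_open[OF f(1)]
  have "smooth_on E U (\<lambda>x. metric E x (u x) (v x))"
  proof (rule smooth_on_cong[OF oU])
    show "smooth_on E U (\<lambda>x. \<Sum>b<r. frame_coord E e x (v x) b * metric E x (u x) (e b x))"
      by (intro smooth_on_sum smooth_on_mult oU section_coord_smooth[OF v f(1)]
          metric_section_smooth[OF u f(1)]) auto
    show "(\<Sum>b<r. frame_coord E e x (v x) b * metric E x (u x) (e b x)) = metric E x (u x) (v x)"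
      if x: "x \<in> U" for x
      by (subst (2) frame_expansion[OF frame[OF f(1)] x section_fibre[OF v]],
          rule metric_sum_right[symmetric])
        (use frame_in_fibre[OF frame[OF f(1)] x] section_fibre[OF u] in auto)
  qed
  then show "\<exists>W. open W \<and> x0 \<in> W \<and> smooth_on E (UNIV \<inter> W) (\<lambda>x. metric E x (u x) (v x))"
    using oU f(2) by auto
qed simp

text \<open>The bump function is chosen before the coefficients \<open>g\<close>. Constant
  \<open>g\<close> will give sections through a given vector, coordinate functions will give
  sections with a prescribed derivative at a zero.\<close>

lemma section_with_jet:
  assumes f: "(U, e) \<in> frames E" and x0: "x0 \<in> U"
  shows "\<exists>f. smooth_on E UNIV f \<and> f x0 \<noteq> 0 \<and> (\<forall>g. (\<forall>a<r. smooth_on E U (g a)) \<longrightarrow>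
       (\<lambda>y. if y \<in> U then f y *\<^sub>R (\<Sum>a<r. g a y *\<^sub>R e a y) else 0) \<in> sections E)"
proof -
  note oU = frame_open[OF f]
  obtain f K where K: "smooth_on E UNIV f" "f x0 \<noteq> 0" "closed K" "K \<subseteq> U" "\<And>x. x \<notin> K \<Longrightarrow> f x = 0"
    using bump_exists[OF oU x0] by metis
  have "(\<lambda>y. if y \<in> U then f y *\<^sub>R (\<Sum>a<r. g a y *\<^sub>R e a y) else 0) \<in> sections E" (is "?u \<in> _")
    if "\<forall>a<r. smooth_on E U (g a)" for g
  proof (rule sectionsI)
    note g = that[rule_format]
    show "?u x \<in> fibre E x" for x
      using frame_in_fibre[OF frame[OF f]] by (auto intro!: fibre_scale fibre_sum)
    fix V d a assume d: "(V, d) \<in> frames E" and a: "a < r"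
    show "smooth_on E V (\<lambda>x. frame_coord E d x (?u x) a)"
    proof (rule smooth_on_extend[OF K(1,3,4,5) frame_open[OF d] oU])
      show "smooth_on E (V \<inter> U) (\<lambda>x. \<Sum>b<r. g b x * frame_coord E d x (e b x) a)"
        by (intro smooth_on_sum smooth_on_mult smooth_on_subset[OF g]
            smooth_on_subset[OF frame_coord_smooth[OF f d a]]) (use oU frame_open[OF d] in auto)
      show "frame_coord E d x (?u x) a = f x * (\<Sum>b<r. g b x * frame_coord E d x (e b x) a)"
        if x: "x \<in> V \<inter> U" for x
      proof -
        have S: "(\<Sum>a<r. g a x *\<^sub>R e a x) \<in> fibre E x"
          using frame_in_fibre[OF frame[OF f]] x by auto
        have "frame_coord E d x (f x *\<^sub>R (\<Sum>a<r. g a x *\<^sub>R e a x)) a =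
            f x * frame_coord E d x (\<Sum>a<r. g a x *\<^sub>R e a x) a"
          using frame_coord_linear[OF frame[OF d] _ S S a, of "f x" 0] x by simp
        moreover have "frame_coord E d x (\<Sum>a<r. g a x *\<^sub>R e a x) a = (\<Sum>b<r. g b x * frame_coord E d x (e b x) a)"
          by (rule frame_coord_sum[OF frame[OF d] _ a]) (use frame_in_fibre[OF frame[OF f]] x in auto)
        ultimately show ?thesis using x by simp
      qed
      show "frame_coord E d x (?u x) a = 0" if "x \<in> V - U" for x
        using frame_coord_linear[OF frame[OF d] _ fibre_0 fibre_0 a, of x 0 0] that by simp
    qed
  qed
  then show ?thesis using K(1,2) by blast
qed

lemma section_through:
  assumes v: "v \<in> fibre E x"
  obtains u where "u \<in> sections E" "u x = v"
proof -
  obtain U e where fr: "(U, e) \<in> frames E" and x: "x \<in> U" by (rule frame_exists)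
  note oU = frame_open[OF fr]
  from section_with_jet[OF fr x] obtain f where f: "f x \<noteq> 0"
    "\<forall>g. (\<forall>a<r. smooth_on E U (g a)) \<longrightarrow>
       (\<lambda>y. if y \<in> U then f y *\<^sub>R (\<Sum>a<r. g a y *\<^sub>R e a y) else 0) \<in> sections E"
    by blast
  from spec[OF f(2), of "\<lambda>a _. frame_coord E e x v a / f x"]
  have "(\<lambda>y. if y \<in> U then f y *\<^sub>R (\<Sum>a<r. (frame_coord E e x v a / f x) *\<^sub>R e a y) else 0) \<in> sections E"
    using smooth_on_const[OF oU] by blast
  moreover have "f x *\<^sub>R (\<Sum>a<r. (frame_coord E e x v a / f x) *\<^sub>R e a x) = v"
    using f(1) frame_expansion[OF frame[OF fr] x v, symmetric] by (simp add: scaleR_sum_right)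
  ultimately show ?thesis using that x by fastforce
qed

text \<open>The vectors dual to the frame with respect to the metric have the inverse Gram matrix as
  their coordinates; their existence justifies the choice in the definition of
  \<open>gram_inv\<close>.\<close>

lemma gram_inv:
  assumes c: "(U, \<phi>, e) \<in> coord_systems E" and x: "x \<in> U" and ac: "a < r" "c < r"
  shows "(\<Sum>b<r. metric E x (e a x) (e b x) * gram_inv E e x b c) = (if a = c then 1 else 0)"
proof -
  note fr = frame[OF coord_frame[OF c]] and ef = coord_fibre[OF c x]
  have "\<exists>u\<in>fibre E x. \<forall>v\<in>fibre E x. metric E x u v = frame_coord E e x v c" if "c < r" for c
    by (rule metric_representable) (rule frame_coord_linear[OF fr x _ _ that])
  then have "\<forall>c\<in>{..<r}. \<exists>u. u \<in> fibre E x \<and> (\<forall>v\<in>fibre E x. metric E x u v = frame_coord E e x v c)"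
    by blast
  from bchoice[OF this] obtain u where
    u': "\<forall>c\<in>{..<r}. u c \<in> fibre E x \<and> (\<forall>v\<in>fibre E x. metric E x (u c) v = frame_coord E e x v c)"
    by blast
  have u: "u c \<in> fibre E x" "v \<in> fibre E x \<Longrightarrow> metric E x (u c) v = frame_coord E e x v c"
    if "c < r" for c v using u' that by auto
  have "(\<Sum>b<r. gram E e x a b * frame_coord E e x (u c) b) = (if a = c then 1 else 0)"
    if ac: "a < r" "c < r" for a c
  proof -
    have "(\<Sum>b<r. gram E e x a b * frame_coord E e x (u c) b) = metric E x (e a x) (u c)"
      by (subst (2) frame_expansion[OF fr x u(1)[OF ac(2)]], subst metric_sum_right)
        (use ef ac in \<open>auto simp: gram_def mult.commute\<close>)
    then show ?thesis
      using metric_sym[OF ef[OF ac(1)] u(1)[OF ac(2)]] u(2)[OF ac(2) ef[OF ac(1)]]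
        frame_coord_frame[OF fr x ac(2,1)] by auto
  qed
  then have "\<exists>h. \<forall>a<r. \<forall>c<r. (\<Sum>b<r. gram E e x a b * h b c) = (if a = c then 1 else 0)"
    by (intro exI[of _ "\<lambda>b c. frame_coord E e x (u c) b"] allI impI)
  from someI_ex[OF this] show ?thesis using ac by (simp add: gram_inv_def gram_def)
qed

context
  fixes U \<phi> e x
  assumes c: "(U, \<phi>, e) \<in> coord_systems E" and x: "x \<in> U"
begin

text \<open>\<open>gram_inv\<close> is itself a Gram matrix, namely that of the dual frame
  \<open>u\<close>.\<close>

lemma gram_inv_sym:
  assumes ab: "a < r" "b < r"
  shows "gram_inv E e x a b = gram_inv E e x b a"
proof -
  note ef = coord_fibre[OF c x]
  define u where "u c = (\<Sum>b<r. gram_inv E e x b c *\<^sub>R e b x)" for c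
  have uf: "u c \<in> fibre E x" for c unfolding u_def using ef by auto
  have eu: "metric E x (e a x) (u c) = (if a = c then 1 else 0)" if "a < r" "c < r" for a c
  proof -
    have "metric E x (e a x) (u c) = (\<Sum>b<r. gram_inv E e x b c * metric E x (e a x) (e b x))"
      unfolding u_def by (rule metric_sum_right) (use ef that in auto)
    then show ?thesis using gram_inv[OF c x that] by (simp add: mult.commute)
  qed
  have "metric E x (u a) (u b) = gram_inv E e x b a" if "a < r" "b < r" for a b
    unfolding u_def[of a] by (subst metric_sum)
      (use uf ef eu that in \<open>auto simp: if_distrib[of "(*) _"] cong: if_cong\<close>)
  then show ?thesis using ab metric_sym[OF uf uf] by metis
qed

lemma gram_inv_coord:
  assumes v: "v \<in> fibre E x" and b: "b < r"
  shows "(\<Sum>a<r. gram_inv E e x a b * metric E x v (e a x)) = frame_coord E e x v b"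
proof -
  note ef = coord_fibre[OF c x] and fr = frame[OF coord_frame[OF c]]
  have "(\<Sum>a<r. gram_inv E e x a b * metric E x v (e a x)) =
      (\<Sum>a<r. gram_inv E e x a b * (\<Sum>d<r. frame_coord E e x v d * metric E x (e d x) (e a x)))"
    by (intro sum.cong refl arg_cong2[of _ _ _ _ "(*)"], subst (1) frame_expansion[OF fr x v])
      (use ef in \<open>auto intro!: metric_sum\<close>)
  also have "\<dots> = (\<Sum>d<r. frame_coord E e x v d * (\<Sum>a<r. metric E x (e d x) (e a x) * gram_inv E e x a b))"
    unfolding sum_distrib_left by (subst sum.swap) (simp add: mult_ac)
  also have "\<dots> = (\<Sum>d<r. if d = b then frame_coord E e x v b else 0)"
    by (rule sum.cong) (use gram_inv[OF c x _ b] in auto)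
  finally show ?thesis using b by simp
qed

end

text \<open>The predicate under the choice operator is the same at both points, so the chosen
  functions agree, even outside the index range.\<close>

lemma gram_inv_const:
  assumes c: "(U, \<phi>, e) \<in> coord_systems E" and "x \<in> U" "y \<in> U"
  shows "gram_inv E e x = gram_inv E e y"
  unfolding gram_inv_def gram_def
  by (intro arg_cong[of _ _ Eps] ext all_cong1 imp_cong refl)
    (use gram_const[OF c assms(2,3)] in \<open>auto intro!: sum.cong arg_cong2[of _ _ _ _ "(=)"]\<close>)

section \<open>Elements of degree 1 and contraction with a section\<close>

definition flat :: "(nat \<Rightarrow> 'm \<Rightarrow> 'v) \<Rightarrow> 'm \<Rightarrow> 'v \<Rightarrow> superpoly" where
  "flat e x v = (\<Sum>b<r. metric E x v (e b x) *\<^sub>R tau b)"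

lemma odd_element_flat [simp]: "odd_element (flat e x v)"
  unfolding flat_def by auto

lemma flat_homogeneous: "flat e x v \<in> homogeneous r 0 (Suc 0)"
  unfolding flat_def by auto

lemma of_section_eq:
  assumes c: "(U, \<phi>, e) \<in> coord_systems E" and x: "x \<in> U" and u: "u x \<in> fibre E x"
  shows "of_section E u (U, \<phi>, e) x = flat e x (u x)"
proof -
  note ef = coord_fibre[OF c x] and fr = frame[OF coord_frame[OF c]]
  have "metric E x (u x) (e b x) = (\<Sum>a<r. gram E e x a b * frame_coord E e x (u x) a)" if "b < r" for b
    by (subst (1) frame_expansion[OF fr x u], subst metric_sum)
      (use ef that in \<open>auto simp: gram_def mult.commute\<close>)
  then show ?thesis
    using c x by (simp add: of_section_def flat_def scaleR_sum_left) (rule sum.swap)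
qed

lemma flat_linear:
  assumes c: "(U, \<phi>, e) \<in> coord_systems E" and x: "x \<in> U"
    and "u \<in> fibre E x" "v \<in> fibre E x"
  shows "flat e x (p *\<^sub>R u + q *\<^sub>R v) = p *\<^sub>R flat e x u + q *\<^sub>R flat e x v"
  unfolding flat_def scaleR_sum_right sum.distrib[symmetric]
  by (rule sum.cong) (use metric_linear[OF assms(3,4)] coord_fibre[OF c x] in \<open>auto simp: algebra_simps\<close>)

lemma flat_sum:
  assumes c: "(U, \<phi>, e) \<in> coord_systems E" and x: "x \<in> U" and "\<And>i. i \<in> S \<Longrightarrow> v i \<in> fibre E x"
  shows "flat e x (\<Sum>i\<in>S. p i *\<^sub>R v i) = (\<Sum>i\<in>S. p i *\<^sub>R flat e x (v i))"
  using assms(3)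
proof (induction S rule: infinite_finite_induct)
  case (insert i S)
  then show ?case
    using flat_linear[OF c x, of "v i" "\<Sum>i\<in>S. p i *\<^sub>R v i" "p i" 1] by auto
qed (use flat_linear[OF c x, of 0 0 0 0] in auto)

lemma coeff_flat: "b < r \<Longrightarrow> coeff (flat e x v) ({|b|}, {#}) = metric E x v (e b x)"
  by (simp add: flat_def coeff_sum tau_def coeff_mon if_distrib[of "(*) _"] cong: if_cong)

lemma flat_inj:
  assumes c: "(U, \<phi>, e) \<in> coord_systems E" and x: "x \<in> U" and u: "u \<in> fibre E x" and v: "v \<in> fibre E x"
    and eq: "flat e x u = flat e x v"
  shows "u = v"
proof -
  note ef = coord_fibre[OF c x] and fr = frame[OF coord_frame[OF c]]
  have b: "metric E x (u - v) (e b x) = 0" if "b < r" for b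
    using coeff_flat[OF that, of e x u] coeff_flat[OF that, of e x v] eq metric_diff[OF u v ef[OF that]] by simp
  have "u - v = 0"
  proof (rule metric_nondegenerate)
    show uv: "u - v \<in> fibre E x" using u v by auto
    show "metric E x (u - v) w = 0" if "w \<in> fibre E x" for w
      by (subst frame_expansion[OF fr x that], subst metric_sum_right[OF uv]) (use b ef in auto)
  qed
  then show ?thesis by simp
qed

lemma of_section_inj:
  assumes u: "u \<in> sections E" and v: "v \<in> sections E" and eq: "of_section E u = of_section E v"
  shows "u = v"
proof
  fix x
  obtain U \<phi> e where c: "(U, \<phi>, e) \<in> coord_systems E" "x \<in> U" using coord_system_exists[of x] .
  show "u x = v x"
    using of_section_eq[OF c, of u] of_section_eq[OF c, of v] section_fibre u v eq
    by (intro flat_inj[OF c]) auto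
qed

lemma section_of_eq: "u \<in> sections E \<Longrightarrow> of_section E u = a \<Longrightarrow> section_of E a = u"
  unfolding section_of_def by (rule the_equality) (auto intro: of_section_inj)

lemma of_section_outside: "c \<notin> coord_systems E \<or> x \<notin> fst c \<Longrightarrow> of_section E u c x = 0"
  by (cases c) (auto simp: of_section_def)

text \<open>The operator \<open>a\<close> \<mapsto> {u, a} at a point. As an element of degree 1 is
  annihilated by \<open>d_mom\<close>, the base derivatives of \<open>a\<close> drop out of the
  bracket, and what remains acts on the single superpolynomial that is the value of
  \<open>a\<close>.\<close>

definition iota :: "('m, 'v) coords \<Rightarrow> ('m \<Rightarrow> 'v) \<Rightarrow> 'm \<Rightarrow> superpoly \<Rightarrow> superpoly" where
  "iota = (\<lambda>(U, \<phi>, e) u x. superderivation r n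
     (\<lambda>i. \<Sum>b<r. chart_deriv (U, \<phi>) i (\<lambda>y. metric E y (u y) (e b y)) x *\<^sub>R tau b)
     (\<lambda>b. frame_coord E e x (u x) b *\<^sub>R 1))"

lemma d_base_section:
  assumes c: "(U, \<phi>, e) \<in> coord_systems E" and x: "x \<in> U" and u: "u \<in> sections E" and i: "i < n"
  shows "d_base (U, \<phi>) i (of_section E u (U, \<phi>, e)) x =
    (\<Sum>b<r. chart_deriv (U, \<phi>) i (\<lambda>y. metric E y (u y) (e b y)) x *\<^sub>R tau b)"
proof -
  have "d_base (U, \<phi>) i (of_section E u (U, \<phi>, e)) x =
      d_base (U, \<phi>) i (\<lambda>y. \<Sum>b<r. metric E y (u y) (e b y) *\<^sub>R tau b) x"
    by (rule d_base_cong[OF coord_chart[OF c] x i])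
      (use of_section_eq[OF c] section_fibre[OF u] in \<open>simp add: flat_def\<close>)
  then show ?thesis
    using d_base_sum[OF coord_chart[OF c] x i, of "{..<r}" "\<lambda>b y. metric E y (u y) (e b y)" tau]
      metric_section_smooth[OF u coord_frame[OF c]] by simp
qed

lemma d_mom_flat [simp]: "d_mom i (flat e x v) = 0"
  by (rule homogeneous_pure_d_mom[OF flat_homogeneous])

lemma d_tau_left_flat: "d_tau_left b (flat e x v) = (if b < r then metric E x v (e b x) *\<^sub>R 1 else 0)"
  by (simp add: flat_def if_distrib[of "(*\<^sub>R) _"] cong: if_cong)

lemma bracket_section_left:
  assumes c: "(U, \<phi>, e) \<in> coord_systems E" and x: "x \<in> U" and u: "u \<in> sections E"
  shows "bracket E (of_section E u) a (U, \<phi>, e) x = iota (U, \<phi>, e) u x (a (U, \<phi>, e) x)"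
proof -
  have eq: "of_section E u (U, \<phi>, e) x = flat e x (u x)"
    by (rule of_section_eq[where u = u, OF c x section_fibre[OF u]])
  have "(\<Sum>a<r. \<Sum>b<r. gram_inv E e x a b *\<^sub>R (d_tau_right a (flat e x (u x)) * d_tau_left b y)) =
      (\<Sum>b<r. (frame_coord E e x (u x) b *\<^sub>R 1) * d_tau_left b y)" for y
  proof -
    have "(\<Sum>a<r. \<Sum>b<r. gram_inv E e x a b *\<^sub>R (d_tau_right a (flat e x (u x)) * d_tau_left b y)) =
      (\<Sum>a<r. \<Sum>b<r. (gram_inv E e x a b * metric E x (u x) (e a x)) *\<^sub>R d_tau_left b y)"
      by (intro sum.cong refl) (simp add: d_tau_right_eq d_tau_left_flat)
    also have "\<dots> = (\<Sum>b<r. (\<Sum>a<r. gram_inv E e x a b * metric E x (u x) (e a x)) *\<^sub>R d_tau_left b y)"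
      by (subst sum.swap) (simp add: scaleR_sum_left)
    finally show ?thesis
      using gram_inv_coord[OF c x section_fibre[OF u]] by simp
  qed
  then show ?thesis
    using c x by (simp add: bracket_def Let_def eq iota_def superderivation_def d_base_section[OF c x u])
qed

lemma odd_element_d_section: "odd_element (\<Sum>b<r. p b *\<^sub>R tau b)"
  by auto

text \<open>Graded antisymmetry with an argument of degree 1, the sign being expressed through
  \<open>parity\<close>.\<close>

lemma bracket_section_right:
  assumes c: "(U, \<phi>, e) \<in> coord_systems E" and x: "x \<in> U" and u: "u \<in> sections E"
  shows "bracket E a (of_section E u) (U, \<phi>, e) x = - iota (U, \<phi>, e) u x (parity (a (U, \<phi>, e) x))"
proof -
  have eq: "of_section E u (U, \<phi>, e) x = flat e x (u x)"
    by (rule of_section_eq[where u = u, OF c x section_fibre[OF u]])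
  have "(\<Sum>a<r. \<Sum>b<r. gram_inv E e x a b *\<^sub>R (d_tau_right a y * d_tau_left b (flat e x (u x)))) =
      - (\<Sum>b<r. (frame_coord E e x (u x) b *\<^sub>R 1) * d_tau_left b (parity y))" for y
  proof -
    have "(\<Sum>a<r. \<Sum>b<r. gram_inv E e x a b *\<^sub>R (d_tau_right a y * d_tau_left b (flat e x (u x)))) =
      (\<Sum>a<r. \<Sum>b<r. - ((gram_inv E e x b a * metric E x (u x) (e b x)) *\<^sub>R d_tau_left a (parity y)))"
      using gram_inv_sym[OF c x]
      by (intro sum.cong refl) (simp add: d_tau_right_eq d_tau_left_flat parity_d_tau_left)
    also have "\<dots> = - (\<Sum>a<r. (\<Sum>b<r. gram_inv E e x b a * metric E x (u x) (e b x)) *\<^sub>R d_tau_left a (parity y))"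
      by (simp add: scaleR_sum_left sum_negf)
    finally show ?thesis
      using gram_inv_coord[OF c x section_fibre[OF u]] by simp
  qed
  moreover have "d_mom i y * (\<Sum>b<r. p b *\<^sub>R tau b) = (\<Sum>b<r. p b *\<^sub>R tau b) * d_mom i (parity y)" for i y p
    using odd_element_swap[OF odd_element_d_section, of p "parity (d_mom i y)"] by (simp add: d_mom_parity)
  ultimately show ?thesis
    using c x by (simp add: bracket_def Let_def eq iota_def superderivation_def d_base_section[OF c x u]
        sum_negf)
qed

lemma iota_mult:
  "iota c u x (y * z) = iota c u x y * z + parity y * iota c u x z"
  unfolding iota_def by (cases c, simp, rule superderivation_odd_mult) auto

lemma linear_iota: "linear (iota c u x)"
  unfolding iota_def by (cases c) (simp add: linear_superderivation)

lemmas iota_simps [simp] =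
  linear_add[OF linear_iota] linear_scale[OF linear_iota] linear_0[OF linear_iota]
  linear_neg[OF linear_iota] linear_diff[OF linear_iota] linear_sum[OF linear_iota]

lemma iota_one [simp]: "iota c u x 1 = 0"
  unfolding iota_def by (cases c) simp

lemma iota_tau: "a < r \<Longrightarrow> iota (U, \<phi>, e) u x (tau a) = frame_coord E e x (u x) a *\<^sub>R 1"
  unfolding iota_def by simp

lemma iota_tau_outside: "\<not> a < r \<Longrightarrow> iota (U, \<phi>, e) u x (tau a) = 0"
  unfolding iota_def by simp

lemma iota_mom: "i < n \<Longrightarrow> iota (U, \<phi>, e) u x (mom i) =
    (\<Sum>b<r. chart_deriv (U, \<phi>) i (\<lambda>y. metric E y (u y) (e b y)) x *\<^sub>R tau b)"
  unfolding iota_def by simp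

lemma iota_mom_outside: "\<not> i < n \<Longrightarrow> iota (U, \<phi>, e) u x (mom i) = 0"
  unfolding iota_def by simp

lemma iota_homogeneous: "y \<in> homogeneous r n (Suc k) \<Longrightarrow> iota c u x y \<in> homogeneous r n k"
  unfolding iota_def
  by (cases c, simp, erule superderivation_homogeneous_odd)
    (auto intro!: homogeneous_sum homogeneous_scale homogeneous_one)

lemma iota_pure:
  "y \<in> homogeneous r 0 k \<Longrightarrow>
    iota (U, \<phi>, e) u x y = (\<Sum>b<r. frame_coord E e x (u x) b *\<^sub>R d_tau_left b y)"
  by (simp add: iota_def superderivation_def homogeneous_pure_d_mom)

lemma iota_pure_homogeneous:
  "y \<in> homogeneous r 0 (Suc k) \<Longrightarrow> iota (U, \<phi>, e) u x y \<in> homogeneous r 0 k"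
  by (subst iota_pure) auto

text \<open>By the Jacobi identity the anticommutator is the bracket with the function <u, v>, which
  differentiates in the momenta only. On forms without momenta what is left is contraction in an
  exterior algebra.\<close>

lemma iota_pure_anticommute:
  assumes "y \<in> homogeneous r 0 (Suc k)"
  shows "iota (U, \<phi>, e) u x (iota (U, \<phi>, e) v x y) = - iota (U, \<phi>, e) v x (iota (U, \<phi>, e) u x y)"
proof -
  have *: "iota (U, \<phi>, e) u x (iota (U, \<phi>, e) v x y) =
      (\<Sum>a<r. \<Sum>b<r. (frame_coord E e x (u x) a * frame_coord E e x (v x) b) *\<^sub>R d_tau_left a (d_tau_left b y))"
    for u v
    by (subst iota_pure[OF iota_pure_homogeneous[OF assms]], subst iota_pure[OF assms])
      (simp add: scaleR_sum_right)
  have "- iota (U, \<phi>, e) v x (iota (U, \<phi>, e) u x y) =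
      (\<Sum>a<r. \<Sum>b<r. (frame_coord E e x (u x) b * frame_coord E e x (v x) a) *\<^sub>R d_tau_left b (d_tau_left a y))"
    unfolding *
    by (subst d_tau_left_anticommute) (simp add: sum_negf mult.commute)
  also have "\<dots> = iota (U, \<phi>, e) u x (iota (U, \<phi>, e) v x y)"
    unfolding * by (rule sum.swap)
  finally show ?thesis by simp
qed

lemma iota_flat:
  assumes c: "(U, \<phi>, e) \<in> coord_systems E" and x: "x \<in> U" and u: "u x \<in> fibre E x" and v: "v \<in> fibre E x"
  shows "iota (U, \<phi>, e) u x (flat e x v) = metric E x (u x) v *\<^sub>R 1"
proof -
  have "metric E x (u x) v = metric E x v (u x)" by (rule metric_sym[OF u v])
  also have "\<dots> = (\<Sum>b<r. frame_coord E e x (u x) b * metric E x v (e b x))"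
    by (subst frame_expansion[OF frame[OF coord_frame[OF c]] x u], rule metric_sum_right)
      (use v coord_fibre[OF c x] in auto)
  finally show ?thesis
    by (subst iota_pure[OF flat_homogeneous]) (simp add: d_tau_left_flat scaleR_sum_left)
qed

text \<open>The derivatives of a section are coefficients of \<open>d_mom\<close>, which vanishes
  here, so only its value at \<open>x\<close> counts.\<close>

lemma iota_tensorial:
  assumes c: "(U, \<phi>, e) \<in> coord_systems E" and x: "x \<in> U" and y: "y \<in> homogeneous r 0 k"
    and w: "w x = p *\<^sub>R u x + q *\<^sub>R v x" and "u x \<in> fibre E x" "v x \<in> fibre E x"
  shows "iota (U, \<phi>, e) w x y = p *\<^sub>R iota (U, \<phi>, e) u x y + q *\<^sub>R iota (U, \<phi>, e) v x y"
  unfolding iota_pure[OF y] w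
  using frame_coord_linear[OF frame[OF coord_frame[OF c]] x assms(5,6)]
  by (simp add: scaleR_sum_right sum.distrib[symmetric] algebra_simps)

text \<open>Contraction with a section through a frame vector is the corresponding
  \<open>d_tau_left\<close>. Elements given in two coordinate systems are compared by this
  criterion.\<close>

lemma iota_pure_zeroD:
  assumes c: "(U, \<phi>, e) \<in> coord_systems E" and x: "x \<in> U" and y: "y \<in> homogeneous r 0 (Suc k)"
    and 0: "\<And>u. u \<in> sections E \<Longrightarrow> iota (U, \<phi>, e) u x y = 0"
  shows "y = 0"
proof (rule homogeneous_eq_0I[OF y])
  fix a assume a: "a < r"
  obtain u where u: "u \<in> sections E" "u x = e a x"
    using section_through[OF coord_fibre[OF c x a]] .
  have "iota (U, \<phi>, e) u x y = (\<Sum>b<r. if b = a then d_tau_left a y else 0)"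
    unfolding iota_pure[OF y] u(2)
    by (rule sum.cong) (use frame_coord_frame[OF frame[OF coord_frame[OF c]] x] a in auto)
  then show "d_tau_left a y = 0" using 0[OF u(1)] a by simp
qed simp

lemma homogeneous_1_flat:
  assumes c: "(U, \<phi>, e) \<in> coord_systems E" and x: "x \<in> U" and y: "y \<in> homogeneous r n (Suc 0)"
  obtains v where "v \<in> fibre E x" "y = flat e x v"
proof -
  note fr = frame[OF coord_frame[OF c]]
  have "\<exists>v\<in>fibre E x. \<forall>w\<in>fibre E x. metric E x v w = (\<Sum>b<r. coeff y ({|b|}, {#}) * frame_coord E e x w b)"
    by (rule metric_representable)
      (simp add: frame_coord_linear[OF fr x] sum_distrib_left sum.distrib algebra_simps)
  then obtain v where v: "v \<in> fibre E x"
    "\<And>w. w \<in> fibre E x \<Longrightarrow> metric E x v w = (\<Sum>b<r. coeff y ({|b|}, {#}) * frame_coord E e x w b)" by blast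
  have "metric E x v (e a x) = coeff y ({|a|}, {#})" if "a < r" for a
  proof -
    have "metric E x v (e a x) = (\<Sum>b<r. if b = a then coeff y ({|a|}, {#}) else 0)"
      unfolding v(2)[OF coord_fibre[OF c x that]]
      by (rule sum.cong) (use frame_coord_frame[OF fr x] that in auto)
    then show ?thesis using that by simp
  qed
  then have "flat e x v = (\<Sum>a<r. coeff y ({|a|}, {#}) *\<^sub>R tau a)"
    by (simp add: flat_def)
  also have "\<dots> = y" by (rule homogeneous_1_eq[OF y, symmetric])
  finally show ?thesis using that[OF v(1)] by simp
qed

end

section \<open>The quadratic element of a skew endomorphism and its bracket\<close>

locale skew_endomorphism = metric_vector_bundle E
  for E :: "('m::{t2_space,second_countable_topology}, 'v::real_vector, 'z) metric_bundle_scheme" +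
  fixes N :: "'m \<Rightarrow> 'v \<Rightarrow> 'v"
  assumes endo: "is_endomorphism E N" and skew: "is_skew E N"
begin

lemma N_fibre: "v \<in> fibre E x \<Longrightarrow> N x v \<in> fibre E x"
  using endo unfolding is_endomorphism_def by (elim conjE) blast

lemma N_linear: "u \<in> fibre E x \<Longrightarrow> v \<in> fibre E x \<Longrightarrow>
    N x (p *\<^sub>R u + q *\<^sub>R v) = p *\<^sub>R N x u + q *\<^sub>R N x v"
  using endo unfolding is_endomorphism_def by (elim conjE) blast

lemma N_sum:
  assumes "\<And>i. i \<in> S \<Longrightarrow> v i \<in> fibre E x"
  shows "N x (\<Sum>i\<in>S. p i *\<^sub>R v i) = (\<Sum>i\<in>S. p i *\<^sub>R N x (v i))"
  using assms
proof (induction S rule: infinite_finite_induct)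
  case (insert i S)
  then show ?case
    using N_linear[of "v i" x "\<Sum>i\<in>S. p i *\<^sub>R v i" "p i" 1] by auto
qed (use N_linear[of 0 x 0 0 0] in auto)

lemma N_skew: "u \<in> fibre E x \<Longrightarrow> v \<in> fibre E x \<Longrightarrow> metric E x (N x u) v = - metric E x u (N x v)"
  using skew unfolding is_skew_def by (simp add: eq_neg_iff_add_eq_0)

lemma N_smooth:
  assumes "(U, e) \<in> frames E" "a < r" "b < r"
  shows "smooth_on E U (\<lambda>x. frame_coord E e x (N x (e b x)) a)"
proof -
  have "\<forall>(U, e)\<in>frames E. \<forall>a<rank E. \<forall>b<rank E.
      smooth_on E U (\<lambda>x. frame_coord E e x (N x (e b x)) a)"
    using endo unfolding is_endomorphism_def by (elim conjE)
  from bspec[OF this assms(1)] show ?thesis using assms(2,3) by simp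
qed

lemma N_expansion:
  assumes fr: "is_frame E (U, e)" and x: "x \<in> U" and v: "v \<in> fibre E x"
  shows "N x v = (\<Sum>b<r. frame_coord E e x v b *\<^sub>R N x (e b x))"
  by (subst frame_expansion[OF fr x v], rule N_sum) (use frame_in_fibre[OF fr x] in auto)

lemma app_section:
  assumes u: "u \<in> sections E"
  shows "app N u \<in> sections E"
proof (rule sectionsI)
  show "app N u x \<in> fibre E x" for x
    unfolding app_def by (rule N_fibre[OF section_fibre[OF u]])
  fix U e a assume f: "(U, e) \<in> frames E" and a: "a < r"
  note fr = frame[OF f] and oU = frame_open[OF f]
  show "smooth_on E U (\<lambda>x. frame_coord E e x (app N u x) a)"
  proof (rule smooth_on_cong[OF oU])
    show "smooth_on E U (\<lambda>x. \<Sum>b<r. frame_coord E e x (u x) b * frame_coord E e x (N x (e b x)) a)"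
      by (intro smooth_on_sum smooth_on_mult oU section_coord_smooth[OF u f] N_smooth[OF f a]) auto
    show "(\<Sum>b<r. frame_coord E e x (u x) b * frame_coord E e x (N x (e b x)) a) =
        frame_coord E e x (app N u x) a" if x: "x \<in> U" for x
      unfolding app_def N_expansion[OF fr x section_fibre[OF u]]
      by (rule frame_coord_sum[OF fr x a, symmetric]) (use N_fibre frame_in_fibre[OF fr x] in auto)
  qed
qed

definition \<omega> :: "(nat \<Rightarrow> 'm \<Rightarrow> 'v) \<Rightarrow> nat \<Rightarrow> nat \<Rightarrow> 'm \<Rightarrow> real" where
  "\<omega> e a b x = metric E x (N x (e a x)) (e b x)"

lemma \<omega>_smooth:
  assumes f: "(U, e) \<in> frames E" and ab: "a < r" "b < r"
  shows "smooth_on E U (\<omega> e a b)"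
proof (rule smooth_on_cong[OF frame_open[OF f]])
  show "smooth_on E U (\<lambda>x. \<Sum>d<r. frame_coord E e x (N x (e a x)) d * metric E x (e d x) (e b x))"
    by (intro smooth_on_sum smooth_on_mult frame_open[OF f] N_smooth[OF f] metric_smooth[OF f] ab) auto
  show "(\<Sum>d<r. frame_coord E e x (N x (e a x)) d * metric E x (e d x) (e b x)) = \<omega> e a b x"
    if x: "x \<in> U" for x
    unfolding \<omega>_def
    by (subst (2) frame_expansion[OF frame[OF f] x N_fibre], rule frame_in_fibre[OF frame[OF f] x ab(1)],
        rule metric_sum[symmetric])
      (use frame_in_fibre[OF frame[OF f] x] ab in auto)
qed

lemma \<omega>_skew: "is_frame E (U, e) \<Longrightarrow> x \<in> U \<Longrightarrow> a < r \<Longrightarrow> b < r \<Longrightarrow> \<omega> e b a x = - \<omega> e a b x"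
  unfolding \<omega>_def
  using N_skew[of "e b x" x "e a x"] frame_in_fibre metric_sym[OF _ N_fibre, of "e b x" x "e a x"] by simp

text \<open>The 2-form <N . , .>; the 1/2 compensates for each pair of indices occurring in both
  orders, and the order of the arguments is the one for which {u, a} = N u.\<close>

definition endo_form :: "('m, 'v) graded_function" where
  "endo_form = (\<lambda>(U, \<phi>, e) x. if (U, \<phi>, e) \<in> coord_systems E \<and> x \<in> U
     then (1 / 2) *\<^sub>R (\<Sum>a<r. \<Sum>b<r. \<omega> e a b x *\<^sub>R (tau a * tau b)) else 0)"

text \<open>The bracket with \<open>endo_form\<close> from the left, at a point. The minus sign is
  the parity of the linear polynomial that arises as right derivative.\<close>

definition D :: "('m, 'v) coords \<Rightarrow> 'm \<Rightarrow> superpoly \<Rightarrow> superpoly" where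
  "D = (\<lambda>(U, \<phi>, e) x. superderivation r n
     (\<lambda>i. (1 / 2) *\<^sub>R (\<Sum>a<r. \<Sum>b<r. chart_deriv (U, \<phi>) i (\<omega> e a b) x *\<^sub>R (tau a * tau b)))
     (\<lambda>b. - (\<Sum>a<r. gram_inv E e x a b *\<^sub>R flat e x (N x (e a x)))))"

lemma even_element_quadratic: "even_element (p *\<^sub>R (\<Sum>a<r. \<Sum>b<r. A a b *\<^sub>R (tau a * tau b)))"
  by (intro even_element_linear even_element_sum) (auto intro: even_element_odd_times_odd)

lemma quadratic_homogeneous: "p *\<^sub>R (\<Sum>a<r. \<Sum>b<r. A a b *\<^sub>R (tau a * tau b)) \<in> homogeneous r 0 2"
  by (intro homogeneous_scale homogeneous_sum homogeneous_mult[of _ _ _ "Suc 0" _ "Suc 0"]) auto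

lemma odd_element_D_coefficient: "odd_element (- (\<Sum>a<r. p a *\<^sub>R flat e x (v a)))"
  by (auto intro!: odd_element_linear(4))

lemma D_mult: "D c x (y * z) = D c x y * z + y * D c x z"
  unfolding D_def
  by (cases c, simp only: prod.case, rule superderivation_even_mult)
    (simp_all only: even_element_quadratic odd_element_D_coefficient)

lemma parity_D: "parity (D c x y) = D c x (parity y)"
  unfolding D_def
  by (cases c, simp only: prod.case, rule parity_superderivation_even)
    (simp_all only: even_element_quadratic odd_element_D_coefficient)

lemma linear_D: "linear (D c x)"
  unfolding D_def by (cases c) (simp add: linear_superderivation)

lemmas D_simps [simp] =
  linear_add[OF linear_D] linear_scale[OF linear_D] linear_0[OF linear_D]
  linear_neg[OF linear_D] linear_diff[OF linear_D] linear_sum[OF linear_D]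

lemma D_one [simp]: "D c x 1 = 0"
  unfolding D_def by (cases c) simp

lemma D_homogeneous: "y \<in> homogeneous r n k \<Longrightarrow> D c x y \<in> homogeneous r n k"
  unfolding D_def
proof (cases c, simp only: prod.case, erule superderivation_homogeneous_even)
  show "(1 / 2) *\<^sub>R (\<Sum>a<r. \<Sum>b<r. A a b *\<^sub>R (tau a * tau b)) \<in> homogeneous r n 2" for A
    by (rule homogeneous_pure_subset[OF quadratic_homogeneous])
  show "- (\<Sum>a<r. p a *\<^sub>R flat e x (v a)) \<in> homogeneous r n (Suc 0)" for p e v
    by (intro homogeneous_neg homogeneous_sum homogeneous_scale homogeneous_pure_subset[OF flat_homogeneous])
qed

text \<open>No coefficient of \<open>D\<close> contains a momentum. Hence the momentum derivatives
  of the square of \<open>D\<close> on \<Theta> are governed by its action on elements of degree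
  1.\<close>

lemma D_d_mom: "d_mom i (D c x y) = D c x (d_mom i y)"
  unfolding D_def
  by (cases c) (simp add: superderivation_def d_mom_mult d_mom_commute[of i] d_mom_d_tau_left sum_negf)

text \<open>The sign is antisymmetry: \<open>endo_form\<close> stands on the left here, whereas N u
  is obtained with \<open>u\<close> on the left.\<close>

lemma D_flat:
  assumes c: "(U, \<phi>, e) \<in> coord_systems E" and x: "x \<in> U" and v: "v \<in> fibre E x"
  shows "D (U, \<phi>, e) x (flat e x v) = - flat e x (N x v)"
proof -
  note ef = coord_fibre[OF c x] and fr = frame[OF coord_frame[OF c]]
  have "D (U, \<phi>, e) x (flat e x v) =
      (\<Sum>b<r. - (\<Sum>a<r. (gram_inv E e x a b * metric E x v (e b x)) *\<^sub>R flat e x (N x (e a x))))"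
    unfolding D_def superderivation_def
    by (simp add: d_tau_left_flat scaleR_sum_right mult.commute)
  also have "\<dots> = - (\<Sum>a<r. (\<Sum>b<r. gram_inv E e x b a * metric E x v (e b x)) *\<^sub>R flat e x (N x (e a x)))"
    unfolding sum_negf scaleR_sum_left
    by (subst sum.swap) (use gram_inv_sym[OF c x] in simp)
  also have "\<dots> = - (\<Sum>a<r. frame_coord E e x v a *\<^sub>R flat e x (N x (e a x)))"
    using gram_inv_coord[OF c x v] by simp
  also have "\<dots> = - flat e x (N x v)"
    unfolding N_expansion[OF fr x v] by (subst flat_sum[OF c x]) (use ef N_fibre in auto)
  finally show ?thesis .
qed

lemma endo_form_eq:
  "(U, \<phi>, e) \<in> coord_systems E \<Longrightarrow> x \<in> U \<Longrightarrow>
    endo_form (U, \<phi>, e) x = (1 / 2) *\<^sub>R (\<Sum>a<r. \<Sum>b<r. \<omega> e a b x *\<^sub>R (tau a * tau b))"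
  by (simp add: endo_form_def)

text \<open>Stated for arbitrary skew coefficients, as it serves both for \<open>\<omega>\<close> at
  a point and for the chart derivatives of \<open>\<omega>\<close>.\<close>

lemma d_tau_left_quadratic:
  assumes A: "\<And>a b. a < r \<Longrightarrow> b < r \<Longrightarrow> A b a = - A a b" and d: "d < r"
  shows "d_tau_left d ((1 / 2) *\<^sub>R (\<Sum>a<r. \<Sum>b<r. A a b *\<^sub>R (tau a * tau b))) = (\<Sum>b<r. A d b *\<^sub>R tau b)"
proof -
  have "d_tau_left d (\<Sum>a<r. \<Sum>b<r. A a b *\<^sub>R (tau a * tau b)) =
      (\<Sum>a<r. \<Sum>b<r. (if a = d then A a b *\<^sub>R tau b else 0) - (if b = d then A a b *\<^sub>R tau a else 0))"
  proof -
    have q: "d_tau_left d (tau a * tau b) = (if a = d then tau b else 0) - (if b = d then tau a else 0)" for a b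
      by (simp add: d_tau_left_mult)
    show ?thesis
      unfolding superlinear_simps q by (intro sum.cong refl) (auto simp: scaleR_diff_right)
  qed
  also have "\<dots> = (\<Sum>a<r. if a = d then \<Sum>b<r. A a b *\<^sub>R tau b else 0) - (\<Sum>a<r. A a d *\<^sub>R tau a)"
    unfolding sum_subtractf
  proof (rule arg_cong2[of _ _ _ _ "(-)"]; rule sum.cong[OF refl])
    show "(\<Sum>b<r. if a = d then A a b *\<^sub>R tau b else 0) = (if a = d then \<Sum>b<r. A a b *\<^sub>R tau b else 0)" for a
      by simp
    show "(\<Sum>b<r. if b = d then A a b *\<^sub>R tau a else 0) = A a d *\<^sub>R tau a" for a
      using d by simp
  qed
  also have "\<dots> = (\<Sum>b<r. A d b *\<^sub>R tau b) - (\<Sum>a<r. - (A d a *\<^sub>R tau a))"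
    using d A[OF d] by (auto intro!: arg_cong2[of _ _ _ _ "(-)"] sum.cong)
  also have "\<dots> = 2 *\<^sub>R (\<Sum>b<r. A d b *\<^sub>R tau b)"
    by (simp add: sum_negf scaleR_2)
  finally show ?thesis by simp
qed

lemma d_tau_left_endo_form:
  assumes c: "(U, \<phi>, e) \<in> coord_systems E" and x: "x \<in> U" and d: "d < r"
  shows "d_tau_left d (endo_form (U, \<phi>, e) x) = flat e x (N x (e d x))"
proof -
  have "d_tau_left d (endo_form (U, \<phi>, e) x) = (\<Sum>b<r. \<omega> e d b x *\<^sub>R tau b)"
    unfolding endo_form_eq[OF c x]
    by (rule d_tau_left_quadratic[where A = "\<lambda>a b. \<omega> e a b x", OF _ d])
      (rule \<omega>_skew[OF frame[OF coord_frame[OF c]] x])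
  then show ?thesis by (simp add: flat_def \<omega>_def)
qed

lemma endo_form_pure: "(U, \<phi>, e) \<in> coord_systems E \<Longrightarrow> x \<in> U \<Longrightarrow> endo_form (U, \<phi>, e) x \<in> homogeneous r 0 2"
  by (simp only: endo_form_eq quadratic_homogeneous)

lemma iota_endo_form:
  assumes c: "(U, \<phi>, e) \<in> coord_systems E" and x: "x \<in> U" and u: "u x \<in> fibre E x"
  shows "iota (U, \<phi>, e) u x (endo_form (U, \<phi>, e) x) = flat e x (N x (u x))"
proof -
  have "iota (U, \<phi>, e) u x (endo_form (U, \<phi>, e) x) =
      (\<Sum>b<r. frame_coord E e x (u x) b *\<^sub>R flat e x (N x (e b x)))"
    unfolding iota_pure[OF endo_form_pure[OF c x]]
    by (rule sum.cong) (use d_tau_left_endo_form[OF c x] in auto)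
  also have "\<dots> = flat e x (N x (u x))"
    unfolding N_expansion[OF frame[OF coord_frame[OF c]] x u]
    by (rule flat_sum[OF c x, symmetric]) (use coord_fibre[OF c x] N_fibre in auto)
  finally show ?thesis .
qed

lemma d_base_endo_form:
  assumes c: "(U, \<phi>, e) \<in> coord_systems E" and x: "x \<in> U" and i: "i < n"
  shows "d_base (U, \<phi>) i (endo_form (U, \<phi>, e)) x =
    (1 / 2) *\<^sub>R (\<Sum>a<r. \<Sum>b<r. chart_deriv (U, \<phi>) i (\<omega> e a b) x *\<^sub>R (tau a * tau b))"
proof -
  let ?J = "{..<r} \<times> {..<r}"
  have "d_base (U, \<phi>) i (endo_form (U, \<phi>, e)) x =
      d_base (U, \<phi>) i (\<lambda>y. \<Sum>j\<in>?J. \<omega> e (fst j) (snd j) y *\<^sub>R ((1 / 2) *\<^sub>R (tau (fst j) * tau (snd j)))) x"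
    by (rule d_base_cong[OF coord_chart[OF c] x i])
      (simp add: endo_form_eq[OF c] sum.cartesian_product scaleR_sum_right case_prod_beta)
  also have "\<dots> = (\<Sum>j\<in>?J. chart_deriv (U, \<phi>) i (\<omega> e (fst j) (snd j)) x *\<^sub>R ((1 / 2) *\<^sub>R (tau (fst j) * tau (snd j))))"
    by (rule d_base_sum[OF coord_chart[OF c] x i]) (use \<omega>_smooth[OF coord_frame[OF c]] in auto)
  finally show ?thesis
    by (simp add: sum.cartesian_product scaleR_sum_right case_prod_beta)
qed

lemma bracket_endo_left:
  assumes c: "(U, \<phi>, e) \<in> coord_systems E" and x: "x \<in> U"
  shows "bracket E endo_form a (U, \<phi>, e) x = D (U, \<phi>, e) x (a (U, \<phi>, e) x)"
proof -
  let ?y = "a (U, \<phi>, e) x"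
  have par: "parity (flat e x v) = - flat e x v" for v
    by (rule odd_element_parity) simp
  have "(\<Sum>a<r. \<Sum>b<r. gram_inv E e x a b *\<^sub>R (d_tau_right a (endo_form (U, \<phi>, e) x) * d_tau_left b y)) =
      (\<Sum>a<r. \<Sum>b<r. gram_inv E e x a b *\<^sub>R (- flat e x (N x (e a x)) * d_tau_left b y))" for y
    by (intro sum.cong refl) (simp add: d_tau_right_eq d_tau_left_endo_form[OF c x] par)
  also have "\<dots> y = (\<Sum>b<r. - (\<Sum>a<r. gram_inv E e x a b *\<^sub>R flat e x (N x (e a x))) * d_tau_left b y)" for y
    by (subst sum.swap) (simp add: sum_distrib_right sum_negf)
  finally show ?thesis
    using c x
    by (simp add: bracket_def Let_def D_def superderivation_def d_base_endo_form[OF c x]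
        homogeneous_pure_d_mom[OF endo_form_pure[OF c x]])
qed

text \<open>Applied to the bracket of \<open>endo_form\<close> with \<Theta>, of degree 3, this
  turns the double bracket into minus the square of \<open>D\<close>.\<close>

lemma bracket_endo_right:
  assumes c: "(U, \<phi>, e) \<in> coord_systems E" and x: "x \<in> U"
    and odd: "parity (a (U, \<phi>, e) x) = - a (U, \<phi>, e) x"
  shows "bracket E a endo_form (U, \<phi>, e) x = - D (U, \<phi>, e) x (a (U, \<phi>, e) x)"
proof -
  let ?y = "a (U, \<phi>, e) x"
  have par: "parity (d_tau_left a ?y) = d_tau_left a ?y" for a
    using odd by (simp add: parity_d_tau_left)
  have sw: "d_tau_left a ?y * flat e x v = flat e x v * d_tau_left a ?y" for a v
    using odd_element_swap[OF odd_element_flat[of e x v], of "d_tau_left a ?y"] par by simp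
  have "(\<Sum>a<r. \<Sum>b<r. gram_inv E e x a b *\<^sub>R (d_tau_right a ?y * d_tau_left b (endo_form (U, \<phi>, e) x))) =
      (\<Sum>a<r. \<Sum>b<r. gram_inv E e x b a *\<^sub>R (flat e x (N x (e b x)) * d_tau_left a ?y))"
    using gram_inv_sym[OF c x]
    by (intro sum.cong refl) (simp add: d_tau_right_eq d_tau_left_endo_form[OF c x] par sw)
  also have "\<dots> = (\<Sum>a<r. (\<Sum>b<r. gram_inv E e x b a *\<^sub>R flat e x (N x (e b x))) * d_tau_left a ?y)"
    by (simp add: sum_distrib_right)
  finally have 1: "(\<Sum>a<r. \<Sum>b<r. gram_inv E e x a b *\<^sub>R (d_tau_right a ?y * d_tau_left b (endo_form (U, \<phi>, e) x))) =
      (\<Sum>a<r. (\<Sum>b<r. gram_inv E e x b a *\<^sub>R flat e x (N x (e b x))) * d_tau_left a ?y)" .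
  have 2: "d_mom i ?y * d_base (U, \<phi>) i (endo_form (U, \<phi>, e)) x =
      (1 / 2) *\<^sub>R (\<Sum>a<r. \<Sum>b<r. chart_deriv (U, \<phi>) i (\<omega> e a b) x *\<^sub>R (tau a * tau b)) * d_mom i ?y"
    if "i < n" for i
    unfolding d_base_endo_form[OF c x that] by (rule even_element_swap[OF even_element_quadratic, symmetric])
  have "bracket E a endo_form (U, \<phi>, e) x =
      (\<Sum>i<n. - (d_mom i ?y * d_base (U, \<phi>) i (endo_form (U, \<phi>, e)) x)) +
      (\<Sum>a<r. \<Sum>b<r. gram_inv E e x a b *\<^sub>R (d_tau_right a ?y * d_tau_left b (endo_form (U, \<phi>, e) x)))"
    using c x by (simp add: bracket_def Let_def homogeneous_pure_d_mom[OF endo_form_pure[OF c x]])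
  also have "(\<Sum>i<n. - (d_mom i ?y * d_base (U, \<phi>) i (endo_form (U, \<phi>, e)) x)) =
      (\<Sum>i<n. - ((1 / 2) *\<^sub>R (\<Sum>a<r. \<Sum>b<r. chart_deriv (U, \<phi>) i (\<omega> e a b) x *\<^sub>R (tau a * tau b)) * d_mom i ?y))"
    by (rule sum.cong) (use 2 in auto)
  finally show ?thesis
    unfolding 1 D_def superderivation_def by (simp add: sum_negf)
qed

end

section \<open>Coordinate changes\<close>

context metric_vector_bundle
begin

abbreviation change :: "('m, 'v) coords \<Rightarrow> ('m, 'v) coords \<Rightarrow> 'm \<Rightarrow> superpoly \<Rightarrow> superpoly" where
  "change c c' x \<equiv> substitute (new_tau E c c' x) (new_mom E c c' x)"

lemma odd_element_new_tau: "odd_element (new_tau E c c' x a)"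
  by (cases c; cases c') auto

lemma odd_element_new_theta: "odd_element (new_theta E c c' x a)"
  by (cases c; cases c'; simp only: new_theta.simps)
    (intro odd_element_sum odd_element_linear(3) odd_element_new_tau)

lemma even_element_new_mom: "even_element (new_mom E c c' x j)"
  by (cases c; cases c'; simp only: new_mom.simps)
    (intro even_element_sum even_element_linear(2,3) even_element_odd_times_odd
      even_element_mom odd_element_tau odd_element_new_theta)

lemmas change_mult = substitute_mult[OF odd_element_new_tau even_element_new_mom]
  and change_tau = substitute_tau[OF odd_element_new_tau even_element_new_mom]
  and change_mom = substitute_mom[OF odd_element_new_tau even_element_new_mom]

lemma change_pure_homogeneous:
  assumes "y \<in> homogeneous r 0 k"
  shows "change c c' x y \<in> homogeneous r 0 k"
  using assms
proof (induction rule: homogeneous_induct)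
  case (mon I \<mu>)
  have "prod_list (map (new_tau E c c' x) as) \<in> homogeneous r 0 (length as)" for as
  proof (induction as)
    case (Cons a as)
    have "new_tau E c c' x a \<in> homogeneous r 0 (Suc 0)"
      by (cases c; cases c') auto
    then show ?case using Cons by (auto intro: homogeneous_mult)
  qed (simp add: homogeneous_one)
  from this[of "sorted_list_of_set (fset I)"] show ?case
    using mon by (auto simp add: mon_homogeneous substitute_mon fcard.rep_eq)
qed auto

context
  fixes U \<phi> e U' \<phi>' e' x
  assumes c: "(U, \<phi>, e) \<in> coord_systems E" and c': "(U', \<phi>', e') \<in> coord_systems E"
    and x: "x \<in> U" and x': "x \<in> U'"
begin

text \<open>Covariance in degree 1: the covector of \<open>v\<close> is the same in every frame. It
  identifies \<open>new_theta\<close>, serves to test \<open>endo_form\<close>, and makes the vector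
  of an element of degree 1 independent of the coordinates.\<close>

lemma change_flat:
  assumes v: "v \<in> fibre E x"
  shows "change (U, \<phi>, e) (U', \<phi>', e') x (flat e' x v) = flat e x v"
proof -
  note fr' = frame[OF coord_frame[OF c']] and ef' = coord_fibre[OF c' x'] and ef = coord_fibre[OF c x]
  have m: "metric E x v (e b x) = (\<Sum>a<r. metric E x v (e' a x) * frame_coord E e' x (e b x) a)" if "b < r" for b
    by (subst (1) frame_expansion[OF fr' x' ef[OF that]], subst metric_sum_right[OF v])
      (use ef' in \<open>auto simp: mult.commute\<close>)
  have "change (U, \<phi>, e) (U', \<phi>', e') x (flat e' x v) =
      (\<Sum>a<r. metric E x v (e' a x) *\<^sub>R new_tau E (U, \<phi>, e) (U', \<phi>', e') x a)"
    unfolding flat_def superlinear_simps change_tau ..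
  also have "\<dots> = (\<Sum>a<r. \<Sum>b<r. (metric E x v (e' a x) * frame_coord E e' x (e b x) a) *\<^sub>R tau b)"
    by (simp add: scaleR_sum_right)
  also have "\<dots> = flat e x v"
    unfolding flat_def by (subst sum.swap) (simp add: m scaleR_sum_left)
  finally show ?thesis .
qed

text \<open>The pull-back by j in invariant terms: the variable conjugate to the frame vector
  \<open>e' a\<close> becomes half its covector.\<close>

lemma new_theta_flat:
  assumes a: "a < r"
  shows "new_theta E (U, \<phi>, e) (U', \<phi>', e') x a = (1 / 2) *\<^sub>R flat e x (e' a x)"
proof -
  have "(\<Sum>b<r. gram E e' x a b *\<^sub>R new_tau E (U, \<phi>, e) (U', \<phi>', e') x b) =
      change (U, \<phi>, e) (U', \<phi>', e') x (flat e' x (e' a x))"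
    unfolding flat_def superlinear_simps change_tau gram_def ..
  also have "\<dots> = flat e x (e' a x)" by (rule change_flat[OF coord_fibre[OF c' x' a]])
  finally show ?thesis by simp
qed

lemma iota_new_tau:
  assumes u: "u \<in> sections E" and a: "a < r"
  shows "iota (U, \<phi>, e) u x (new_tau E (U, \<phi>, e) (U', \<phi>', e') x a) = frame_coord E e' x (u x) a *\<^sub>R 1"
proof -
  note fr = frame[OF coord_frame[OF c]] and fr' = frame[OF coord_frame[OF c']]
  have "frame_coord E e' x (u x) a = (\<Sum>b<r. frame_coord E e x (u x) b * frame_coord E e' x (e b x) a)"
    by (subst (1) frame_expansion[OF fr x section_fibre[OF u]], rule frame_coord_sum[OF fr' x' a])
      (use coord_fibre[OF c x] in auto)
  then show ?thesis
    by (simp add: iota_tau scaleR_sum_left mult.commute)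
qed

text \<open>Contracting the quadratic correction in \<open>new_mom\<close> gives two terms of weight
  1/2. Since both Gram matrices are constant, the derivative of the transition matrix, lowered by
  the metric, is skew; this makes the two halves add up to exactly what cancels the derivative of
  the transition matrix in the components of \<open>u\<close>.\<close>

lemma iota_new_mom:
  assumes u: "u \<in> sections E" and j: "j < n"
  shows "iota (U, \<phi>, e) u x (new_mom E (U, \<phi>, e) (U', \<phi>', e') x j) =
    change (U, \<phi>, e) (U', \<phi>', e') x (iota (U', \<phi>', e') u x (mom j))"
proof -
  note f = coord_frame[OF c] and f' = coord_frame[OF c'] and ch = coord_chart[OF c] and ch' = coord_chart[OF c']
  note fr = frame[OF f] and fr' = frame[OF f']
  let ?W = "U \<inter> U'"
  have W: "open ?W" "x \<in> ?W" using coord_open[OF c] coord_open[OF c'] x x' by auto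
  define T where "T a b y = frame_coord E e' y (e b y) a" for a b y
  define G where "G a d = metric E x (e' a x) (e d x)" for a d
  define V where "V a y = metric E y (u y) (e' a y)" for a y
  define dd where "dd i g = chart_deriv (U, \<phi>) i g x" for i g
  define uc where "uc b = frame_coord E e x (u x) b" for b
  have T_smooth: "smooth_on E ?W (T a b)" if "a < r" "b < r" for a b
    unfolding T_def by (rule smooth_on_subset[OF frame_coord_smooth[OF f f' that]]) auto
  have V_smooth: "smooth_on E ?W (V a)" if "a < r" for a
    unfolding V_def by (rule smooth_on_subset[OF metric_section_smooth[OF u f' that]]) auto
  have e_exp: "e b y = (\<Sum>a<r. T a b y *\<^sub>R e' a y)" if "b < r" "y \<in> ?W" for b y
    unfolding T_def using frame_expansion[OF fr', of y "e b y"] coord_fibre[OF c, of y b] that by auto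
  \<comment> \<open>The skewness of the lowered derivative of \<open>T\<close>.\<close>
  have TG: "(\<Sum>a<r. dd i (T a d) * G a b + dd i (T a b) * G a d) = 0"
    if i: "i < n" and bd: "b < r" "d < r" for i b d
  proof -
    have gr: "metric E y (e b y) (e d y) = (\<Sum>a<r. T a b y * (\<Sum>k<r. T k d y * metric E x (e' a x) (e' k x)))"
      if y: "y \<in> ?W" for y
    proof -
      have "metric E y (e b y) (e d y) = (\<Sum>a<r. T a b y * metric E y (e' a y) (e d y))"
        unfolding e_exp[OF bd(1) y] by (rule metric_sum) (use coord_fibre c c' y bd in auto)
      also have "\<dots> = (\<Sum>a<r. T a b y * (\<Sum>k<r. T k d y * metric E y (e' a y) (e' k y)))"
        unfolding e_exp[OF bd(2) y]
        by (intro sum.cong refl arg_cong2[of _ _ _ _ "(*)"] metric_sum_right) (use coord_fibre[OF c'] y in auto)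
      also have "\<dots> = (\<Sum>a<r. T a b y * (\<Sum>k<r. T k d y * metric E x (e' a x) (e' k x)))"
        by (intro sum.cong refl arg_cong2[of _ _ _ _ "(*)"]) (use gram_const[OF c' _ x'] y in auto)
      finally show ?thesis .
    qed
    have S1: "smooth_on E ?W (\<lambda>y. \<Sum>k<r. T k d y * metric E x (e' a x) (e' k x))" for a
      by (intro smooth_on_sum smooth_on_mult smooth_on_const W T_smooth bd) auto
    have dS1: "dd i (\<lambda>y. \<Sum>k<r. T k d y * metric E x (e' a x) (e' k x)) =
        (\<Sum>k<r. dd i (T k d) * metric E x (e' a x) (e' k x))" for a
    proof -
      have "dd i (\<lambda>y. \<Sum>k<r. T k d y * metric E x (e' a x) (e' k x)) =
          (\<Sum>k<r. dd i (\<lambda>y. T k d y * metric E x (e' a x) (e' k x)))"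
        unfolding dd_def
        by (rule chart_deriv_sum[OF ch W(1) _ W(2) x i])
          (use W T_smooth bd in \<open>auto intro!: smooth_on_mult smooth_on_const\<close>)
      also have "\<dots> = (\<Sum>k<r. dd i (T k d) * metric E x (e' a x) (e' k x))"
        unfolding dd_def
        using chart_deriv_mult[OF ch T_smooth smooth_on_const[OF W(1)] W(2) x i] bd
        by (intro sum.cong) auto
      finally show ?thesis .
    qed
    have Gexp: "G a b = (\<Sum>k<r. T k b x * metric E x (e' a x) (e' k x))" if "a < r" "b < r" for a b
      unfolding G_def e_exp[OF that(2) W(2)] by (rule metric_sum_right) (use coord_fibre[OF c' x'] that in auto)
    \<comment> \<open>The Gram matrix of \<open>e\<close> is constant, and so is that of
      \<open>e'\<close>; hence only \<open>T\<close> is differentiated when the former is expanded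
      through the latter.\<close>
    have "0 = dd i (\<lambda>y. metric E x (e b x) (e d x))"
      by (simp add: dd_def)
    also have "\<dots> = dd i (\<lambda>y. \<Sum>a<r. T a b y * (\<Sum>k<r. T k d y * metric E x (e' a x) (e' k x)))"
      unfolding dd_def by (rule chart_deriv_cong[OF ch W x i]) (use gr gram_const[OF c x _ bd] in auto)
    also have "\<dots> = (\<Sum>a<r. dd i (\<lambda>y. T a b y * (\<Sum>k<r. T k d y * metric E x (e' a x) (e' k x))))"
      unfolding dd_def
      by (rule chart_deriv_sum[OF ch W(1) _ W(2) x i]) (use W T_smooth bd S1 in \<open>auto intro!: smooth_on_mult\<close>)
    also have "\<dots> = (\<Sum>a<r. dd i (T a b) * (\<Sum>k<r. T k d x * metric E x (e' a x) (e' k x)) +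
        T a b x * (\<Sum>k<r. dd i (T k d) * metric E x (e' a x) (e' k x)))"
      unfolding dS1[symmetric] unfolding dd_def
      using chart_deriv_mult[OF ch T_smooth S1 W(2) x i] bd by (intro sum.cong) auto
    also have "\<dots> = (\<Sum>a<r. dd i (T a b) * G a d) + (\<Sum>a<r. \<Sum>k<r. T a b x * (dd i (T k d) * metric E x (e' a x) (e' k x)))"
      using Gexp bd by (simp add: sum.distrib sum_distrib_left)
    also have "(\<Sum>a<r. \<Sum>k<r. T a b x * (dd i (T k d) * metric E x (e' a x) (e' k x))) = (\<Sum>k<r. dd i (T k d) * G k b)"
      using bd metric_sym[OF coord_fibre[OF c' x'] coord_fibre[OF c' x']]
      by (subst sum.swap) (auto intro!: sum.cong simp: Gexp sum_distrib_left mult_ac)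
    finally show ?thesis by (simp add: sum.distrib)
  qed
  have u_exp: "metric E y (u y) (e d y) = (\<Sum>a<r. T a d y * V a y)" if "d < r" "y \<in> ?W" for d y
    unfolding V_def e_exp[OF that] by (rule metric_sum_right) (use coord_fibre[OF c'] section_fibre[OF u] that in auto)
  have Vx: "V a x = (\<Sum>b<r. uc b * G a b)" if "a < r" for a
  proof -
    have "V a x = metric E x (e' a x) (u x)"
      unfolding V_def by (rule metric_sym[OF section_fibre[OF u] coord_fibre[OF c' x' that]])
    also have "\<dots> = (\<Sum>b<r. uc b * G a b)"
      unfolding uc_def G_def
      by (subst (1) frame_expansion[OF fr x section_fibre[OF u]], rule metric_sum_right)
        (use coord_fibre[OF c x] coord_fibre[OF c' x' that] in auto)
    finally show ?thesis .
  qed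
  have du: "dd i (\<lambda>y. metric E y (u y) (e d y)) = (\<Sum>a<r. dd i (T a d) * V a x + T a d x * dd i (V a))"
    if i: "i < n" and d: "d < r" for i d
  proof -
    have "dd i (\<lambda>y. metric E y (u y) (e d y)) = dd i (\<lambda>y. \<Sum>a<r. T a d y * V a y)"
      unfolding dd_def by (rule chart_deriv_cong[OF ch W x i]) (use u_exp[OF d] in auto)
    also have "\<dots> = (\<Sum>a<r. dd i (\<lambda>y. T a d y * V a y))"
      unfolding dd_def
      by (rule chart_deriv_sum[OF ch W(1) _ W(2) x i]) (use W T_smooth V_smooth d in \<open>auto intro!: smooth_on_mult\<close>)
    also have "\<dots> = (\<Sum>a<r. dd i (T a d) * V a x + T a d x * dd i (V a))"
      unfolding dd_def using chart_deriv_mult[OF ch T_smooth V_smooth W(2) x i] d by (intro sum.cong) auto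
    finally show ?thesis .
  qed
  \<comment> \<open>By \<open>TG\<close> the two half terms together are the negative of the
    derivative of \<open>T\<close> that occurs in \<open>du\<close>.\<close>
  have key: "dd i (\<lambda>y. metric E y (u y) (e d y)) +
      (\<Sum>a<r. \<Sum>b<r. dd i (T a b) * (uc b * G a d)) / 2 - (\<Sum>a<r. dd i (T a d) * V a x) / 2 =
      (\<Sum>a<r. dd i (V a) * T a d x)" if i: "i < n" and d: "d < r" for i d
  proof -
    have "(\<Sum>a<r. dd i (T a d) * V a x) + (\<Sum>a<r. \<Sum>b<r. dd i (T a b) * (uc b * G a d)) =
        (\<Sum>a<r. \<Sum>b<r. uc b * (dd i (T a d) * G a b + dd i (T a b) * G a d))"
      using Vx by (simp add: sum.distrib sum_distrib_left algebra_simps)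
    also have "\<dots> = (\<Sum>b<r. uc b * (\<Sum>a<r. dd i (T a d) * G a b + dd i (T a b) * G a d))"
      by (subst sum.swap) (simp add: sum_distrib_left)
    also have "\<dots> = 0" using TG[OF i _ d] by simp
    finally show ?thesis unfolding du[OF that] by (simp add: sum.distrib mult.commute)
  qed
  have inner: "iota (U, \<phi>, e) u x (mom i + (\<Sum>a<r. \<Sum>b<r. dd i (T a b) *\<^sub>R
      (tau b * new_theta E (U, \<phi>, e) (U', \<phi>', e') x a))) =
      (\<Sum>a<r. dd i (V a) *\<^sub>R new_tau E (U, \<phi>, e) (U', \<phi>', e') x a)" if i: "i < n" for i
  proof -
    \<comment> \<open>One term per factor; reaching the second factor costs the sign of passing
      \<open>tau b\<close>.\<close>
    have th: "iota (U, \<phi>, e) u x (tau b * new_theta E (U, \<phi>, e) (U', \<phi>', e') x a) =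
        (uc b / 2) *\<^sub>R flat e x (e' a x) - (V a x / 2) *\<^sub>R tau b" if "a < r" "b < r" for a b
    proof -
      have "new_theta E (U, \<phi>, e) (U', \<phi>', e') x a = (1 / 2) *\<^sub>R flat e x (e' a x)"
        by (rule new_theta_flat[OF that(1)])
      then show ?thesis
        using iota_flat[where u = u, OF c x section_fibre[OF u] coord_fibre[OF c' x' that(1)]] that
        by (simp only: iota_mult) (simp add: iota_tau uc_def V_def)
    qed
    have "iota (U, \<phi>, e) u x (mom i + (\<Sum>a<r. \<Sum>b<r. dd i (T a b) *\<^sub>R
        (tau b * new_theta E (U, \<phi>, e) (U', \<phi>', e') x a))) =
        (\<Sum>d<r. dd i (\<lambda>y. metric E y (u y) (e d y)) *\<^sub>R tau d) +
        (\<Sum>a<r. \<Sum>b<r. dd i (T a b) *\<^sub>R ((uc b / 2) *\<^sub>R flat e x (e' a x) - (V a x / 2) *\<^sub>R tau b))"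
      using i th by (simp add: iota_mom dd_def del: new_theta.simps)
    also have "(\<Sum>a<r. \<Sum>b<r. dd i (T a b) *\<^sub>R ((uc b / 2) *\<^sub>R flat e x (e' a x) - (V a x / 2) *\<^sub>R tau b)) =
        (\<Sum>a<r. \<Sum>b<r. \<Sum>d<r. (dd i (T a b) * (uc b * G a d) / 2) *\<^sub>R tau d) -
        (\<Sum>a<r. \<Sum>b<r. (dd i (T a b) * V a x / 2) *\<^sub>R tau b)"
      by (simp add: flat_def G_def scaleR_diff_right sum_subtractf scaleR_sum_right mult.assoc)
    also have "(\<Sum>a<r. \<Sum>b<r. (dd i (T a b) * V a x / 2) *\<^sub>R tau b) =
        (\<Sum>d<r. ((\<Sum>a<r. dd i (T a d) * V a x) / 2) *\<^sub>R tau d)"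
      by (subst sum.swap) (simp add: scaleR_sum_left sum_divide_distrib)
    also have "(\<Sum>a<r. \<Sum>b<r. \<Sum>d<r. (dd i (T a b) * (uc b * G a d) / 2) *\<^sub>R tau d) =
        (\<Sum>d<r. ((\<Sum>a<r. \<Sum>b<r. dd i (T a b) * (uc b * G a d)) / 2) *\<^sub>R tau d)"
    proof -
      have "(\<Sum>a<r. \<Sum>b<r. \<Sum>d<r. (dd i (T a b) * (uc b * G a d) / 2) *\<^sub>R tau d) =
          (\<Sum>a<r. \<Sum>d<r. \<Sum>b<r. (dd i (T a b) * (uc b * G a d) / 2) *\<^sub>R tau d)"
        by (rule sum.cong[OF refl], rule sum.swap)
      also have "\<dots> = (\<Sum>d<r. \<Sum>a<r. \<Sum>b<r. (dd i (T a b) * (uc b * G a d) / 2) *\<^sub>R tau d)"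
        by (rule sum.swap)
      finally show ?thesis by (simp add: scaleR_sum_left sum_divide_distrib)
    qed
    also have "(\<Sum>d<r. dd i (\<lambda>y. metric E y (u y) (e d y)) *\<^sub>R tau d) +
        ((\<Sum>d<r. ((\<Sum>a<r. \<Sum>b<r. dd i (T a b) * (uc b * G a d)) / 2) *\<^sub>R tau d) -
         (\<Sum>d<r. ((\<Sum>a<r. dd i (T a d) * V a x) / 2) *\<^sub>R tau d)) =
        (\<Sum>d<r. (\<Sum>a<r. dd i (V a) * T a d x) *\<^sub>R tau d)"
      unfolding sum_subtractf[symmetric] sum.distrib[symmetric]
    proof (rule sum.cong[OF refl])
      fix d assume "d \<in> {..<r}"
      then show "dd i (\<lambda>y. metric E y (u y) (e d y)) *\<^sub>R tau d +
          (((\<Sum>a<r. \<Sum>b<r. dd i (T a b) * (uc b * G a d)) / 2) *\<^sub>R tau d -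
           ((\<Sum>a<r. dd i (T a d) * V a x) / 2) *\<^sub>R tau d) =
          (\<Sum>a<r. dd i (V a) * T a d x) *\<^sub>R tau d"
        using key[OF i, of d]
        by (simp only: scaleR_add_left[symmetric] scaleR_diff_left[symmetric] add_diff_eq lessThan_iff)
    qed
    also have "\<dots> = (\<Sum>a<r. dd i (V a) *\<^sub>R new_tau E (U, \<phi>, e) (U', \<phi>', e') x a)"
      by (simp add: T_def scaleR_sum_left scaleR_sum_right) (rule sum.swap)
    finally show ?thesis .
  qed
  have "iota (U, \<phi>, e) u x (new_mom E (U, \<phi>, e) (U', \<phi>', e') x j) =
      (\<Sum>i<n. chart_deriv (U', \<phi>') j (\<lambda>y. \<phi> y i) x *\<^sub>R
        (\<Sum>a<r. dd i (V a) *\<^sub>R new_tau E (U, \<phi>, e) (U', \<phi>', e') x a))"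
    unfolding new_mom.simps iota_simps
    by (rule sum.cong[OF refl], rule arg_cong[where f = "scaleR _"])
      (use inner in \<open>simp add: dd_def T_def[abs_def] del: new_theta.simps new_tau.simps\<close>)
  also have "\<dots> = (\<Sum>a<r. (\<Sum>i<n. chart_deriv (U', \<phi>') j (\<lambda>y. \<phi> y i) x * dd i (V a)) *\<^sub>R
      new_tau E (U, \<phi>, e) (U', \<phi>', e') x a)"
    unfolding scaleR_sum_right scaleR_sum_left by (subst sum.swap) (simp del: new_tau.simps)
  \<comment> \<open>The Jacobian in front of the old momenta in \<open>new_mom\<close> converts
    derivatives of the old chart into those of the new one.\<close>
  also have "\<dots> = (\<Sum>a<r. chart_deriv (U', \<phi>') j (V a) x *\<^sub>R new_tau E (U, \<phi>, e) (U', \<phi>', e') x a)"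
    unfolding dd_def
    by (intro sum.cong refl arg_cong2[of _ _ _ _ scaleR] chart_deriv_chain[symmetric, OF ch ch' W(1) V_smooth W(2) x x' j])
      auto
  also have "\<dots> = change (U, \<phi>, e) (U', \<phi>', e') x (iota (U', \<phi>', e') u x (mom j))"
    unfolding iota_mom[OF j] superlinear_simps change_tau V_def[abs_def] ..
  finally show ?thesis .
qed

text \<open>Both sides are odd derivations along the substitution homomorphism, so generators
  decide. Homogeneity confines the indices to the range in which \<open>iota_new_tau\<close> and
  \<open>iota_new_mom\<close> apply.\<close>

lemma iota_covariant:
  assumes u: "u \<in> sections E" and "y \<in> homogeneous r n k"
  shows "change (U, \<phi>, e) (U', \<phi>', e') x (iota (U', \<phi>', e') u x y) =
    iota (U, \<phi>, e) u x (change (U, \<phi>, e) (U', \<phi>', e') x y)"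
  using assms(2)
proof (induction rule: homogeneous_induct)
  case (mon I \<mu>)
  show ?case
  proof (rule mon_generator_induct[where R = "{..<r}" and M = "{..<n}"])
    show "fset I \<subseteq> {..<r}" "set_mset \<mu> \<subseteq> {..<n}" using mon by (auto simp: mon_homogeneous)
    fix a y assume "a \<in> {..<r}" and IH: "change (U, \<phi>, e) (U', \<phi>', e') x (iota (U', \<phi>', e') u x y) =
      iota (U, \<phi>, e) u x (change (U, \<phi>, e) (U', \<phi>', e') x y)"
    then have a: "a < r" by simp
    show "change (U, \<phi>, e) (U', \<phi>', e') x (iota (U', \<phi>', e') u x (tau a * y)) =
      iota (U, \<phi>, e) u x (change (U, \<phi>, e) (U', \<phi>', e') x (tau a * y))"
      unfolding iota_mult change_mult change_tau superlinear_simps iota_new_tau[OF u a] iota_tau[OF a]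
        odd_element_parity[OF odd_element_new_tau] odd_element_parity[OF odd_element_tau]
        substitute_one IH ..
  next
    fix j y assume "j \<in> {..<n}" and IH: "change (U, \<phi>, e) (U', \<phi>', e') x (iota (U', \<phi>', e') u x y) =
      iota (U, \<phi>, e) u x (change (U, \<phi>, e) (U', \<phi>', e') x y)"
    then have j: "j < n" by simp
    show "change (U, \<phi>, e) (U', \<phi>', e') x (iota (U', \<phi>', e') u x (mom j * y)) =
      iota (U, \<phi>, e) u x (change (U, \<phi>, e) (U', \<phi>', e') x (mom j * y))"
      unfolding iota_mult change_mult change_mom superlinear_simps iota_new_mom[OF u j]
        even_element_parity[OF even_element_new_mom] even_element_parity[OF even_element_mom] IH ..
  qed simp
qed simp_all

end

end

section \<open>Graded functions\<close>

context metric_vector_bundle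
begin

lemma graded_zero:
  "a \<in> graded_functions E k \<Longrightarrow> c \<notin> coord_systems E \<or> x \<notin> fst c \<Longrightarrow> a c x = 0"
  unfolding graded_functions_def by blast

lemma graded_homogeneous:
  assumes "a \<in> graded_functions E k" "(U, \<phi>, e) \<in> coord_systems E" "x \<in> U"
  shows "a (U, \<phi>, e) x \<in> homogeneous r n k"
proof -
  have "\<forall>c\<in>coord_systems E. \<forall>x\<in>fst c. \<forall>I \<mu>. coeff (a c x) (I, \<mu>) \<noteq> 0 \<longrightarrow>
      fset I \<subseteq> {..<r} \<and> set_mset \<mu> \<subseteq> {..<n} \<and> fcard I + 2 * size \<mu> = k"
    using assms(1) unfolding graded_functions_def by blast
  from bspec[OF this assms(2)] show ?thesis using assms(3) by (simp add: homogeneous_def)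
qed

lemma graded_smooth:
  assumes a: "a \<in> graded_functions E k" and c: "(U, \<phi>, e) \<in> coord_systems E"
  shows "smooth_super U (a (U, \<phi>, e))"
proof -
  let ?a = "a (U, \<phi>, e)"
  let ?K = "{(I :: nat fset, \<mu> :: nat multiset). fset I \<subseteq> {..<r} \<and> set_mset \<mu> \<subseteq> {..<n} \<and> fcard I + 2 * size \<mu> = k}"
  have "\<forall>c\<in>coord_systems E. \<forall>I \<mu>. smooth_on E (fst c) (\<lambda>x. coeff (a c x) (I, \<mu>))"
    using a unfolding graded_functions_def by blast
  from bspec[OF this c] have s: "smooth_on E U (\<lambda>x. coeff (?a x) key)" for key
    by (cases key) simp
  show ?thesis
  proof (rule smooth_super.eq_on)
    show "smooth_super U (\<lambda>x. \<Sum>key\<in>?K. coeff (?a x) key *\<^sub>R mon key)"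
      by (intro smooth_super_sum smooth_super.base s coord_open[OF c])
    fix x assume "x \<in> U"
    then have h: "?a x \<in> homogeneous r n k" by (rule graded_homogeneous[OF a c])
    have "{key. coeff (?a x) key \<noteq> 0} \<subseteq> ?K"
    proof
      fix key assume "key \<in> {key. coeff (?a x) key \<noteq> 0}"
      then show "key \<in> ?K" using h by (cases key) (simp add: homogeneous_def)
    qed
    from lin_ext_superset[OF finite_homogeneous_keys this, of mon]
    show "(\<Sum>key\<in>?K. coeff (?a x) key *\<^sub>R mon key) = ?a x"
      by (simp add: lin_ext_mon_self)
  qed
qed

lemma graded_covariant:
  assumes "a \<in> graded_functions E k" "(U, \<phi>, e) \<in> coord_systems E" "(U', \<phi>', e') \<in> coord_systems E"
    "x \<in> U" "x \<in> U'"
  shows "a (U, \<phi>, e) x = change (U, \<phi>, e) (U', \<phi>', e') x (a (U', \<phi>', e') x)"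
proof -
  have "\<forall>c\<in>coord_systems E. \<forall>c'\<in>coord_systems E. \<forall>x\<in>fst c \<inter> fst c'. a c x = change c c' x (a c' x)"
    using assms(1) unfolding graded_functions_def by blast
  from bspec[OF bspec[OF this assms(2)] assms(3)] show ?thesis using assms(4,5) by simp
qed

lemma gradedI:
  assumes "\<And>c x. c \<notin> coord_systems E \<or> x \<notin> fst c \<Longrightarrow> a c x = 0"
    and s: "\<And>U \<phi> e. (U, \<phi>, e) \<in> coord_systems E \<Longrightarrow> smooth_super U (a (U, \<phi>, e))"
    and h: "\<And>U \<phi> e x. (U, \<phi>, e) \<in> coord_systems E \<Longrightarrow> x \<in> U \<Longrightarrow> a (U, \<phi>, e) x \<in> homogeneous r n k"
    and v: "\<And>U \<phi> e U' \<phi>' e' x. (U, \<phi>, e) \<in> coord_systems E \<Longrightarrow> (U', \<phi>', e') \<in> coord_systems E \<Longrightarrow>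
      x \<in> U \<Longrightarrow> x \<in> U' \<Longrightarrow> a (U, \<phi>, e) x = change (U, \<phi>, e) (U', \<phi>', e') x (a (U', \<phi>', e') x)"
  shows "a \<in> graded_functions E k"
proof -
  have "\<forall>c x. c \<notin> coord_systems E \<or> x \<notin> fst c \<longrightarrow> a c x = 0" using assms(1) by blast
  moreover have "\<forall>c\<in>coord_systems E. (\<forall>I \<mu>. smooth_on E (fst c) (\<lambda>x. coeff (a c x) (I, \<mu>))) \<and>
      (\<forall>x\<in>fst c. \<forall>I \<mu>. coeff (a c x) (I, \<mu>) \<noteq> 0 \<longrightarrow>
        fset I \<subseteq> {..<r} \<and> set_mset \<mu> \<subseteq> {..<n} \<and> fcard I + 2 * size \<mu> = k)"
  proof (rule ballI)
    fix c assume "c \<in> coord_systems E"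
    moreover obtain U \<phi> e where "c = (U, \<phi>, e)" by (cases c)
    ultimately show "(\<forall>I \<mu>. smooth_on E (fst c) (\<lambda>x. coeff (a c x) (I, \<mu>))) \<and>
      (\<forall>x\<in>fst c. \<forall>I \<mu>. coeff (a c x) (I, \<mu>) \<noteq> 0 \<longrightarrow>
        fset I \<subseteq> {..<r} \<and> set_mset \<mu> \<subseteq> {..<n} \<and> fcard I + 2 * size \<mu> = k)"
      using smooth_super_coeff[OF coord_open s, of U \<phi> e] h[of U \<phi> e] by (simp add: homogeneous_def)
  qed
  moreover have "\<forall>c\<in>coord_systems E. \<forall>c'\<in>coord_systems E. \<forall>x\<in>fst c \<inter> fst c'.
      a c x = change c c' x (a c' x)"
  proof (intro ballI)
    fix c c' x assume *: "c \<in> coord_systems E" "c' \<in> coord_systems E" "x \<in> fst c \<inter> fst c'"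
    obtain U \<phi> e U' \<phi>' e' where c: "c = (U, \<phi>, e)" "c' = (U', \<phi>', e')" by (cases c; cases c')
    show "a c x = change c c' x (a c' x)"
      unfolding c by (rule v) (use * c in auto)
  qed
  ultimately show ?thesis unfolding graded_functions_def mem_Collect_eq by (intro conjI)
qed

lemma graded_neg:
  assumes "a \<in> graded_functions E k"
  shows "(\<lambda>c x. - a c x) \<in> graded_functions E k"
proof (rule gradedI)
  fix U \<phi> e assume c: "(U, \<phi>, e) \<in> coord_systems E"
  show "smooth_super U (\<lambda>x. - a (U, \<phi>, e) x)"
    by (rule smooth_super_linear[OF coord_open[OF c] _ graded_smooth[OF assms c]])
      (rule linearI, simp_all)
next
  fix U \<phi> e U' \<phi>' e' x
  assume "(U, \<phi>, e) \<in> coord_systems E" "(U', \<phi>', e') \<in> coord_systems E" "x \<in> U" "x \<in> U'"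
  from graded_covariant[OF assms this]
  show "- a (U, \<phi>, e) x = change (U, \<phi>, e) (U', \<phi>', e') x (- a (U', \<phi>', e') x)"
    by (simp only: superlinear_simps)
qed (use graded_zero[OF assms] graded_homogeneous[OF assms] in auto)

lemma bracket_outside: "c \<notin> coord_systems E \<or> x \<notin> fst c \<Longrightarrow> bracket E f h c x = 0"
  by (cases c) (auto simp: bracket_def)

lemma smooth_super_iota:
  assumes c: "(U, \<phi>, e) \<in> coord_systems E" and u: "u \<in> sections E" and a: "smooth_super U a"
  shows "smooth_super U (\<lambda>x. iota (U, \<phi>, e) u x (a x))"
  unfolding iota_def superderivation_def prod.case
  by (intro smooth_super.add smooth_super_sum smooth_super_mult smooth_super.base coord_open[OF c]
      smooth_super_linear[OF _ linear_d_mom a] smooth_super_linear[OF _ linear_d_tau_left a]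
      smooth_on_chart_deriv[OF coord_chart[OF c]] metric_section_smooth[OF u coord_frame[OF c]]
      section_coord_smooth[OF u coord_frame[OF c]]) auto

lemma bracket_section_graded:
  assumes u: "u \<in> sections E" and a: "a \<in> graded_functions E (Suc k)"
  shows "bracket E (of_section E u) a \<in> graded_functions E k"
proof (rule gradedI)
  fix U \<phi> e assume c: "(U, \<phi>, e) \<in> coord_systems E"
  show "smooth_super U (bracket E (of_section E u) a (U, \<phi>, e))"
    by (rule smooth_super.eq_on[OF smooth_super_iota[OF c u graded_smooth[OF a c]]])
      (simp add: bracket_section_left[OF c _ u])
  show "bracket E (of_section E u) a (U, \<phi>, e) x \<in> homogeneous r n k" if "x \<in> U" for x
    unfolding bracket_section_left[OF c that u]
    by (rule iota_homogeneous[OF graded_homogeneous[OF a c that]])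
next
  fix U \<phi> e U' \<phi>' e' x
  assume c: "(U, \<phi>, e) \<in> coord_systems E" and c': "(U', \<phi>', e') \<in> coord_systems E"
    and x: "x \<in> U" "x \<in> U'"
  show "bracket E (of_section E u) a (U, \<phi>, e) x =
      change (U, \<phi>, e) (U', \<phi>', e') x (bracket E (of_section E u) a (U', \<phi>', e') x)"
    unfolding bracket_section_left[OF c x(1) u] bracket_section_left[OF c' x(2) u]
      iota_covariant[OF c c' x u graded_homogeneous[OF a c' x(2)]]
      graded_covariant[OF a c c' x, symmetric] ..
qed (rule bracket_outside)

text \<open>The inverse of the identification of sections with elements of degree 1, which gives
  \<open>section_of\<close> its meaning. Non-degeneracy yields a vector at each point, covariance
  makes it independent of the coordinate system.\<close>

lemma section_realization:
  assumes a: "a \<in> graded_functions E (Suc 0)"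
  shows "\<exists>u\<in>sections E. of_section E u = a"
proof -
  have "\<exists>v\<in>fibre E x. \<forall>U \<phi> e. (U, \<phi>, e) \<in> coord_systems E \<longrightarrow> x \<in> U \<longrightarrow> flat e x v = a (U, \<phi>, e) x" for x
  proof -
    obtain U \<phi> e where c: "(U, \<phi>, e) \<in> coord_systems E" "x \<in> U" using coord_system_exists[of x] .
    obtain v where v: "v \<in> fibre E x" "a (U, \<phi>, e) x = flat e x v"
      using homogeneous_1_flat[OF c graded_homogeneous[OF a c]] .
    have "flat e' x v = a (U', \<phi>', e') x" if c': "(U', \<phi>', e') \<in> coord_systems E" "x \<in> U'" for U' \<phi>' e'
      unfolding graded_covariant[OF a c'(1) c(1) c'(2) c(2)] v(2)
      by (rule change_flat[OF c'(1) c(1) c'(2) c(2) v(1), symmetric])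
    then show ?thesis using v(1) by blast
  qed
  then obtain u where u: "\<And>x. u x \<in> fibre E x"
    "\<And>x U \<phi> e. (U, \<phi>, e) \<in> coord_systems E \<Longrightarrow> x \<in> U \<Longrightarrow> flat e x (u x) = a (U, \<phi>, e) x"
    by metis
  have "u \<in> sections E"
  proof (rule sectionsI[OF u(1)])
    fix V d b assume d: "(V, d) \<in> frames E" and b: "b < r"
    show "smooth_on E V (\<lambda>x. frame_coord E d x (u x) b)"
    proof (rule smooth_on_local[OF frame_open[OF d]])
      fix x0 assume x0: "x0 \<in> V"
      obtain U \<phi> e where c: "(U, \<phi>, e) \<in> coord_systems E" "x0 \<in> U" using coord_system_exists[of x0] .
      note oU = coord_open[OF c(1)] and f = coord_frame[OF c(1)]
      let ?W = "V \<inter> U"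
      have oW: "open ?W" using oU frame_open[OF d] by auto
      have "smooth_on E ?W (\<lambda>x. frame_coord E d x (u x) b)"
      proof (rule smooth_on_cong[OF oW])
        \<comment> \<open>The inverse Gram matrix is frozen at \<open>x0\<close>: it is the same on
          all of \<open>U\<close>, and constants are smooth.\<close>
        show "smooth_on E ?W (\<lambda>x. \<Sum>i<r. (\<Sum>j<r. gram_inv E e x0 j i * coeff (a (U, \<phi>, e) x) ({|j|}, {#})) *
            frame_coord E d x (e i x) b)"
        proof (intro smooth_on_sum smooth_on_mult smooth_on_const oW)
          show "smooth_on E ?W (\<lambda>x. coeff (a (U, \<phi>, e) x) ({|j|}, {#}))" for j
            by (rule smooth_on_subset[OF smooth_super_coeff[OF oU graded_smooth[OF a c(1)]]]) auto
          show "smooth_on E ?W (\<lambda>x. frame_coord E d x (e i x) b)" if "i \<in> {..<r}" for i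
            by (rule smooth_on_subset[OF frame_coord_smooth[OF f d b]]) (use that in auto)
        qed
        fix x assume x: "x \<in> ?W"
        have "(\<Sum>j<r. gram_inv E e x0 j i * coeff (a (U, \<phi>, e) x) ({|j|}, {#})) = frame_coord E e x (u x) i"
          if "i < r" for i
          unfolding gram_inv_coord[OF c(1) _ u(1) that, of x, symmetric] using x c gram_inv_const[OF c, of x]
          by (subst gram_inv_coord[OF c(1) _ u(1) that, of x, symmetric])
            (auto simp: u(2)[OF c(1), symmetric] coeff_flat)
        moreover have "frame_coord E d x (u x) b = (\<Sum>i<r. frame_coord E e x (u x) i * frame_coord E d x (e i x) b)"
          by (subst (1) frame_expansion[OF frame[OF f] _ u(1)], use x in simp,
              rule frame_coord_sum[OF frame[OF d] _ b])
            (use x coord_fibre[OF c(1)] in auto)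
        ultimately show "(\<Sum>i<r. (\<Sum>j<r. gram_inv E e x0 j i * coeff (a (U, \<phi>, e) x) ({|j|}, {#})) *
            frame_coord E d x (e i x) b) = frame_coord E d x (u x) b" by simp
      qed
      then show "\<exists>W. open W \<and> x0 \<in> W \<and> smooth_on E (V \<inter> W) (\<lambda>x. frame_coord E d x (u x) b)"
        using oU c(2) by blast
    qed
  qed
  moreover have "of_section E u c x = a c x" for c x
  proof (cases "c \<in> coord_systems E \<and> x \<in> fst c")
    case True
    obtain U \<phi> e where [simp]: "c = (U, \<phi>, e)" by (cases c)
    show ?thesis using True of_section_eq[where u = u, OF _ _ u(1)] u(2) by simp
  next
    case False
    then show ?thesis using of_section_outside[of c x u] graded_zero[OF a, of c x] by auto
  qed
  ultimately show ?thesis by blast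
qed

text \<open>The inner bracket has degree 2, so it is even and graded antisymmetry is a plain
  sign.\<close>

lemma bracket_twice:
  assumes a: "a \<in> graded_functions E 3" and u: "u \<in> sections E" and v: "v \<in> sections E"
  shows "bracket E (bracket E (of_section E u) a) (of_section E v) =
    (\<lambda>c x. - bracket E (of_section E v) (bracket E (of_section E u) a) c x)"
proof (intro ext)
  fix c x
  show "bracket E (bracket E (of_section E u) a) (of_section E v) c x =
    - bracket E (of_section E v) (bracket E (of_section E u) a) c x"
  proof (cases "c \<in> coord_systems E \<and> x \<in> fst c")
    case True
    obtain U \<phi> e where "c = (U, \<phi>, e)" by (cases c)
    moreover from this True have c: "(U, \<phi>, e) \<in> coord_systems E" "x \<in> U" by auto
    have "bracket E (of_section E u) a (U, \<phi>, e) x \<in> homogeneous r n 2"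
      using bracket_section_graded[OF u, of a 2] a c by (intro graded_homogeneous) (auto simp: numeral_3_eq_3)
    from homogeneous_parity[OF this]
    have "bracket E (bracket E (of_section E u) a) (of_section E v) (U, \<phi>, e) x =
      - bracket E (of_section E v) (bracket E (of_section E u) a) (U, \<phi>, e) x"
      by (simp add: bracket_section_right[OF c v] bracket_section_left[OF c v])
    ultimately show ?thesis by simp
  next
    case False
    then show ?thesis using bracket_outside[of c x] by auto
  qed
qed

section \<open>The Dorfman bracket and triple contractions\<close>

context
  fixes \<Theta> assumes \<Theta>: "\<Theta> \<in> graded_functions E 3"
begin

lemma dorfman_section:
  assumes u: "u \<in> sections E" and v: "v \<in> sections E"
  shows "dorfman E \<Theta> u v \<in> sections E"
    and "of_section E (dorfman E \<Theta> u v) = bracket E (bracket E (of_section E u) \<Theta>) (of_section E v)"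
proof -
  have "\<Theta> \<in> graded_functions E (Suc (Suc (Suc 0)))" using \<Theta> by (simp add: numeral_3_eq_3)
  then have "bracket E (bracket E (of_section E u) \<Theta>) (of_section E v) \<in> graded_functions E (Suc 0)"
    unfolding bracket_twice[OF \<Theta> u v]
    by (intro graded_neg bracket_section_graded[OF v] bracket_section_graded[OF u])
  then obtain w where w: "w \<in> sections E"
    "of_section E w = bracket E (bracket E (of_section E u) \<Theta>) (of_section E v)"
    using section_realization by blast
  then have "dorfman E \<Theta> u v = w" unfolding dorfman_def by (intro section_of_eq)
  then show "dorfman E \<Theta> u v \<in> sections E"
    "of_section E (dorfman E \<Theta> u v) = bracket E (bracket E (of_section E u) \<Theta>) (of_section E v)"
    using w by auto
qed

lemma dorfman_flat:
  assumes c: "(U, \<phi>, e) \<in> coord_systems E" and x: "x \<in> U" and u: "u \<in> sections E" and v: "v \<in> sections E"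
  shows "flat e x (dorfman E \<Theta> u v x) = - iota (U, \<phi>, e) v x (iota (U, \<phi>, e) u x (\<Theta> (U, \<phi>, e) x))"
proof -
  have "flat e x (dorfman E \<Theta> u v x) = of_section E (dorfman E \<Theta> u v) (U, \<phi>, e) x"
    by (rule of_section_eq[where u = "dorfman E \<Theta> u v", OF c x section_fibre[OF dorfman_section(1)[OF u v]], symmetric])
  then show ?thesis
    by (simp add: dorfman_section(2)[OF u v] bracket_twice[OF \<Theta> u v] bracket_section_left[OF c x u]
        bracket_section_left[OF c x v])
qed

end

lemma bracket_thrice:
  assumes c: "(U, \<phi>, e) \<in> coord_systems E" and x: "x \<in> U" and a: "a \<in> graded_functions E 3"
    and u: "u \<in> sections E" and v: "v \<in> sections E" and w: "w \<in> sections E"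
  shows "bracket E (bracket E (bracket E (of_section E u) a) (of_section E v)) (of_section E w) (U, \<phi>, e) x =
    - iota (U, \<phi>, e) w x (iota (U, \<phi>, e) v x (iota (U, \<phi>, e) u x (a (U, \<phi>, e) x)))"
proof -
  let ?y = "iota (U, \<phi>, e) v x (iota (U, \<phi>, e) u x (a (U, \<phi>, e) x))"
  have "a (U, \<phi>, e) x \<in> homogeneous r n (Suc (Suc (Suc 0)))"
    using graded_homogeneous[OF a c x] by (simp add: numeral_3_eq_3)
  then have "?y \<in> homogeneous r n (Suc 0)" by (intro iota_homogeneous)
  from homogeneous_parity[OF this] show ?thesis
    by (simp add: bracket_section_right[OF c x w] bracket_twice[OF a u v] bracket_section_left[OF c x u]
        bracket_section_left[OF c x v])
qed

lemma pure_cubic_zeroI: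
  assumes c: "(U, \<phi>, e) \<in> coord_systems E" and x: "x \<in> U" and y: "y \<in> homogeneous r 0 3"
    and 0: "\<And>u v w. u \<in> sections E \<Longrightarrow> v \<in> sections E \<Longrightarrow> w \<in> sections E \<Longrightarrow>
      iota (U, \<phi>, e) w x (iota (U, \<phi>, e) v x (iota (U, \<phi>, e) u x y)) = 0"
  shows "y = 0"
proof -
  have y: "y \<in> homogeneous r 0 (Suc (Suc (Suc 0)))" using y by (simp add: numeral_3_eq_3)
  show ?thesis
  proof (rule iota_pure_zeroD[OF c x y])
    fix u assume u: "u \<in> sections E"
    show "iota (U, \<phi>, e) u x y = 0"
    proof (rule iota_pure_zeroD[OF c x iota_pure_homogeneous[OF y]])
      fix v assume v: "v \<in> sections E"
      show "iota (U, \<phi>, e) v x (iota (U, \<phi>, e) u x y) = 0"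
        by (rule iota_pure_zeroD[OF c x iota_pure_homogeneous[OF iota_pure_homogeneous[OF y]]])
          (rule 0[OF u v])
    qed
  qed
qed

text \<open>Triple contractions determine a cubic form without momenta;
  \<open>tensor_element\<close> is well defined by this.\<close>

lemma represents_unique:
  assumes a: "represents_3_tensor E t a" and b: "represents_3_tensor E t b"
  shows "a = b"
proof (intro ext)
  fix c x
  have ga: "a \<in> graded_functions E 3" and gb: "b \<in> graded_functions E 3"
    using a b by (auto simp: represents_3_tensor_def)
  show "a c x = b c x"
  proof (cases "c \<in> coord_systems E \<and> x \<in> fst c")
    case True
    obtain U \<phi> e where cU: "c = (U, \<phi>, e)" by (cases c)
    with True have c: "(U, \<phi>, e) \<in> coord_systems E" "x \<in> U" by auto
    have pure: "a' (U, \<phi>, e) x \<in> homogeneous r 0 3" if "represents_3_tensor E t a'" for a'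
      by (rule homogeneous_pureI[OF graded_homogeneous[OF _ c]])
        (use that d_mom_zero_iff[of "a' (U, \<phi>, e) x"] in \<open>auto simp: represents_3_tensor_def\<close>)
    have "a (U, \<phi>, e) x - b (U, \<phi>, e) x = 0"
    proof (rule pure_cubic_zeroI[OF c])
      show "a (U, \<phi>, e) x - b (U, \<phi>, e) x \<in> homogeneous r 0 3" using pure a b by auto
      fix u v w assume uvw: "u \<in> sections E" "v \<in> sections E" "w \<in> sections E"
      have "bracket E (bracket E (bracket E (of_section E u) a) (of_section E v)) (of_section E w) =
          bracket E (bracket E (bracket E (of_section E u) b) (of_section E v)) (of_section E w)"
        using a b uvw unfolding represents_3_tensor_def by simp
      from fun_cong[OF fun_cong[OF this, of "(U, \<phi>, e)"], of x]
      show "iota (U, \<phi>, e) w x (iota (U, \<phi>, e) v x (iota (U, \<phi>, e) u x (a (U, \<phi>, e) x - b (U, \<phi>, e) x))) = 0"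
        unfolding bracket_thrice[OF c ga uvw] bracket_thrice[OF c gb uvw] by simp
    qed
    then show ?thesis by (simp add: cU)
  next
    case False
    then show ?thesis using graded_zero[OF ga, of c x] graded_zero[OF gb, of c x] by auto
  qed
qed

end

section \<open>The torsion\<close>

context skew_endomorphism
begin

section \<open>The commutator of the two derivations\<close>

lemma chart_deriv_\<omega>_skew:
  assumes c: "(U, \<phi>, e) \<in> coord_systems E" and x: "x \<in> U" and i: "i < n" and ab: "a < r" "b < r"
  shows "chart_deriv (U, \<phi>) i (\<omega> e b a) x = - chart_deriv (U, \<phi>) i (\<omega> e a b) x"
proof -
  note ch = coord_chart[OF c] and f = coord_frame[OF c]
  have "chart_deriv (U, \<phi>) i (\<omega> e b a) x = chart_deriv (U, \<phi>) i (\<lambda>y. \<omega> e a b y * - 1) x"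
    by (rule chart_deriv_cong[OF ch coord_open[OF c] x x i]) (use \<omega>_skew[OF frame[OF f] _ ab] in simp)
  then show ?thesis
    using chart_deriv_cmult[OF ch \<omega>_smooth[OF f ab] x i, of "- 1"] by simp
qed

text \<open>The Jacobi identity {a, {u, y}} = {{a, u}, y} + {u, {a, y}} for the quadratic element a
  of \<open>N\<close>, with {a, u} = - N u. On \<open>tau a\<close> it is skewness of
  \<open>N\<close>, on \<open>mom i\<close> the Leibniz rule for the covector components of N
  u.\<close>

lemma commutator:
  assumes c: "(U, \<phi>, e) \<in> coord_systems E" and x: "x \<in> U" and u: "u \<in> sections E"
  shows "D (U, \<phi>, e) x (iota (U, \<phi>, e) u x y) =
    iota (U, \<phi>, e) u x (D (U, \<phi>, e) x y) - iota (U, \<phi>, e) (app N u) x y"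
proof -
  note ch = coord_chart[OF c] and f = coord_frame[OF c] and oU = coord_open[OF c]
  note fr = frame[OF f] and ef = coord_fibre[OF c x]
  let ?c = "(U, \<phi>, e)"
  \<comment> \<open>The defect is an odd derivation although its summands are composites: the mixed
    terms cancel. So it vanishes once it does on generators.\<close>
  define F where "F y = D ?c x (iota ?c u x y) - iota ?c u x (D ?c x y) + iota ?c (app N u) x y" for y
  have F_mult: "F (y * z) = F y * z + parity y * F z" for y z
    by (simp add: F_def iota_mult D_mult parity_D[symmetric] algebra_simps)
  have F_tau: "F (tau a) = 0" for a
  proof (cases "a < r")
    case True
    have Nu: "N x (u x) \<in> fibre E x" by (rule N_fibre[OF section_fibre[OF u]])
    have "iota ?c u x (D ?c x (tau a)) =
        - (\<Sum>d<r. (gram_inv E e x d a * metric E x (u x) (N x (e d x))) *\<^sub>R 1)"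
      using True iota_flat[where u = u, OF c x section_fibre[OF u] N_fibre[OF ef]]
      by (simp add: D_def)
    also have "\<dots> = (\<Sum>d<r. (gram_inv E e x d a * metric E x (N x (u x)) (e d x)) *\<^sub>R 1)"
      using N_skew[OF section_fibre[OF u] ef] by (simp add: sum_negf)
    also have "\<dots> = frame_coord E e x (N x (u x)) a *\<^sub>R 1"
      unfolding scaleR_sum_left[symmetric] gram_inv_coord[OF c x Nu True] ..
    finally show ?thesis by (simp add: F_def iota_tau[OF True] app_def)
  qed (simp add: F_def iota_tau_outside D_def)
  have F_mom: "F (mom i) = 0" for i
  proof (cases "i < n")
    case True
    define dd where "dd g = chart_deriv (U, \<phi>) i g x" for g
    define uc where "uc a y = frame_coord E e y (u y) a" for a y
    have uc_smooth: "smooth_on E U (uc a)" if "a < r" for a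
      unfolding uc_def by (rule section_coord_smooth[OF u f that])
    have d_comb: "dd (\<lambda>y. \<Sum>a<r. uc a y * g a y) = (\<Sum>a<r. dd (uc a) * g a x + uc a x * dd (g a))"
      if g: "\<And>a. a < r \<Longrightarrow> smooth_on E U (g a)" for g
    proof -
      have "dd (\<lambda>y. \<Sum>a<r. uc a y * g a y) = (\<Sum>a<r. dd (\<lambda>y. uc a y * g a y))"
        unfolding dd_def by (rule chart_deriv_sum[OF ch oU _ x x True])
          (use oU uc_smooth g in \<open>auto intro!: smooth_on_mult\<close>)
      then show ?thesis
        using chart_deriv_mult[OF ch uc_smooth g x x True] by (simp add: dd_def)
    qed
    \<comment> \<open>The derivative of \<open>u\<close> for the connection in which the frame
      \<open>e\<close> is parallel. Constancy of the Gram matrix makes this connection metric, so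
      differentiating the covector components of \<open>u\<close> gives those of
      \<open>w\<close>.\<close>
    define w where "w = (\<Sum>a<r. dd (uc a) *\<^sub>R e a x)"
    have w: "w \<in> fibre E x" unfolding w_def using ef by auto
    have du: "dd (\<lambda>y. metric E y (u y) (e b y)) = metric E x w (e b x)" if b: "b < r" for b
    proof -
      have "dd (\<lambda>y. metric E y (u y) (e b y)) = dd (\<lambda>y. \<Sum>a<r. uc a y * metric E x (e a x) (e b x))"
        unfolding dd_def
      proof (rule chart_deriv_cong[OF ch oU x x True])
        fix y assume y: "y \<in> U"
        have "metric E y (u y) (e b y) = (\<Sum>a<r. uc a y * metric E y (e a y) (e b y))"
          unfolding uc_def
          by (subst (1) frame_expansion[OF fr y section_fibre[OF u]], rule metric_sum)
            (use coord_fibre[OF c y] b in auto)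
        then show "metric E y (u y) (e b y) = (\<Sum>a<r. uc a y * metric E x (e a x) (e b x))"
          using gram_const[OF c y x _ b] by simp
      qed
      also have "\<dots> = (\<Sum>a<r. dd (uc a) * metric E x (e a x) (e b x))"
        using d_comb[of "\<lambda>a _. metric E x (e a x) (e b x)"] smooth_on_const[OF oU] by (simp add: dd_def)
      also have "\<dots> = metric E x w (e b x)"
        unfolding w_def by (rule metric_sum[symmetric]) (use ef b in auto)
      finally show ?thesis .
    qed
    have 1: "D ?c x (iota ?c u x (mom i)) = - flat e x (N x w)"
      using D_flat[OF c x w] du by (simp add: iota_mom[OF True] flat_def dd_def)
    have 2: "iota ?c u x (D ?c x (mom i)) = (\<Sum>b<r. (\<Sum>a<r. uc a x * dd (\<omega> e a b)) *\<^sub>R tau b)"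
    proof -
      have "iota ?c u x (D ?c x (mom i)) =
          (\<Sum>d<r. uc d x *\<^sub>R d_tau_left d ((1 / 2) *\<^sub>R (\<Sum>a<r. \<Sum>b<r. dd (\<omega> e a b) *\<^sub>R (tau a * tau b))))"
      proof -
        have "D ?c x (mom i) = (1 / 2) *\<^sub>R (\<Sum>a<r. \<Sum>b<r. dd (\<omega> e a b) *\<^sub>R (tau a * tau b))"
          using True by (simp add: D_def dd_def)
        then show ?thesis by (simp only: iota_pure[OF quadratic_homogeneous] uc_def)
      qed
      also have "\<dots> = (\<Sum>d<r. uc d x *\<^sub>R (\<Sum>b<r. dd (\<omega> e d b) *\<^sub>R tau b))"
      proof (rule sum.cong[OF refl], rule arg_cong2[of _ _ _ _ scaleR, OF refl])
        fix d assume "d \<in> {..<r}"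
        then show "d_tau_left d ((1 / 2) *\<^sub>R (\<Sum>a<r. \<Sum>b<r. dd (\<omega> e a b) *\<^sub>R (tau a * tau b))) =
            (\<Sum>b<r. dd (\<omega> e d b) *\<^sub>R tau b)"
          unfolding dd_def
          by (intro d_tau_left_quadratic[where A = "\<lambda>a b. chart_deriv (U, \<phi>) i (\<omega> e a b) x"]
              chart_deriv_\<omega>_skew[OF c x True]) simp_all
      qed
      also have "\<dots> = (\<Sum>b<r. (\<Sum>a<r. uc a x * dd (\<omega> e a b)) *\<^sub>R tau b)"
        unfolding scaleR_sum_left scaleR_sum_right by (subst sum.swap) simp
      finally show ?thesis .
    qed
    \<comment> \<open>One summand is \<open>N\<close> applied to \<open>w\<close>, the other the
      derivative of \<open>N\<close> applied to \<open>u\<close>; up to sign these are the terms of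
      \<open>1\<close> and \<open>2\<close>.\<close>
    have dNu: "dd (\<lambda>y. metric E y (app N u y) (e b y)) = (\<Sum>a<r. dd (uc a) * \<omega> e a b x + uc a x * dd (\<omega> e a b))"
      if b: "b < r" for b
    proof -
      have "dd (\<lambda>y. metric E y (app N u y) (e b y)) = dd (\<lambda>y. \<Sum>a<r. uc a y * \<omega> e a b y)"
        unfolding dd_def
      proof (rule chart_deriv_cong[OF ch oU x x True])
        fix y assume y: "y \<in> U"
        show "metric E y (app N u y) (e b y) = (\<Sum>a<r. uc a y * \<omega> e a b y)"
          unfolding uc_def \<omega>_def app_def N_expansion[OF fr y section_fibre[OF u]]
          by (rule metric_sum) (use coord_fibre[OF c y] N_fibre b in auto)
      qed
      then show ?thesis using d_comb[of "\<lambda>a. \<omega> e a b"] \<omega>_smooth[OF f _ b] by simp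
    qed
    have Nw: "flat e x (N x w) = (\<Sum>b<r. (\<Sum>a<r. dd (uc a) * \<omega> e a b x) *\<^sub>R tau b)"
    proof -
      have "N x w = (\<Sum>a<r. dd (uc a) *\<^sub>R N x (e a x))"
        unfolding w_def by (rule N_sum) (use ef in auto)
      moreover have "metric E x (\<Sum>a<r. dd (uc a) *\<^sub>R N x (e a x)) (e b x) = (\<Sum>a<r. dd (uc a) * \<omega> e a b x)"
        if "b < r" for b
        unfolding \<omega>_def by (rule metric_sum) (use ef N_fibre that in auto)
      ultimately show ?thesis by (simp add: flat_def)
    qed
    have "iota ?c (app N u) x (mom i) =
        (\<Sum>b<r. (\<Sum>a<r. dd (uc a) * \<omega> e a b x + uc a x * dd (\<omega> e a b)) *\<^sub>R tau b)"
      unfolding iota_mom[OF True] using dNu by (simp add: dd_def)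
    then show ?thesis
      unfolding F_def 1 2 Nw by (simp add: sum.distrib scaleR_add_left)
  qed (simp add: F_def iota_mom_outside D_def)
  have "F y = 0"
  proof (induction y rule: superpoly_generator_induct)
    case (add y z)
    then show ?case by (simp add: F_def algebra_simps)
  next
    case (scale p y)
    then show ?case by (simp add: F_def flip: scaleR_diff_right scaleR_add_right)
  next
    case one
    then show ?case by (simp add: F_def)
  qed (simp_all add: F_mult F_tau F_mom)
  then show ?thesis by (simp add: F_def algebra_simps)
qed

section \<open>The quadratic element as a graded function\<close>

lemma smooth_super_quadratic:
  assumes "open W" "\<And>a b. a < r \<Longrightarrow> b < r \<Longrightarrow> smooth_on E W (A a b)"
  shows "smooth_super W (\<lambda>x. (1 / 2) *\<^sub>R (\<Sum>a<r. \<Sum>b<r. A a b x *\<^sub>R (tau a * tau b)))"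
  by (intro smooth_super_scale smooth_on_const smooth_super_sum smooth_super.base assms) auto

lemma smooth_super_D:
  assumes c: "(U, \<phi>, e) \<in> coord_systems E" and a: "smooth_super U a"
  shows "smooth_super U (\<lambda>x. D (U, \<phi>, e) x (a x))"
proof -
  note oU = coord_open[OF c] and f = coord_frame[OF c]
  have flat: "smooth_super U (\<lambda>x. \<Sum>b<r. \<omega> e d b x *\<^sub>R tau b)" if "d < r" for d
    by (intro smooth_super_sum smooth_super.base oU \<omega>_smooth[OF f that]) auto
  have B: "smooth_super U (\<lambda>x. - (\<Sum>d<r. gram_inv E e x d b *\<^sub>R flat e x (N x (e d x))))" if "b < r" for b
  \<comment> \<open>A point of \<open>U\<close> is needed at which the inverse Gram matrix can be
    frozen.\<close>
  proof (cases "U = {}")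
    case True
    then show ?thesis by (intro smooth_super.eq_on[OF smooth_super_const[OF oU, of 0]]) simp
  next
    case False
    then obtain x0 where x0: "x0 \<in> U" by auto
    have "smooth_super U (\<lambda>x. - 1 *\<^sub>R (\<Sum>d<r. gram_inv E e x0 d b *\<^sub>R (\<Sum>b<r. \<omega> e d b x *\<^sub>R tau b)))"
      by (intro smooth_super_scale smooth_on_const smooth_super_sum oU flat) auto
    then show ?thesis
      by (rule smooth_super.eq_on) (simp add: flat_def \<omega>_def gram_inv_const[OF c _ x0])
  qed
  show ?thesis
    unfolding D_def superderivation_def prod.case
    by (intro smooth_super.add smooth_super_sum smooth_super_mult oU smooth_super_quadratic
        smooth_super_linear[OF _ linear_d_mom a] smooth_super_linear[OF _ linear_d_tau_left a]
        smooth_on_chart_deriv[OF coord_chart[OF c] oU order_refl \<omega>_smooth[OF f]] B) auto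
qed

lemma endo_form_outside: "c \<notin> coord_systems E \<or> x \<notin> fst c \<Longrightarrow> endo_form c x = 0"
  by (cases c) (auto simp: endo_form_def)

text \<open>For the transformation law both sides are contracted with a section \<open>u\<close>;
  either way the covector of N u results, which \<open>change_flat\<close> knows to be
  covariant.\<close>

lemma endo_form_graded: "endo_form \<in> graded_functions E 2"
proof (rule gradedI)
  fix U \<phi> e assume c: "(U, \<phi>, e) \<in> coord_systems E"
  show "smooth_super U (endo_form (U, \<phi>, e))"
    by (rule smooth_super.eq_on[OF smooth_super_quadratic[OF coord_open[OF c] \<omega>_smooth[OF coord_frame[OF c]]]])
      (auto simp: endo_form_eq[OF c])
  show "endo_form (U, \<phi>, e) x \<in> homogeneous r n 2" if "x \<in> U" for x
    by (rule homogeneous_pure_subset[OF endo_form_pure[OF c that]])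
next
  fix U \<phi> e U' \<phi>' e' x
  assume c: "(U, \<phi>, e) \<in> coord_systems E" and c': "(U', \<phi>', e') \<in> coord_systems E"
    and x: "x \<in> U" "x \<in> U'"
  have "endo_form (U, \<phi>, e) x - change (U, \<phi>, e) (U', \<phi>', e') x (endo_form (U', \<phi>', e') x) = 0"
  proof (rule iota_pure_zeroD[OF c x(1), of _ 1])
    show "endo_form (U, \<phi>, e) x - change (U, \<phi>, e) (U', \<phi>', e') x (endo_form (U', \<phi>', e') x) \<in> homogeneous r 0 (Suc 1)"
      using endo_form_pure[OF c x(1)] change_pure_homogeneous[OF endo_form_pure[OF c' x(2)]]
      by (auto simp: numeral_2_eq_2)
    fix u assume u: "u \<in> sections E"
    note uf = section_fibre[OF u, of x]
    show "iota (U, \<phi>, e) u x (endo_form (U, \<phi>, e) x -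
        change (U, \<phi>, e) (U', \<phi>', e') x (endo_form (U', \<phi>', e') x)) = 0"
      using iota_covariant[OF c c' x u homogeneous_pure_subset[OF endo_form_pure[OF c' x(2)]]]
        iota_endo_form[where u = u, OF c x(1) uf] iota_endo_form[where u = u, OF c' x(2) uf]
        change_flat[OF c c' x N_fibre[OF uf]] by simp
  qed
  then show "endo_form (U, \<phi>, e) x = change (U, \<phi>, e) (U', \<phi>', e') x (endo_form (U', \<phi>', e') x)" by simp
qed (rule endo_form_outside)

lemma bracket_endo_form:
  assumes u: "u \<in> sections E"
  shows "of_section E (app N u) = bracket E (of_section E u) endo_form"
proof (intro ext)
  fix c x
  show "of_section E (app N u) c x = bracket E (of_section E u) endo_form c x"
  proof (cases "c \<in> coord_systems E \<and> x \<in> fst c")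
    case True
    obtain U \<phi> e where cU: "c = (U, \<phi>, e)" by (cases c)
    with True have c: "(U, \<phi>, e) \<in> coord_systems E" "x \<in> U" by auto
    show ?thesis
      unfolding cU bracket_section_left[OF c u] iota_endo_form[where u = u, OF c section_fibre[OF u]]
      by (subst of_section_eq[where u = "app N u", OF c section_fibre[OF app_section[OF u]]])
        (simp add: app_def)
  next
    case False
    then show ?thesis using of_section_outside[of c x] bracket_outside[of c x] by auto
  qed
qed

text \<open>Sections vanishing at \<open>x\<close> with prescribed derivative detect the momenta, which needs a
  nonzero vector in the fibre.\<close>

lemma endo_element_eq:
  assumes r: "0 < r"
  shows "endo_element E N = endo_form"
  unfolding endo_element_def
proof (rule the_equality)
  show "endo_form \<in> graded_functions E 2 \<and>
      (\<forall>u\<in>sections E. of_section E (app N u) = bracket E (of_section E u) endo_form)"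
    using endo_form_graded bracket_endo_form by auto
  fix a assume a: "a \<in> graded_functions E 2 \<and>
      (\<forall>u\<in>sections E. of_section E (app N u) = bracket E (of_section E u) a)"
  show "a = endo_form"
  proof (intro ext)
    fix c x
    show "a c x = endo_form c x"
    proof (cases "c \<in> coord_systems E \<and> x \<in> fst c")
      case True
      obtain U \<phi> e where cU: "c = (U, \<phi>, e)" by (cases c)
      with True have c: "(U, \<phi>, e) \<in> coord_systems E" and x: "x \<in> U" by auto
      note ch = coord_chart[OF c] and f = coord_frame[OF c] and oU = coord_open[OF c]
      let ?y = "a (U, \<phi>, e) x - endo_form (U, \<phi>, e) x"
      have y: "?y \<in> homogeneous r n 2"
        using graded_homogeneous[OF _ c x] a endo_form_graded by auto
      have iota0: "iota (U, \<phi>, e) u x ?y = 0" if u: "u \<in> sections E" for u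
      proof -
        have "bracket E (of_section E u) a (U, \<phi>, e) x = bracket E (of_section E u) endo_form (U, \<phi>, e) x"
          using a u bracket_endo_form[OF u] by metis
        then show ?thesis by (simp add: bracket_section_left[OF c x u])
      qed
      have "d_mom j ?y = 0" if j: "j < n" for j
      proof -
        from section_with_jet[OF f x] obtain g where g: "smooth_on E UNIV g" "g x \<noteq> 0"
          "\<forall>h. (\<forall>a<r. smooth_on E U (h a)) \<longrightarrow>
            (\<lambda>y. if y \<in> U then g y *\<^sub>R (\<Sum>a<r. h a y *\<^sub>R e a y) else 0) \<in> sections E"
          by blast
        \<comment> \<open>Only the frame vector \<open>e 0\<close> is used, which exists in positive
          rank; its coefficient vanishes at \<open>x\<close> and has the single nonzero derivative
          1, in direction \<open>j\<close>.\<close>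
        define h where "h a y = (if a = 0 then \<phi> y j - \<phi> x j else 0)" for a :: nat and y
        have q_smooth: "smooth_on E U (\<lambda>y. \<phi> y j - \<phi> x j)"
          by (intro smooth_on_diff smooth_on_const oU smooth_on_coordinate[OF ch j])
        have "smooth_on E U (h a)" for a
          using q_smooth smooth_on_const[OF oU, of 0] by (cases "a = 0") (simp_all add: h_def[abs_def])
        define u where "u y = (if y \<in> U then g y *\<^sub>R (\<Sum>a<r. h a y *\<^sub>R e a y) else 0)" for y
        have u: "u \<in> sections E"
          unfolding u_def[abs_def] using g(3) \<open>\<And>a. smooth_on E U (h a)\<close> by blast
        have u_eq: "u y = (g y * (\<phi> y j - \<phi> x j)) *\<^sub>R e 0 y" if "y \<in> U" for y
        proof -
          have "(\<Sum>a<r. h a y *\<^sub>R e a y) = (\<Sum>a<r. if a = 0 then (\<phi> y j - \<phi> x j) *\<^sub>R e 0 y else 0)"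
            by (rule sum.cong) (auto simp: h_def)
          then show ?thesis using that r by (simp add: u_def)
        qed
        have du: "chart_deriv (U, \<phi>) i (\<lambda>y. metric E y (u y) (e b y)) x =
            (if i = j then g x * metric E x (e 0 x) (e b x) else 0)" if i: "i < n" and b: "b < r" for i b
        proof -
          have "chart_deriv (U, \<phi>) i (\<lambda>y. metric E y (u y) (e b y)) x =
              chart_deriv (U, \<phi>) i (\<lambda>y. (g y * (\<phi> y j - \<phi> x j)) * metric E x (e 0 x) (e b x)) x"
          proof (rule chart_deriv_cong[OF ch oU x x i])
            fix y assume y: "y \<in> U"
            show "metric E y (u y) (e b y) = g y * (\<phi> y j - \<phi> x j) * metric E x (e 0 x) (e b x)"
              unfolding u_eq[OF y] using metric_scale[OF coord_fibre[OF c y r] coord_fibre[OF c y b]]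
                gram_const[OF c y x r b] by simp
          qed
          also have "\<dots> = chart_deriv (U, \<phi>) i (\<lambda>y. g y * (\<phi> y j - \<phi> x j)) x * metric E x (e 0 x) (e b x)"
            by (rule chart_deriv_cmult[OF ch _ x i])
              (intro smooth_on_mult oU q_smooth smooth_on_subset[OF g(1)], auto)
          also have "chart_deriv (U, \<phi>) i (\<lambda>y. g y * (\<phi> y j - \<phi> x j)) x =
              g x * chart_deriv (U, \<phi>) i (\<lambda>y. \<phi> y j - \<phi> x j) x"
            using chart_deriv_mult[OF ch smooth_on_subset[OF g(1) subset_UNIV] q_smooth x x i] by simp
          also have "chart_deriv (U, \<phi>) i (\<lambda>y. \<phi> y j - \<phi> x j) x = (if i = j then 1 else 0)"
            using chart_deriv_add[OF ch smooth_on_coordinate[OF ch j] smooth_on_const[OF oU] x x i, of "- \<phi> x j"]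
              chart_deriv_coordinate[OF ch x i, of j] by simp
          finally show ?thesis by simp
        qed
        have ux: "u x = 0" unfolding u_eq[OF x] by simp
        have fc0: "frame_coord E e x (u x) b = 0" if "b < r" for b
          using frame_coord_linear[OF frame[OF f] x fibre_0 fibre_0 that, of 0 0] by (simp add: ux)
        \<comment> \<open>The value of \<open>u\<close> at \<open>x\<close> is 0, so the
          \<open>d_tau_left\<close> part disappears and the contraction becomes a covector times one
          momentum derivative.\<close>
        have "iota (U, \<phi>, e) u x ?y =
            (\<Sum>i<n. (\<Sum>b<r. (if i = j then g x * metric E x (e 0 x) (e b x) else 0) *\<^sub>R tau b) * d_mom i ?y)"
          using fc0 du by (simp add: iota_def superderivation_def)
        also have "\<dots> = (\<Sum>i<n. if i = j then (g x *\<^sub>R flat e x (e 0 x)) * d_mom j ?y else 0)"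
          by (rule sum.cong) (auto simp: flat_def scaleR_sum_right)
        also have "\<dots> = (g x *\<^sub>R flat e x (e 0 x)) * d_mom j ?y" using j by simp
        finally have 0: "g x *\<^sub>R (flat e x (e 0 x) * d_mom j ?y) = 0" using iota0[OF u] by simp
        have "d_mom j ?y \<in> homogeneous r n 0" using y by (intro homogeneous_d_mom) (simp add: numeral_2_eq_2)
        \<comment> \<open>In degree 2 the coefficient of a momentum is a number, so a nonzero
          covector in front of it detects it.\<close>
        then obtain k where k: "d_mom j ?y = k *\<^sub>R 1" using homogeneous_0_eq by blast
        have "flat e x (e 0 x) \<noteq> 0"
        proof
          assume "flat e x (e 0 x) = 0"
          then have "flat e x (e 0 x) = flat e x 0"
            using flat_linear[OF c x fibre_0 fibre_0, of 0 0] by simp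
          then have "e 0 x = 0" by (rule flat_inj[OF c x coord_fibre[OF c x r] fibre_0])
          then show False
            using frame_coord_frame[OF frame[OF f] x r r]
              frame_coord_linear[OF frame[OF f] x fibre_0 fibre_0 r, of 0 0] by simp
        qed
        then show ?thesis using 0 g(2) unfolding k by simp
      qed
      then have "?y \<in> homogeneous r 0 2" by (rule homogeneous_pureI[OF y])
      then have "?y = 0"
        by (intro iota_pure_zeroD[OF c x _ iota0, of 1]) (auto simp: numeral_2_eq_2)
      then show ?thesis by (simp add: cU)
    next
      case False
      then show ?thesis using graded_zero[of a 2 c x] a endo_form_outside[of c x] by auto
    qed
  qed
qed

end

section \<open>The element generating the torsion\<close>

locale courant_endomorphism = skew_endomorphism E N
  for E :: "('m::{t2_space,second_countable_topology}, 'v::real_vector, 'z) metric_bundle_scheme"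
    and N :: "'m \<Rightarrow> 'v \<Rightarrow> 'v" +
  fixes \<Theta> :: "('m, 'v) graded_function" and l :: real
  assumes \<Theta>: "\<Theta> \<in> graded_functions E 3"
    and square: "\<And>x v. v \<in> fibre E x \<Longrightarrow> N x (N x v) = l *\<^sub>R v"
begin

definition torsion_form :: "('m, 'v) graded_function" where
  "torsion_form = (\<lambda>c x. - (1 / 2) *\<^sub>R (bracket E (bracket E endo_form \<Theta>) endo_form c x + l *\<^sub>R \<Theta> c x))"

lemma D_square:
  assumes c: "(U, \<phi>, e) \<in> coord_systems E" and x: "x \<in> U" and y: "y \<in> homogeneous r n (Suc 0)"
  shows "D (U, \<phi>, e) x (D (U, \<phi>, e) x y) = l *\<^sub>R y"
proof -
  obtain v where v: "v \<in> fibre E x" "y = flat e x v" using homogeneous_1_flat[OF c x y] .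
  have "D (U, \<phi>, e) x (D (U, \<phi>, e) x y) = flat e x (l *\<^sub>R v)"
    using D_flat[OF c x v(1)] D_flat[OF c x N_fibre[OF v(1)]] square[OF v(1)] by (simp add: v(2))
  also have "\<dots> = l *\<^sub>R y"
    using flat_linear[OF c x v(1) v(1), of l 0] by (simp add: v(2))
  finally show ?thesis .
qed

lemma torsion_form_eq:
  assumes c: "(U, \<phi>, e) \<in> coord_systems E" and x: "x \<in> U"
  shows "torsion_form (U, \<phi>, e) x = (1 / 2) *\<^sub>R
    (D (U, \<phi>, e) x (D (U, \<phi>, e) x (\<Theta> (U, \<phi>, e) x)) - l *\<^sub>R \<Theta> (U, \<phi>, e) x)"
proof -
  have "parity (bracket E endo_form \<Theta> (U, \<phi>, e) x) = - bracket E endo_form \<Theta> (U, \<phi>, e) x"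
    using homogeneous_parity[OF D_homogeneous[OF graded_homogeneous[OF \<Theta> c x], of "(U, \<phi>, e)" x]]
    by (simp add: bracket_endo_left[OF c x])
  from bracket_endo_right[where a = "bracket E endo_form \<Theta>", OF c x this] show ?thesis
    by (simp add: torsion_form_def bracket_endo_left[OF c x] algebra_simps)
qed

lemma torsion_form_pure:
  assumes c: "(U, \<phi>, e) \<in> coord_systems E" and x: "x \<in> U"
  shows "torsion_form (U, \<phi>, e) x \<in> homogeneous r 0 3"
proof (rule homogeneous_pureI)
  note \<theta> = graded_homogeneous[OF \<Theta> c x]
  show "torsion_form (U, \<phi>, e) x \<in> homogeneous r n 3"
    unfolding torsion_form_eq[OF c x]
    by (intro homogeneous_scale homogeneous_diff D_homogeneous \<theta>)
  fix i
  have "d_mom i (\<Theta> (U, \<phi>, e) x) \<in> homogeneous r n (Suc 0)"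
    using \<theta> by (intro homogeneous_d_mom) (simp add: numeral_3_eq_3)
  from D_square[OF c x this] show "d_mom i (torsion_form (U, \<phi>, e) x) = 0"
    unfolding torsion_form_eq[OF c x] by (simp add: D_d_mom)
qed

text \<open>The contraction sees the first derivatives of N N u, so it matters that \<open>l\<close>
  is a constant and not a function.\<close>

lemma square_section:
  assumes c: "(U, \<phi>, e) \<in> coord_systems E" and x: "x \<in> U" and u: "u \<in> sections E"
  shows "iota (U, \<phi>, e) (app N (app N u)) x y = l *\<^sub>R iota (U, \<phi>, e) u x y"
proof -
  have eq: "app N (app N u) = (\<lambda>x. l *\<^sub>R u x)"
    unfolding app_def using square section_fibre[OF u] by blast
  note ch = coord_chart[OF c] and f = coord_frame[OF c]
  have uf: "u y \<in> fibre E y" for y by (rule section_fibre[OF u])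
  have "frame_coord E e x (l *\<^sub>R u x) b = l * frame_coord E e x (u x) b" if "b < r" for b
    using frame_coord_linear[OF frame[OF f] x uf uf that, of l 0] by simp
  moreover have "chart_deriv (U, \<phi>) i (\<lambda>y. metric E y (l *\<^sub>R u y) (e b y)) x =
      l * chart_deriv (U, \<phi>) i (\<lambda>y. metric E y (u y) (e b y)) x" if i: "i < n" and b: "b < r" for i b
  proof -
    have "chart_deriv (U, \<phi>) i (\<lambda>y. metric E y (l *\<^sub>R u y) (e b y)) x =
        chart_deriv (U, \<phi>) i (\<lambda>y. metric E y (u y) (e b y) * l) x"
      by (rule chart_deriv_cong[OF ch coord_open[OF c] x x i])
        (use metric_scale[OF uf coord_fibre[OF c _ b]] in simp)
    then show ?thesis
      using chart_deriv_cmult[OF ch metric_section_smooth[OF u f b] x i, of l] by simp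
  qed
  ultimately show ?thesis
    unfolding eq by (simp add: iota_def superderivation_def scaleR_sum_right sum_distrib_right scaleR_add_right)
qed

lemma torsion_section:
  assumes u: "u \<in> sections E" and v: "v \<in> sections E"
  shows "torsion E \<Theta> N u v \<in> sections E"
proof -
  have diff: "(\<lambda>x. s x - t x) \<in> sections E" if "s \<in> sections E" "t \<in> sections E" for s t
    using section_combination[OF that smooth_on_const smooth_on_const, of 1 "-1"] by simp
  have add: "(\<lambda>x. s x + t x) \<in> sections E" if "s \<in> sections E" "t \<in> sections E" for s t
    using section_combination[OF that smooth_on_const smooth_on_const, of 1 1] by simp
  show ?thesis
    unfolding torsion_def dorfman_twisted_def
    by (intro diff add app_section dorfman_section(1)[OF \<Theta>] u v)
qed

text \<open>With \<open>b(u, v) = - \<iota>\<^sub>v \<iota>\<^sub>u \<Theta>\<close> the bracket and \<open>[D, \<iota>\<^sub>u] = - \<iota>\<^bsub>N u\<^esub>\<close>, moving both copies of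
  \<open>D\<close> to the left of \<open>\<iota>\<^sub>v \<iota>\<^sub>u\<close> turns \<open>\<iota>\<^sub>v \<iota>\<^sub>u D\<^sup>2 \<Theta>\<close> into the four terms of the torsion.\<close>

lemma torsion_flat:
  assumes c: "(U, \<phi>, e) \<in> coord_systems E" and x: "x \<in> U" and u: "u \<in> sections E" and v: "v \<in> sections E"
  shows "flat e x (torsion E \<Theta> N u v x) =
    - iota (U, \<phi>, e) v x (iota (U, \<phi>, e) u x (torsion_form (U, \<phi>, e) x))"
proof -
  define I I' J J' where "I = iota (U, \<phi>, e) u x" and "I' = iota (U, \<phi>, e) (app N u) x"
    and "J = iota (U, \<phi>, e) v x" and "J' = iota (U, \<phi>, e) (app N v) x"
  define d where "d = D (U, \<phi>, e) x"
  define \<theta> where "\<theta> = \<Theta> (U, \<phi>, e) x"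
  note Nu = app_section[OF u] and Nv = app_section[OF v]
  have lin: "linear I" "linear I'" "linear J" "linear J'" "linear d"
    unfolding I_def I'_def J_def J'_def d_def by (rule linear_iota linear_D)+
  note lins = linear_add[OF lin(1)] linear_add[OF lin(2)] linear_add[OF lin(3)] linear_add[OF lin(4)]
    linear_add[OF lin(5)] linear_scale[OF lin(1)] linear_scale[OF lin(2)] linear_scale[OF lin(3)]
    linear_scale[OF lin(4)] linear_scale[OF lin(5)] linear_diff[OF lin(1)] linear_diff[OF lin(2)]
    linear_diff[OF lin(3)] linear_diff[OF lin(4)] linear_diff[OF lin(5)]
    linear_neg[OF lin(5)]
  have ID: "I (d y) = d (I y) + I' y" and I'D: "I' (d y) = d (I' y) + l *\<^sub>R I y"
    and JD: "J (d y) = d (J y) + J' y" and J'D: "J' (d y) = d (J' y) + l *\<^sub>R J y" for y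
    using commutator[OF c x u] commutator[OF c x Nu] commutator[OF c x v] commutator[OF c x Nv]
      square_section[OF c x u] square_section[OF c x v]
    by (simp_all add: I_def I'_def J_def J'_def d_def)
  have \<theta>: "\<theta> \<in> homogeneous r n (Suc (Suc (Suc 0)))"
    unfolding \<theta>_def using graded_homogeneous[OF \<Theta> c x] by (simp add: numeral_3_eq_3)
  \<comment> \<open>Two contractions bring \<Theta> down to degree 1, where \<open>D_square\<close>
    applies.\<close>
  have dd: "d (d (J (I \<theta>))) = l *\<^sub>R J (I \<theta>)"
    unfolding d_def J_def I_def by (rule D_square[OF c x]) (intro iota_homogeneous \<theta>)
  \<comment> \<open>Each mixed term occurs twice. Of the three multiples of
    \<open>J (I \<theta>)\<close> one is \<open>dd\<close> and two come from the square of
    \<open>N\<close> in \<open>I'D\<close> and \<open>J'D\<close>; subtracting \<open>l\<close>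
    times \<Theta> cancels one, and half of the rest matches the torsion.\<close>
  have "J (I (d (d \<theta>))) = 2 *\<^sub>R (l *\<^sub>R J (I \<theta>) + d (J' (I \<theta>)) + d (J (I' \<theta>)) + J' (I' \<theta>)) + l *\<^sub>R J (I \<theta>)"
    by (simp add: ID I'D JD J'D lins dd algebra_simps scaleR_2) (simp flip: scaleR_add_left)
  then have "- J (I (torsion_form (U, \<phi>, e) x)) =
      - J' (I' \<theta>) - d (J (I' \<theta>) + J' (I \<theta>)) - l *\<^sub>R J (I \<theta>)"
    unfolding torsion_form_eq[OF c x] d_def[symmetric] \<theta>_def[symmetric]
    by (simp add: lins algebra_simps)
  also have "\<dots> = flat e x (torsion E \<Theta> N u v x)"
  proof -
    have fl: "flat e x (s + t) = flat e x s + flat e x t" "flat e x (s - t) = flat e x s - flat e x t"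
      if "s \<in> fibre E x" "t \<in> fibre E x" for s t
      using flat_linear[OF c x that, of 1 1] flat_linear[OF c x that, of 1 "-1"] by simp_all
    define b1 b2 b3 b4 where "b1 = dorfman E \<Theta> (app N u) (app N v) x" and "b2 = dorfman E \<Theta> (app N u) v x"
      and "b3 = dorfman E \<Theta> u (app N v) x" and "b4 = dorfman E \<Theta> u v x"
    have bf: "b1 \<in> fibre E x" "b2 \<in> fibre E x" "b3 \<in> fibre E x" "b4 \<in> fibre E x"
      unfolding b1_def b2_def b3_def b4_def
      using dorfman_section(1)[OF \<Theta>] u v Nu Nv section_fibre by blast+
    have fb: "flat e x b1 = - J' (I' \<theta>)" "flat e x b2 = - J (I' \<theta>)" "flat e x b3 = - J' (I \<theta>)"
      "flat e x b4 = - J (I \<theta>)"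
      unfolding b1_def b2_def b3_def b4_def I_def I'_def J_def J'_def \<theta>_def
      using dorfman_flat[OF \<Theta> c x] u v Nu Nv by auto
    have fN: "flat e x (N x w) = - d (flat e x w)" if "w \<in> fibre E x" for w
      using D_flat[OF c x that] by (simp add: d_def)
    have "torsion E \<Theta> N u v x = b1 - N x (b2 + b3 - N x b4)"
      by (simp add: torsion_def dorfman_twisted_def app_def b1_def b2_def b3_def b4_def)
    also have "flat e x \<dots> = flat e x b1 + d (flat e x b2 + flat e x b3 + d (flat e x b4))"
      using bf N_fibre by (simp add: fl fN fibre_add fibre_diff)
    finally show ?thesis
      unfolding fb by (simp add: lins dd algebra_simps)
  qed
  finally show ?thesis by (simp add: I_def J_def)
qed

lemma torsion_form_outside: "c \<notin> coord_systems E \<or> x \<notin> fst c \<Longrightarrow> torsion_form c x = 0"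
  using graded_zero[OF \<Theta>] bracket_outside by (simp add: torsion_form_def)

lemma triple_iota_tors:
  assumes c: "(U, \<phi>, e) \<in> coord_systems E" and x: "x \<in> U"
    and u: "u \<in> sections E" and v: "v \<in> sections E" and w: "w \<in> sections E"
  shows "iota (U, \<phi>, e) w x (iota (U, \<phi>, e) v x (iota (U, \<phi>, e) u x (torsion_form (U, \<phi>, e) x))) =
    - torsion_tensor E \<Theta> N u v w x *\<^sub>R 1"
proof -
  note Tf = section_fibre[OF torsion_section[OF u v], of x] and wf = section_fibre[OF w, of x]
  have "iota (U, \<phi>, e) w x (flat e x (torsion E \<Theta> N u v x)) = torsion_tensor E \<Theta> N u v w x *\<^sub>R 1"
    using iota_flat[where u = w, OF c x wf Tf] metric_sym[OF wf Tf] by (simp add: torsion_tensor_def)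
  then show ?thesis unfolding torsion_flat[OF c x u v] by (simp add: minus_equation_iff)
qed

text \<open>The triple contraction is the scalar \<open>torsion_tensor\<close>, the same in all
  coordinate systems, and it determines a cubic form without momenta. So the transformation law
  holds although it is not checked on the double bracket itself.\<close>

lemma torsion_form_graded: "torsion_form \<in> graded_functions E 3"
proof (rule gradedI)
  fix U \<phi> e assume c: "(U, \<phi>, e) \<in> coord_systems E"
  note oU = coord_open[OF c] and s = graded_smooth[OF \<Theta> c]
  have "smooth_super U (\<lambda>x. (1 / 2) *\<^sub>R (D (U, \<phi>, e) x (D (U, \<phi>, e) x (\<Theta> (U, \<phi>, e) x)) + (- l) *\<^sub>R \<Theta> (U, \<phi>, e) x))"
    by (intro smooth_super_scale smooth_on_const smooth_super.add smooth_super_D[OF c] s oU)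
  then show "smooth_super U (torsion_form (U, \<phi>, e))"
    by (rule smooth_super.eq_on) (simp add: torsion_form_eq[OF c])
  show "torsion_form (U, \<phi>, e) x \<in> homogeneous r n 3" if "x \<in> U" for x
    by (rule homogeneous_pure_subset[OF torsion_form_pure[OF c that]])
next
  fix U \<phi> e U' \<phi>' e' x
  assume c: "(U, \<phi>, e) \<in> coord_systems E" and c': "(U', \<phi>', e') \<in> coord_systems E"
    and x: "x \<in> U" "x \<in> U'"
  have "torsion_form (U, \<phi>, e) x - change (U, \<phi>, e) (U', \<phi>', e') x (torsion_form (U', \<phi>', e') x) = 0"
  proof (rule pure_cubic_zeroI[OF c x(1)])
    show "torsion_form (U, \<phi>, e) x - change (U, \<phi>, e) (U', \<phi>', e') x (torsion_form (U', \<phi>', e') x) \<in> homogeneous r 0 3"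
      using torsion_form_pure[OF c x(1)] change_pure_homogeneous[OF torsion_form_pure[OF c' x(2)]] by auto
    fix u v w assume u: "u \<in> sections E" and v: "v \<in> sections E" and w: "w \<in> sections E"
    have h: "torsion_form (U', \<phi>', e') x \<in> homogeneous r n (Suc (Suc (Suc 0)))"
      using homogeneous_pure_subset[OF torsion_form_pure[OF c' x(2)]] by (simp add: numeral_3_eq_3)
    have "iota (U, \<phi>, e) w x (iota (U, \<phi>, e) v x (iota (U, \<phi>, e) u x
        (change (U, \<phi>, e) (U', \<phi>', e') x (torsion_form (U', \<phi>', e') x)))) =
        change (U, \<phi>, e) (U', \<phi>', e') x
          (iota (U', \<phi>', e') w x (iota (U', \<phi>', e') v x (iota (U', \<phi>', e') u x (torsion_form (U', \<phi>', e') x))))"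
      unfolding iota_covariant[OF c c' x u h, symmetric]
        iota_covariant[OF c c' x v iota_homogeneous[OF h], symmetric]
        iota_covariant[OF c c' x w iota_homogeneous[OF iota_homogeneous[OF h]], symmetric] ..
    also have "\<dots> = - torsion_tensor E \<Theta> N u v w x *\<^sub>R 1"
      unfolding triple_iota_tors[OF c' x(2) u v w] by simp
    finally show "iota (U, \<phi>, e) w x (iota (U, \<phi>, e) v x (iota (U, \<phi>, e) u x
        (torsion_form (U, \<phi>, e) x - change (U, \<phi>, e) (U', \<phi>', e') x (torsion_form (U', \<phi>', e') x)))) = 0"
      using triple_iota_tors[OF c x(1) u v w] by simp
  qed
  then show "torsion_form (U, \<phi>, e) x = change (U, \<phi>, e) (U', \<phi>', e') x (torsion_form (U', \<phi>', e') x)" by simp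
qed (rule torsion_form_outside)

lemma of_section_torsion:
  assumes u: "u \<in> sections E" and v: "v \<in> sections E"
  shows "of_section E (torsion E \<Theta> N u v) = bracket E (bracket E (of_section E u) torsion_form) (of_section E v)"
proof (intro ext)
  fix c x
  show "of_section E (torsion E \<Theta> N u v) c x = bracket E (bracket E (of_section E u) torsion_form) (of_section E v) c x"
  proof (cases "c \<in> coord_systems E \<and> x \<in> fst c")
    case True
    obtain U \<phi> e where cU: "c = (U, \<phi>, e)" by (cases c)
    with True have c: "(U, \<phi>, e) \<in> coord_systems E" "x \<in> U" by auto
    show ?thesis
      unfolding cU bracket_twice[OF torsion_form_graded u v] bracket_section_left[OF c u] bracket_section_left[OF c v]
        torsion_flat[OF c u v, symmetric]
      by (rule of_section_eq[where u = "torsion E \<Theta> N u v", OF c section_fibre[OF torsion_section[OF u v]]])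
  next
    case False
    then show ?thesis using of_section_outside[of c x] bracket_outside[of c x] by auto
  qed
qed

lemma represents_tors: "represents_3_tensor E (torsion_tensor E \<Theta> N) torsion_form"
  unfolding represents_3_tensor_def
proof (intro conjI ballI allI impI torsion_form_graded)
  fix c x I \<mu> assume nz: "coeff (torsion_form c x) (I, \<mu>) \<noteq> 0"
  obtain U \<phi> e where cU: "c = (U, \<phi>, e)" by (cases c)
  have "(U, \<phi>, e) \<in> coord_systems E \<and> x \<in> U"
  proof (rule ccontr)
    assume "\<not> ?thesis"
    then have "torsion_form c x = 0" using torsion_form_outside[of c x] by (simp add: cU)
    then show False using nz by simp
  qed
  then show "\<mu> = {#}" using torsion_form_pure[of U \<phi> e x] nz by (simp add: cU homogeneous_def)
next
  fix u v w assume uvw: "u \<in> sections E" "v \<in> sections E" "w \<in> sections E"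
  show "bracket E (bracket E (bracket E (of_section E u) torsion_form) (of_section E v)) (of_section E w) =
      of_fun E (torsion_tensor E \<Theta> N u v w)"
  proof (intro ext)
    fix c x
    show "bracket E (bracket E (bracket E (of_section E u) torsion_form) (of_section E v)) (of_section E w) c x =
      of_fun E (torsion_tensor E \<Theta> N u v w) c x"
    proof (cases "c \<in> coord_systems E \<and> x \<in> fst c")
      case True
      obtain U \<phi> e where cU: "c = (U, \<phi>, e)" by (cases c)
      with True have c: "(U, \<phi>, e) \<in> coord_systems E" "x \<in> U" by auto
      show ?thesis
        unfolding cU bracket_thrice[OF c torsion_form_graded uvw] triple_iota_tors[OF c uvw]
        using c by (simp add: of_fun_def)
    next
      case False
      then show ?thesis using bracket_outside[of c x] by (auto simp: of_fun_def)
    qed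
  qed
qed

lemma torsion_element_eq: "torsion_element E \<Theta> N = torsion_form"
  unfolding torsion_element_def tensor_element_def
  using represents_tors represents_unique by blast

section \<open>Tensoriality and skew-symmetry\<close>

lemma flat_eqI:
  assumes "\<And>U \<phi> e. (U, \<phi>, e) \<in> coord_systems E \<Longrightarrow> x \<in> U \<Longrightarrow> flat e x s = flat e x t"
    and "s \<in> fibre E x" "t \<in> fibre E x"
  shows "s = t"
proof -
  obtain U \<phi> e where c: "(U, \<phi>, e) \<in> coord_systems E" "x \<in> U" using coord_system_exists[of x] .
  from flat_inj[OF c assms(2,3) assms(1)[OF c]] show ?thesis .
qed

lemma torsion_linear_left:
  assumes u: "u \<in> sections E" and u': "u' \<in> sections E" and v: "v \<in> sections E"
    and f: "f \<in> smooth_functions E" and h: "h \<in> smooth_functions E"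
  shows "torsion E \<Theta> N (\<lambda>x. f x *\<^sub>R u x + h x *\<^sub>R u' x) v x =
    f x *\<^sub>R torsion E \<Theta> N u v x + h x *\<^sub>R torsion E \<Theta> N u' v x"
proof -
  let ?w = "\<lambda>x. f x *\<^sub>R u x + h x *\<^sub>R u' x"
  have w: "?w \<in> sections E"
    using section_combination[OF u u'] f h by (simp add: smooth_functions_def)
  note Tf = section_fibre[OF torsion_section[OF u v]] and T'f = section_fibre[OF torsion_section[OF u' v]]
  show ?thesis
  proof (rule flat_eqI[OF _ section_fibre[OF torsion_section[OF w v]]])
    show "f x *\<^sub>R torsion E \<Theta> N u v x + h x *\<^sub>R torsion E \<Theta> N u' v x \<in> fibre E x"
      using Tf T'f by auto
    fix U \<phi> e assume c: "(U, \<phi>, e) \<in> coord_systems E" "x \<in> U"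
    have "iota (U, \<phi>, e) ?w x (torsion_form (U, \<phi>, e) x) =
        f x *\<^sub>R iota (U, \<phi>, e) u x (torsion_form (U, \<phi>, e) x) + h x *\<^sub>R iota (U, \<phi>, e) u' x (torsion_form (U, \<phi>, e) x)"
      by (rule iota_tensorial[where w = ?w and u = u and v = u', OF c torsion_form_pure[OF c] refl section_fibre[OF u] section_fibre[OF u']])
    then show "flat e x (torsion E \<Theta> N ?w v x) =
        flat e x (f x *\<^sub>R torsion E \<Theta> N u v x + h x *\<^sub>R torsion E \<Theta> N u' v x)"
      unfolding flat_linear[OF c Tf T'f] torsion_flat[OF c w v] torsion_flat[OF c u v] torsion_flat[OF c u' v]
      by (simp add: algebra_simps)
  qed
qed

text \<open>The Dorfman bracket is not skew because \<Theta> contains momenta;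
  \<open>torsion_form\<close> contains none, so the two contractions anticommute.\<close>

lemma torsion_skew:
  assumes u: "u \<in> sections E" and v: "v \<in> sections E"
  shows "torsion E \<Theta> N v u x = - torsion E \<Theta> N u v x"
proof (rule flat_eqI)
  note Tf = section_fibre[OF torsion_section[OF u v], of x]
  show "torsion E \<Theta> N v u x \<in> fibre E x" by (rule section_fibre[OF torsion_section[OF v u]])
  show "- torsion E \<Theta> N u v x \<in> fibre E x" using fibre_scale[OF Tf, of "- 1"] by simp
  fix U \<phi> e assume c: "(U, \<phi>, e) \<in> coord_systems E" "x \<in> U"
  have p: "torsion_form (U, \<phi>, e) x \<in> homogeneous r 0 (Suc 2)" using torsion_form_pure[OF c] by simp
  show "flat e x (torsion E \<Theta> N v u x) = flat e x (- torsion E \<Theta> N u v x)"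
    using flat_linear[OF c Tf Tf, of "- 1" 0] torsion_flat[OF c u v] torsion_flat[OF c v u]
      iota_pure_anticommute[where u = u and v = v, OF p]
    by simp
qed

text \<open>The second equation comes from exchanging the last two contractions, which act on the
  momentum-free contraction of \<open>torsion_form\<close> with \<open>u\<close>.\<close>

lemma torsion_tensor_skew:
  assumes u: "u \<in> sections E" and v: "v \<in> sections E" and w: "w \<in> sections E"
  shows "torsion_tensor E \<Theta> N v u w x = - torsion_tensor E \<Theta> N u v w x"
    and "torsion_tensor E \<Theta> N u w v x = - torsion_tensor E \<Theta> N u v w x"
proof -
  note Tf = section_fibre[OF torsion_section[OF u v], of x]
  show "torsion_tensor E \<Theta> N v u w x = - torsion_tensor E \<Theta> N u v w x"
    unfolding torsion_tensor_def torsion_skew[OF u v]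
    using metric_scale[OF Tf section_fibre[OF w], of "- 1"] by simp
  obtain U \<phi> e where c: "(U, \<phi>, e) \<in> coord_systems E" "x \<in> U" using coord_system_exists[of x] .
  have p: "torsion_form (U, \<phi>, e) x \<in> homogeneous r 0 (Suc (Suc (Suc 0)))"
    using torsion_form_pure[OF c] by (simp add: numeral_3_eq_3)
  have "torsion_tensor E \<Theta> N u w v x *\<^sub>R (1 :: superpoly) = (- torsion_tensor E \<Theta> N u v w x) *\<^sub>R 1"
    using triple_iota_tors[OF c u v w] triple_iota_tors[OF c u w v]
      iota_pure_anticommute[where u = v and v = w, OF iota_pure_homogeneous[OF p]] by simp
  then show "torsion_tensor E \<Theta> N u w v x = - torsion_tensor E \<Theta> N u v w x"
    unfolding scaleR_cancel_right by simp
qed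

lemma torsion_tensor_skew_3_tensor: "is_skew_3_tensor E (torsion_tensor E \<Theta> N)"
  unfolding is_skew_3_tensor_def
proof (intro conjI ballI allI)
  fix u v w x assume u: "u \<in> sections E" and v: "v \<in> sections E" and w: "w \<in> sections E"
  show "torsion_tensor E \<Theta> N u v w \<in> smooth_functions E"
    unfolding torsion_tensor_def smooth_functions_def
    using metric_sections_smooth[OF torsion_section[OF u v] w] by simp
  show "torsion_tensor E \<Theta> N v u w x = - torsion_tensor E \<Theta> N u v w x"
    "torsion_tensor E \<Theta> N u w v x = - torsion_tensor E \<Theta> N u v w x"
    by (rule torsion_tensor_skew[OF u v w])+
next
  fix u u' v w f h x
  assume u: "u \<in> sections E" and u': "u' \<in> sections E" and v: "v \<in> sections E" and w: "w \<in> sections E"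
    and f: "f \<in> smooth_functions E" and h: "h \<in> smooth_functions E"
  show "torsion_tensor E \<Theta> N (\<lambda>y. f y *\<^sub>R u y + h y *\<^sub>R u' y) v w x =
      f x * torsion_tensor E \<Theta> N u v w x + h x * torsion_tensor E \<Theta> N u' v w x"
    unfolding torsion_tensor_def torsion_linear_left[OF u u' v f h]
    by (rule metric_linear[OF section_fibre[OF torsion_section[OF u v]]
          section_fibre[OF torsion_section[OF u' v]] section_fibre[OF w]])
qed

text \<open>In rank 0 the quadratic element need not be unique, and \<open>endo_element\<close> is
  then unspecified. Both sides vanish there because \<Theta> does.\<close>

lemma torsion_form_endo_element: "torsion_form = (\<lambda>c x. - (1 / 2) *\<^sub>R
    (bracket E (bracket E (endo_element E N) \<Theta>) (endo_element E N) c x + l *\<^sub>R \<Theta> c x))"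
proof (cases "r = 0")
  case False
  then show ?thesis by (simp add: torsion_form_def endo_element_eq)
next
  case True
  have \<Theta>0: "\<Theta> = (\<lambda>c x. 0)"
  proof (intro ext)
    fix c x
    show "\<Theta> c x = 0"
    proof (cases "c \<in> coord_systems E \<and> x \<in> fst c")
      case True
      obtain U \<phi> e where cU: "c = (U, \<phi>, e)" by (cases c)
      with True have c: "(U, \<phi>, e) \<in> coord_systems E" "x \<in> U" by auto
      have "coeff (\<Theta> c x) (I, \<mu>) = 0" for I \<mu>
      proof (rule ccontr)
        assume "coeff (\<Theta> c x) (I, \<mu>) \<noteq> 0"
        then have "fset I \<subseteq> {..<r}" "fcard I + 2 * size \<mu> = 3"
          using graded_homogeneous[OF \<Theta> c] by (auto simp: homogeneous_def cU)
        moreover from this have "fcard I = 0" using \<open>r = 0\<close> by (simp add: fcard.rep_eq)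
        \<comment> \<open>Without odd variables every degree is even.\<close>
        ultimately have "2 * size \<mu> = 3" by simp
        then show False by presburger
      qed
      then show ?thesis by (auto intro: superpoly_eqI)
    next
      case False
      then show ?thesis using graded_zero[OF \<Theta>] by blast
    qed
  qed
  \<comment> \<open>For every \<open>a\<close>, since no property of \<open>endo_element\<close> is
    at hand here.\<close>
  have "bracket E (bracket E a (\<lambda>c x. 0)) a = (\<lambda>c x. 0)" for a
  proof -
    have z: "d_base (U, \<phi>) i (\<lambda>x. 0) x = 0" for U \<phi> i x
      by (simp add: d_base_def zero_superpoly_def)
    have "bracket E a (\<lambda>c x. 0) = (\<lambda>c x. 0)" for a
      by (intro ext) (simp add: bracket_def Let_def z split: prod.split)
    moreover have "bracket E (\<lambda>c x. 0) a = (\<lambda>c x. 0)" for a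
      by (intro ext) (simp add: bracket_def Let_def z split: prod.split)
    ultimately show ?thesis by simp
  qed
  then show ?thesis unfolding torsion_form_def by (simp add: \<Theta>0)
qed

end

theorem theorem3p6:
  fixes E :: "('m::{t2_space,second_countable_topology}, 'v::real_vector) metric_bundle"
    and \<Theta> :: "('m, 'v) graded_function"
    and N :: "'m \<Rightarrow> 'v \<Rightarrow> 'v"
    and l :: real
  assumes "is_metric_bundle E"
    and "is_courant E \<Theta>"
    and "is_endomorphism E N"
    and "is_skew E N"
    and "proportional_to_almost_cps E N"
    and "\<forall>x. \<forall>v\<in>fibre E x. N x (N x v) = l *\<^sub>R v"
  shows
    "(\<forall>u\<in>sections E. \<forall>v\<in>sections E. torsion E \<Theta> N u v \<in> sections E) \<and>
     (\<forall>u\<in>sections E. \<forall>u'\<in>sections E. \<forall>v\<in>sections E.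
        \<forall>f\<in>smooth_functions E. \<forall>h\<in>smooth_functions E.
        torsion E \<Theta> N (\<lambda>x. f x *\<^sub>R u x + h x *\<^sub>R u' x) v =
          (\<lambda>x. f x *\<^sub>R torsion E \<Theta> N u v x + h x *\<^sub>R torsion E \<Theta> N u' v x)) \<and>
     (\<forall>u\<in>sections E. \<forall>v\<in>sections E. \<forall>v'\<in>sections E.
        \<forall>f\<in>smooth_functions E. \<forall>h\<in>smooth_functions E.
        torsion E \<Theta> N u (\<lambda>x. f x *\<^sub>R v x + h x *\<^sub>R v' x) =
          (\<lambda>x. f x *\<^sub>R torsion E \<Theta> N u v x + h x *\<^sub>R torsion E \<Theta> N u v' x)) \<and>
     (\<forall>u\<in>sections E. \<forall>v\<in>sections E. torsion E \<Theta> N v u = (\<lambda>x. - torsion E \<Theta> N u v x)) \<and>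
     is_skew_3_tensor E (torsion_tensor E \<Theta> N) \<and>
     (\<exists>!a. represents_3_tensor E (torsion_tensor E \<Theta> N) a) \<and>
     (\<forall>u\<in>sections E. \<forall>v\<in>sections E.
        of_section E (torsion E \<Theta> N u v) =
          bracket E (bracket E (of_section E u) (torsion_element E \<Theta> N)) (of_section E v)) \<and>
     torsion_element E \<Theta> N = (\<lambda>c x. - (1 / 2) *\<^sub>R
       (bracket E (bracket E (endo_element E N) \<Theta>) (endo_element E N) c x + l *\<^sub>R \<Theta> c x))"
proof -
  interpret courant_endomorphism E N \<Theta> l
    by unfold_locales (use assms in \<open>auto simp: is_courant_def\<close>)
  have left: "torsion E \<Theta> N (\<lambda>x. f x *\<^sub>R u x + h x *\<^sub>R u' x) v =
      (\<lambda>x. f x *\<^sub>R torsion E \<Theta> N u v x + h x *\<^sub>R torsion E \<Theta> N u' v x)"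
    if "u \<in> sections E" "u' \<in> sections E" "v \<in> sections E" "f \<in> smooth_functions E" "h \<in> smooth_functions E"
    for u u' v f h
    by (rule ext) (rule torsion_linear_left[OF that])
  have skew: "torsion E \<Theta> N v u = (\<lambda>x. - torsion E \<Theta> N u v x)"
    if "u \<in> sections E" "v \<in> sections E" for u v
    by (rule ext) (rule torsion_skew[OF that])
  have right: "torsion E \<Theta> N u (\<lambda>x. f x *\<^sub>R v x + h x *\<^sub>R v' x) =
      (\<lambda>x. f x *\<^sub>R torsion E \<Theta> N u v x + h x *\<^sub>R torsion E \<Theta> N u v' x)"
    if u: "u \<in> sections E" and v: "v \<in> sections E" and v': "v' \<in> sections E"
      and f: "f \<in> smooth_functions E" and h: "h \<in> smooth_functions E" for u v v' f h
  proof -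
    have w: "(\<lambda>x. f x *\<^sub>R v x + h x *\<^sub>R v' x) \<in> sections E"
      using section_combination[OF v v'] f h by (simp add: smooth_functions_def)
    \<comment> \<open>Linearity in the second argument is linearity in the first between two
      applications of \<open>skew\<close>.\<close>
    show ?thesis
      unfolding skew[OF w u] left[OF v v' u f h] skew[OF u v] skew[OF u v'] by (simp add: add.commute)
  qed
  have ex1: "\<exists>!a. represents_3_tensor E (torsion_tensor E \<Theta> N) a"
    using represents_tors represents_unique by blast
  show ?thesis
    unfolding torsion_element_eq
    by (intro conjI ballI torsion_section left right skew torsion_tensor_skew_3_tensor ex1
        of_section_torsion torsion_form_endo_element)
qed

end
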